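(* Let $(g,\mathbf{v})\in\mathbb{R}\times\mathbb{R}^\infty$ be an admissible pair. Then there exist sequences $(\alpha(d))_{d\ge1}$, $(u(d))_{d\ge1}$ of positive real numbers such that the refined assumption (defined in the context) is satisfied with $g'=0$; that is, $v_1>0$, $M^{(\alpha(d))}_{u(d);\mathbf{v}}(\lambda)\ge0$ for all $\lambda\in\mathbb{Y}$ and all $d\in\mathbb{Z}_{\ge1}$, and $$\frac{\alpha(d)}{u(d)^2}=\frac1d+o\Big(\frac1d\Big),\qquad\frac{\alpha(d)-1}{u(d)}=g+o\Big(\frac1{\sqrt d}\Big)\qquad\text{as }d\to\infty.$$ Explicitly: (1) if $g>0$, then we can choose $\alpha(d)=g^2d$, $u(d)=\lceil gd\rceil$; (2) if $g<0$, then we can choose $\alpha(d)=\frac1{g^2d}$, $u(d)=\frac{\lceil-gd\rceil}{g^2d}$.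
   Context: $\mathbb{Y}$ is the set of all partitions, and $\mathrm{Sym}=\mathbb{R}[p_1,p_2,\dots]$ is the real algebra of symmetric functions, with $p_k$ the power sums. For $\alpha>0$, $J^{(\alpha)}_\lambda$ is the integral form Jack symmetric function (Macdonald, Ch. VI.10): orthogonal for $\langle p_\lambda,p_\mu\rangle=\delta_{\lambda\mu}\alpha^{\ell(\lambda)}z_\lambda$ (where $z_\lambda=\prod_i i^{m_i}m_i!$ and $m_i$ is the number of parts of $\lambda$ equal to $i$), dominance-triangular in the monomial symmetric functions, with coefficient of $p_1^{|\lambda|}$ equal to $1$. Put $j^{(\alpha)}_\lambda:=\prod_{(i,j)\in\lambda}(\alpha(\lambda_i-j)+(\lambda_j'-i)+1)(\alpha(\lambda_i-j)+(\lambda'_j-i)+\alpha)>0$, where $\lambda'$ is the conjugate partition. For $u>0$ and $\mathbf{v}=(v_1,v_2,\dots)\in\mathbb{R}^\infty$, $J^{(\alpha)}_\lambda(u\cdot\mathbf{v})$ is the image of $J^{(\alpha)}_\lambda$ under the unital algebra homomorphism $p_k\mapsto uv_k$, and $$M^{(\alpha)}_{u;\mathbf{v}}(\lambda):=\exp\Big(-\frac{u^2v_1}{\alpha}\Big)\frac{J^{(\alpha)}_\lambda(u\cdot\mathbf{v})\,u^{|\lambda|}}{j^{(\alpha)}_\lambda},\qquad\lambda\in\mathbb{Y}.$$ Refined assumption, for parameters $g,g'\in\mathbb{R}$, $\mathbf{v}\in\mathbb{R}^\infty$ and sequences $(\alpha(d))_{d\ge1}$, $(u(d))_{d\ge1}$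 of positive reals: $v_1>0$; $M^{(\alpha(d))}_{u(d);\mathbf{v}}(\lambda)\ge0$ for all $\lambda\in\mathbb{Y}$, $d\in\mathbb{Z}_{\ge1}$; and, as $d\to\infty$, $\frac{\alpha(d)}{u(d)^2}=\frac1d+o(\frac1d)$ and $\frac{\alpha(d)-1}{u(d)}=g+\frac{g'}{\sqrt d}+o(\frac1{\sqrt d})$. A sequence $\mathbf{v}=(v_1,v_2,\dots)\in\mathbb{R}^\infty$ determines a totally Jack-positive specialization if the unital algebra homomorphism $\rho\colon\mathrm{Sym}\to\mathbb{R}$ with $\rho(p_k)=v_k$ for all $k\ge1$ satisfies $\rho(J^{(\alpha)}_\lambda)\ge0$ for all $\lambda\in\mathbb{Y}$ and all $\alpha>0$. The pair $(g,\mathbf{v})\in\mathbb{R}\times\mathbb{R}^\infty$ is admissible if either $g>0$ and $\mathbf{v}$ determines a totally Jack-positive specialization, or $g<0$ and $\pm\mathbf{v}:=((-1)^{j-1}v_j)_{j\ge1}$ determines a totally Jack-positive specialization.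
   Formalization: The formal theorem additionally assumes that v is not the zero sequence, since (g,0) with g≠0 is admissible as defined but violates the required v_1>0. *)

theory Defs
  imports
    "HOL-Analysis.Analysis"
    "HOL-Library.Multiset"
    "HOL-Library.Poly_Mapping"
    "HOL-Library.Landau_Symbols"
begin

section \<open>Partitions\<close>

typedef partition = "{A :: nat multiset. 0 \<notin># A}"
  morphisms parts Abs_partition
  by (rule exI[of _ "{#}"]) simp

setup_lifting type_definition_partition

text \<open>
  The additive monoid structure is the union of parts, so that \<open>partition \<Rightarrow>\<^sub>0 real\<close> with its
  library ring structure is the polynomial ring in the power sums.
\<close>

instantiation partition :: cancel_comm_monoid_add
begin

lift_definition zero_partition :: partition is "{#}" by simp
lift_definition plus_partition :: "partition \<Rightarrow> partition \<Rightarrow> partition" is "(+)" by simp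
lift_definition minus_partition :: "partition \<Rightarrow> partition \<Rightarrow> partition" is "(-)"
  by (auto dest: in_diffD)

instance
proof
  fix a b c :: partition
  show "a + b + c = a + (b + c)" by transfer (simp add: add.assoc)
  show "a + b = b + a" by transfer (simp add: add.commute)
  show "0 + a = a" by transfer simp
  show "a + b - a = b" by transfer simp
  show "a - b - c = a - (b + c)" by transfer (simp add: diff_diff_add)
qed

end

definition psize :: "partition \<Rightarrow> nat" where
  "psize \<kappa> = sum_mset (parts \<kappa>)"

definition plen :: "partition \<Rightarrow> nat" where
  "plen \<kappa> = size (parts \<kappa>)"

text \<open>Rows and columns are numbered from 1.\<close>

definition row :: "partition \<Rightarrow> nat \<Rightarrow> nat" where
  "row \<kappa> i = (if 1 \<le> i \<and> i \<le> plen \<kappa>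
      then rev (sorted_list_of_multiset (parts \<kappa>)) ! (i - 1) else 0)"

definition col :: "partition \<Rightarrow> nat \<Rightarrow> nat" where
  "col \<kappa> j = size {#p \<in># parts \<kappa>. j \<le> p#}"

definition boxes :: "partition \<Rightarrow> (nat \<times> nat) set" where
  "boxes \<kappa> = {(i, j). 1 \<le> i \<and> i \<le> plen \<kappa> \<and> 1 \<le> j \<and> j \<le> row \<kappa> i}"

definition dominated :: "partition \<Rightarrow> partition \<Rightarrow> bool" where
  "dominated \<mu> \<kappa> \<longleftrightarrow> psize \<mu> = psize \<kappa> \<and>
     (\<forall>k. (\<Sum>i = 1..k. row \<mu> i) \<le> (\<Sum>i = 1..k. row \<kappa> i))"

lift_definition ones :: "nat \<Rightarrow> partition" is "\<lambda>n. replicate_mset n 1" by simp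

definition zee :: "partition \<Rightarrow> nat" where
  "zee \<kappa> = (\<Prod>i\<in>set_mset (parts \<kappa>). i ^ count (parts \<kappa>) i * fact (count (parts \<kappa>) i))"


section \<open>Symmetric functions\<close>

text \<open>The basis element \<open>Poly_Mapping.single \<kappa> 1\<close> is the power sum product \<open>p\<^sub>\<kappa>\<close>.\<close>

type_synonym sym = "partition \<Rightarrow>\<^sub>0 real"

lift_definition single_part :: "nat \<Rightarrow> partition" is "\<lambda>k. if k = 0 then {#} else {#k#}" by simp

definition powersum :: "nat \<Rightarrow> sym" where
  "powersum k = Poly_Mapping.single (single_part k) 1"

text \<open>
  The unital algebra homomorphism with \<open>p\<^sub>k \<mapsto> v\<^sub>k\<close> for \<open>k \<ge> 1\<close>.  A sequence
  \<open>(v\<^sub>1, v\<^sub>2, \<dots>)\<close> is a function on \<^typ>\<open>nat\<close> whose value at 0 is irrelevant.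
\<close>

definition spec :: "(nat \<Rightarrow> real) \<Rightarrow> sym \<Rightarrow> real" where
  "spec v F = (\<Sum>\<kappa>\<in>Poly_Mapping.keys F. Poly_Mapping.lookup F \<kappa> * (\<Prod>k\<in>#parts \<kappa>. v k))"

lemma spec_superset:
  assumes "finite A" "Poly_Mapping.keys F \<subseteq> A"
  shows "spec v F = (\<Sum>\<kappa>\<in>A. Poly_Mapping.lookup F \<kappa> * (\<Prod>k\<in>#parts \<kappa>. v k))"
  unfolding spec_def using assms
  by (intro sum.mono_neutral_left) (auto simp: in_keys_iff)

lemma spec_single: "spec v (Poly_Mapping.single \<kappa> c) = c * (\<Prod>k\<in>#parts \<kappa>. v k)"
  by (subst spec_superset[of "{\<kappa>}"]) (auto split: if_splits)

lemma spec_powersum: "k \<ge> 1 \<Longrightarrow> spec v (powersum k) = v k"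
  by (simp add: powersum_def spec_single single_part.rep_eq)

lemma spec_one: "spec v 1 = 1"
  by (simp add: spec_single zero_partition.rep_eq flip: single_one)

lemma spec_add: "spec v (F + G) = spec v F + spec v G"
proof -
  let ?A = "Poly_Mapping.keys F \<union> Poly_Mapping.keys G"
  have "Poly_Mapping.keys (F + G) \<subseteq> ?A"
    by (rule Poly_Mapping.keys_add)
  then show ?thesis
    by (simp add: spec_superset[of ?A] lookup_add distrib_right sum.distrib)
qed

lemma sym_induct [case_names zero add_single]:
  assumes "P (0 :: sym)"
    and "\<And>F \<kappa> c. P F \<Longrightarrow> P (F + Poly_Mapping.single \<kappa> c)"
  shows "P F"
proof (induction F rule: Poly_Mapping.update_induct)
  case const
  show ?case using assms(1) .
next
  case (update F \<kappa> c)
  have "Poly_Mapping.update \<kappa> c F = F + Poly_Mapping.single \<kappa> c"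
    using update by (intro poly_mapping_eqI)
      (auto simp: lookup_update lookup_add lookup_single in_keys_iff when_def)
  then show ?case using assms(2) update by simp
qed

lemma spec_mult: "spec v (F * G) = spec v F * spec v G"
proof -
  have 0: "spec v 0 = 0" by (simp add: spec_def)
  have 1: "spec v (Poly_Mapping.single \<kappa> c * H) = spec v (Poly_Mapping.single \<kappa> c) * spec v H" for \<kappa> c H
    by (induction H rule: sym_induct)
      (simp_all add: 0 mult_single spec_single plus_partition.rep_eq spec_add distrib_left)
  show ?thesis
    by (induction F rule: sym_induct)
      (simp_all add: 1 0 spec_add distrib_right)
qed

lemma spec_scale: "spec v (Poly_Mapping.single 0 c * F) = c * spec v F"
  by (simp add: spec_mult spec_single zero_partition.rep_eq)

text \<open>
  The monomial symmetric polynomial \<open>m\<^sub>\<mu>(x\<^sub>0, \<dots>, x\<^bsub>N-1\<^esub>)\<close>: the sum of all distinct monomials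
  whose nonzero exponents are, up to order, the parts of \<open>\<mu>\<close>.
\<close>

definition exponents :: "nat \<Rightarrow> partition \<Rightarrow> (nat \<Rightarrow> nat) set" where
  "exponents N \<mu> = {a. (\<forall>i\<ge>N. a i = 0) \<and>
      {#k \<in># image_mset a (mset_set {..<N}). k \<noteq> 0#} = parts \<mu>}"

definition monomial_poly :: "partition \<Rightarrow> nat \<Rightarrow> (nat \<Rightarrow> real) \<Rightarrow> real" where
  "monomial_poly \<mu> N x = (\<Sum>a\<in>exponents N \<mu>. \<Prod>i<N. x i ^ a i)"

text \<open>
  \<open>F\<close> lies in the span of the \<open>m\<^sub>\<mu>\<close> with \<open>\<mu> \<le> \<kappa>\<close> in dominance order.  An identity between
  symmetric functions is an identity between their values in any finite number of variables,
  where \<open>p\<^sub>k\<close> becomes \<open>x\<^sub>0\<^sup>k + \<dots> + x\<^bsub>N-1\<^esub>\<^sup>k\<close>.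
\<close>

definition dominance_triangular :: "partition \<Rightarrow> sym \<Rightarrow> bool" where
  "dominance_triangular \<kappa> F \<longleftrightarrow> (\<exists>c :: partition \<Rightarrow> real. \<forall>N x.
     spec (\<lambda>k. \<Sum>i<N. x i ^ k) F = (\<Sum>\<mu> | dominated \<mu> \<kappa>. c \<mu> * monomial_poly \<mu> N x))"

lemma finite_exponents: "finite (exponents N \<mu>)"
proof (rule finite_subset)
  show "exponents N \<mu> \<subseteq> {a. \<forall>i. (i \<in> {..<N} \<longrightarrow> a i \<in> insert 0 (set_mset (parts \<mu>))) \<and>
      (i \<notin> {..<N} \<longrightarrow> a i = 0)}"
  proof
    fix a assume a: "a \<in> exponents N \<mu>"
    have "a i \<in> insert 0 (set_mset (parts \<mu>))" if "i < N" for i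
    proof (cases "a i = 0")
      case False
      have "{#k \<in># image_mset a (mset_set {..<N}). k \<noteq> 0#} = parts \<mu>"
        using a unfolding exponents_def by blast
      moreover have "a i \<in># {#k \<in># image_mset a (mset_set {..<N}). k \<noteq> 0#}"
        using that False by auto
      ultimately show ?thesis by simp
    qed simp
    moreover have "a i = 0" if "i \<ge> N" for i
      using a that by (simp add: exponents_def)
    ultimately show "a \<in> {a. \<forall>i. (i \<in> {..<N} \<longrightarrow> a i \<in> insert 0 (set_mset (parts \<mu>))) \<and>
      (i \<notin> {..<N} \<longrightarrow> a i = 0)}" by auto
  qed
  show "finite {a. \<forall>i. (i \<in> {..<N} \<longrightarrow> a i \<in> insert 0 (set_mset (parts \<mu>))) \<and>
      (i \<notin> {..<N} \<longrightarrow> a i = 0)}"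
    by (rule finite_set_of_finite_funs) auto
qed

lemma finite_dominated: "finite {\<mu>. dominated \<mu> \<kappa>}"
proof -
  let ?n = "psize \<kappa>"
  have "parts \<mu> \<in> mset ` {xs. set xs \<subseteq> {..?n} \<and> length xs \<le> ?n}" if d: "dominated \<mu> \<kappa>" for \<mu>
  proof -
    obtain xs where xs: "mset xs = parts \<mu>" using ex_mset by blast
    have s: "sum_list xs = ?n"
      using d xs by (metis dominated_def psize_def sum_mset_sum_list)
    have "0 \<notin> set xs" using xs parts[of \<mu>] by (metis mem_Collect_eq set_mset_mset)
    then have "length xs \<le> sum_list xs"
      by (induction xs) auto
    moreover have "set xs \<subseteq> {..?n}"
      using member_le_sum_list[of _ xs] s by auto
    ultimately show ?thesis using xs s by (intro image_eqI[of _ _ xs]) auto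
  qed
  then have "parts ` {\<mu>. dominated \<mu> \<kappa>} \<subseteq> mset ` {xs. set xs \<subseteq> {..?n} \<and> length xs \<le> ?n}"
    by auto
  then have "finite (parts ` {\<mu>. dominated \<mu> \<kappa>})"
    by (rule finite_subset) (intro finite_imageI finite_lists_length_le, simp)
  then show ?thesis
    by (rule finite_imageD) (simp add: inj_on_def parts_inject)
qed


section \<open>Jack symmetric functions\<close>

text \<open>The bilinear form with \<open>\<langle>p\<^sub>\<kappa>, p\<^sub>\<mu>\<rangle> = \<delta>\<^bsub>\<kappa>\<mu>\<^esub> \<alpha>\<^bsup>\<ell>(\<kappa>)\<^esup> z\<^sub>\<kappa>\<close>.\<close>

definition jack_inner :: "real \<Rightarrow> sym \<Rightarrow> sym \<Rightarrow> real" where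
  "jack_inner \<alpha> F G = (\<Sum>\<kappa>\<in>Poly_Mapping.keys F.
     Poly_Mapping.lookup F \<kappa> * Poly_Mapping.lookup G \<kappa> * \<alpha> ^ plen \<kappa> * real (zee \<kappa>))"

definition is_jack_family :: "real \<Rightarrow> (partition \<Rightarrow> sym) \<Rightarrow> bool" where
  "is_jack_family \<alpha> J \<longleftrightarrow>
     (\<forall>\<kappa> \<mu>. \<kappa> \<noteq> \<mu> \<longrightarrow> jack_inner \<alpha> (J \<kappa>) (J \<mu>) = 0) \<and>
     (\<forall>\<kappa>. dominance_triangular \<kappa> (J \<kappa>)) \<and>
     (\<forall>\<kappa>. Poly_Mapping.lookup (J \<kappa>) (ones (psize \<kappa>)) = 1)"

text \<open>For \<open>\<alpha> > 0\<close> there is exactly one such family, by the classical theory of Jack functions.\<close>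

definition jack :: "real \<Rightarrow> partition \<Rightarrow> sym" where
  "jack \<alpha> = (THE J. is_jack_family \<alpha> J)"

definition jack_norm :: "real \<Rightarrow> partition \<Rightarrow> real" where
  "jack_norm \<alpha> \<kappa> = (\<Prod>(i, j)\<in>boxes \<kappa>.
     (\<alpha> * (real (row \<kappa> i) - real j) + (real (col \<kappa> j) - real i) + 1) *
     (\<alpha> * (real (row \<kappa> i) - real j) + (real (col \<kappa> j) - real i) + \<alpha>))"

definition jack_measure :: "real \<Rightarrow> real \<Rightarrow> (nat \<Rightarrow> real) \<Rightarrow> partition \<Rightarrow> real" where
  "jack_measure \<alpha> u v \<kappa> =
     exp (- (u\<^sup>2 * v 1) / \<alpha>) * (spec (\<lambda>k. u * v k) (jack \<alpha> \<kappa>) * u ^ psize \<kappa> / jack_norm \<alpha> \<kappa>)"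


section \<open>Positivity and the refined assumption\<close>

definition totally_jack_positive :: "(nat \<Rightarrow> real) \<Rightarrow> bool" where
  "totally_jack_positive v \<longleftrightarrow> (\<forall>\<kappa>. \<forall>\<alpha>>0. spec v (jack \<alpha> \<kappa>) \<ge> 0)"

definition twist :: "(nat \<Rightarrow> real) \<Rightarrow> nat \<Rightarrow> real" where
  "twist v j = (- 1) ^ (j - 1) * v j"

definition admissible :: "real \<Rightarrow> (nat \<Rightarrow> real) \<Rightarrow> bool" where
  "admissible g v \<longleftrightarrow>
     (g > 0 \<and> totally_jack_positive v) \<or> (g < 0 \<and> totally_jack_positive (twist v))"

text \<open>Sequences indexed by \<open>d \<ge> 1\<close> are functions on \<^typ>\<open>nat\<close> whose value at 0 is irrelevant.\<close>

definition refined_assumption ::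
  "real \<Rightarrow> real \<Rightarrow> (nat \<Rightarrow> real) \<Rightarrow> (nat \<Rightarrow> real) \<Rightarrow> (nat \<Rightarrow> real) \<Rightarrow> bool" where
  "refined_assumption g g' v \<alpha> u \<longleftrightarrow>
     (\<forall>d\<ge>1. \<alpha> d > 0 \<and> u d > 0) \<and>
     v 1 > 0 \<and>
     (\<forall>d\<ge>1. \<forall>\<kappa>. jack_measure (\<alpha> d) (u d) v \<kappa> \<ge> 0) \<and>
     (\<lambda>d. \<alpha> d / (u d)\<^sup>2 - 1 / real d) \<in> o(\<lambda>d. 1 / real d) \<and>
     (\<lambda>d. (\<alpha> d - 1) / u d - (g + g' / sqrt (real d))) \<in> o(\<lambda>d. 1 / sqrt (real d))"

end

theory Submission
  imports Defs "HOL-Analysis.Finite_Function_Topology" "HOL-Real_Asymp.Real_Asymp"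
begin

text \<open>
  A totally Jack-positive \<open>v\<close> is nonnegative on all Jack functions for every \<open>\<alpha>\<close>; as
  \<open>\<alpha> \<rightarrow> \<infinity>\<close> these degenerate to monomial symmetric functions, so \<open>v\<close> is nonnegative on those.
  The coproduct of a monomial symmetric function has nonnegative coefficients, hence every
  multiple \<open>n v\<close> with \<open>n\<close> a positive integer is also nonnegative on monomial functions, and
  then on all Jack functions, because their monomial coefficients are nonnegative. This settles
  \<open>g > 0\<close>; the case \<open>g < 0\<close> follows from the duality \<open>p\<^sub>k \<mapsto> (-1)\<^sup>k\<^sup>-\<^sup>1 \<alpha> p\<^sub>k\<close>, which
  exchanges \<open>\<alpha>\<close> and \<open>1 / \<alpha>\<close>.

  The properties of Jack functions come from one family of operators \<open>R D\<^sup>l R\<^sup>*\<close>, built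
  from a Lax (Dunkl) operator \<open>D\<close> acting on symmetric functions with a distinguished variable.
  In power sums they are visibly self-adjoint; on monomial functions they are triangular for the
  dominance order, and their joint eigenvalues separate partitions. Therefore Gram--Schmidt along
  dominance gives joint eigenvectors, which are orthogonal. For \<open>l = 1\<close> the off-diagonal
  coefficients are nonnegative and the eigenvalues are monotone in dominance, so the eigenvector
  equation determines the monomial coefficients recursively as nonnegative numbers, and bounds
  them by \<open>O(1 / \<alpha>)\<close> off the diagonal. Finally, the duality maps the operators for \<open>\<alpha>\<close> to
  those for \<open>1 / \<alpha>\<close>, so it permutes the eigenlines.
\<close>

section \<open>Linear maps and bilinear forms on free vector spaces\<close>

text \<open>The measure evaluates Jack functions at \<open>u v\<close>, while total positivity
  speaks of \<open>v\<close>. The coproduct reaches integer multiples only, which is why a ceiling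
  enters \<open>u\<close>; for g < 0 the duality contributes a further factor \<alpha>. Rounding
  moves the integer by less than 1, a relative error of order 1/d, and both asymptotic conditions
  absorb it. \<open>jack\<close> is a definite description, so both existence and uniqueness of Jack
  functions must be established before anything can be said about it. One operator is not enough for
  orthogonality. For l = 1 the eigenvalue is, up to a factor \<alpha>, \<alpha> times the sum of the
  squared rows minus the sum of the squared columns; the incomparable partitions (4,1,1) and (3,3)
  give 18 \<alpha> - 12 both times. All powers l are used to separate partitions, whereas below a
  fixed partition l = 1 already separates and yields signs and bounds. Augmented monomials replace
  monomials because their recursion has integer coefficients and no symmetry factors, and makes
  sense in every commutative ring.\<close>

lemma lookup_scaleR [simp]:
  fixes F :: "'a \<Rightarrow>\<^sub>0 real"
  shows "Poly_Mapping.lookup (r *\<^sub>R F) k = r * Poly_Mapping.lookup F k"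
proof -
  have "finite {i. r * Poly_Mapping.lookup F i \<noteq> 0}"
    by (rule finite_subset[OF _ finite_lookup[of F]]) auto
  then show ?thesis
    by (simp add: scaleR_poly_mapping_def Abs_poly_mapping_inverse)
qed

lemma scaleR_single: "r *\<^sub>R Poly_Mapping.single k x = Poly_Mapping.single k (r * x :: real)"
  by (rule poly_mapping_eqI) (simp add: lookup_single when_def)

lemma scaleR_eq_times:
  fixes F :: "'a::comm_monoid_add \<Rightarrow>\<^sub>0 real"
  shows "r *\<^sub>R F = Poly_Mapping.single 0 r * F"
  by (rule poly_mapping_eqI) (simp flip: mult_map_scale_conv_mult add: map.rep_eq when_def)

lemma mult_scaleR_poly:
  fixes F G :: "'a::comm_monoid_add \<Rightarrow>\<^sub>0 real"
  shows "(r *\<^sub>R F) * G = r *\<^sub>R (F * G)" and "F * (r *\<^sub>R G) = r *\<^sub>R (F * G)"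
  by (simp_all add: scaleR_eq_times algebra_simps)

definition lin :: "('a \<Rightarrow> 'b::real_vector) \<Rightarrow> ('a \<Rightarrow>\<^sub>0 real) \<Rightarrow> 'b" where
  "lin T F = (\<Sum>k\<in>Poly_Mapping.keys F. Poly_Mapping.lookup F k *\<^sub>R T k)"

lemma lin_superset:
  assumes "finite A" "Poly_Mapping.keys F \<subseteq> A"
  shows "lin T F = (\<Sum>k\<in>A. Poly_Mapping.lookup F k *\<^sub>R T k)"
  unfolding lin_def using assms by (intro sum.mono_neutral_left) (auto simp: in_keys_iff)

lemma linear_lin [simp]: "linear (lin T)"
proof
  fix F G :: "'a \<Rightarrow>\<^sub>0 real" and r :: real
  let ?A = "Poly_Mapping.keys F \<union> Poly_Mapping.keys G"
  have "Poly_Mapping.keys (F + G) \<subseteq> ?A" by (rule Poly_Mapping.keys_add)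
  then show "lin T (F + G) = lin T F + lin T G"
    by (simp add: lin_superset[of ?A] lookup_add scaleR_add_left sum.distrib)
  have "Poly_Mapping.keys (r *\<^sub>R F) \<subseteq> Poly_Mapping.keys F" by (auto simp: in_keys_iff)
  then show "lin T (r *\<^sub>R F) = r *\<^sub>R lin T F"
    by (simp add: lin_superset[of "Poly_Mapping.keys F"] scaleR_sum_right)
qed

lemma lin_single [simp]: "lin T (Poly_Mapping.single k c) = c *\<^sub>R T k"
  by (simp add: lin_def)

lemma poly_mapping_span: "F \<in> span (range (\<lambda>k. Poly_Mapping.single k (1::real)))"
proof (induction F rule: Poly_Mapping.update_induct)
  case const then show ?case by (rule span_zero)
next
  case (update F k c)
  have "Poly_Mapping.update k c F = F + c *\<^sub>R Poly_Mapping.single k 1"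
    using update by (intro poly_mapping_eqI)
      (auto simp: lookup_update lookup_add lookup_single in_keys_iff when_def)
  then show ?case using update(3) by (metis span_add span_scale span_base rangeI)
qed

lemma linear_ext_single:
  assumes "linear S" "linear T" "\<And>k. S (Poly_Mapping.single k (1::real)) = T (Poly_Mapping.single k 1)"
  shows "S F = T F"
  by (rule linear_eq_on[OF assms(1,2) poly_mapping_span]) (use assms(3) in auto)

text \<open>Diagonal in the basis with weight \<open>w\<close>; the basis is left general because
  the form is needed on \<open>sym\<close> and on \<open>wsym\<close>.\<close>

definition form :: "('a \<Rightarrow> real) \<Rightarrow> ('a \<Rightarrow>\<^sub>0 real) \<Rightarrow> ('a \<Rightarrow>\<^sub>0 real) \<Rightarrow> real" where
  "form w F G = lin (\<lambda>k. Poly_Mapping.lookup G k * w k) F"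

lemma linear_form_left: "linear (\<lambda>F. form w F G)"
  unfolding form_def by simp

lemma form_commute: "form w F G = form w G F"
proof -
  let ?A = "Poly_Mapping.keys F \<union> Poly_Mapping.keys G"
  show ?thesis by (simp add: form_def lin_superset[of ?A] mult_ac)
qed

lemma linear_form_right: "linear (\<lambda>G. form w F G)"
  by (subst form_commute) (rule linear_form_left)

lemmas form_linear = linear_add[OF linear_form_left] linear_scale[OF linear_form_left]
  linear_diff[OF linear_form_left] linear_0[OF linear_form_left]
  linear_add[OF linear_form_right] linear_scale[OF linear_form_right]
  linear_diff[OF linear_form_right] linear_0[OF linear_form_right]

lemma form_pos:
  assumes "\<And>k. w k > 0" "form w F F = 0" shows "F = 0"
proof (rule ccontr)
  assume "F \<noteq> 0"
  then have "Poly_Mapping.keys F \<noteq> {}" by simp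
  then have "(\<Sum>k\<in>Poly_Mapping.keys F. Poly_Mapping.lookup F k * (Poly_Mapping.lookup F k * w k)) > 0"
    using assms(1) by (intro sum_pos) (auto simp: in_keys_iff mult.assoc[symmetric] zero_less_mult_iff linorder_neq_iff)
  then show False using assms(2) by (simp add: form_def lin_def)
qed

text \<open>By bilinearity adjointness is a statement about matrix entries in the two bases.\<close>

lemma form_lin_adjoint:
  assumes "\<And>k j. w' j * Poly_Mapping.lookup (S k) j = w k * Poly_Mapping.lookup (T j) k"
  shows "form w' (lin S F) G = form w F (lin T G)"
proof -
  have "form w' (lin S (Poly_Mapping.single k 1)) G = form w (Poly_Mapping.single k 1) (lin T G)" for k
  proof (rule linear_ext_single[of "\<lambda>G. form w' (lin S (Poly_Mapping.single k 1)) G"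
        "\<lambda>G. form w (Poly_Mapping.single k 1) (lin T G)"])
    show "linear (\<lambda>G. form w (Poly_Mapping.single k 1) (lin T G))"
      using linear_compose[OF linear_lin linear_form_right] by (simp add: o_def)
    show "form w' (lin S (Poly_Mapping.single k 1)) (Poly_Mapping.single j 1) =
        form w (Poly_Mapping.single k 1) (lin T (Poly_Mapping.single j 1))" for j
      using assms[of j k] by (subst form_commute) (simp add: form_def mult_ac)
  qed (rule linear_form_right)
  note single = this
  have "linear (\<lambda>F. form w' (lin S F) G)"
    using linear_compose[OF linear_lin linear_form_left] by (simp add: o_def)
  from linear_ext_single[OF this linear_form_left single] show ?thesis .
qed

text \<open>Gram-Schmidt: \<open>s\<close> is first made orthogonal to \<open>span S\<close>, then
  the component of \<open>x\<close> in that one new direction is added.\<close>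

lemma orthogonal_projection:
  assumes w: "\<And>k. w k > 0" and "finite S"
  shows "\<exists>y\<in>span S. \<forall>z\<in>span S. form w (x - y) z = 0"
  using \<open>finite S\<close>
proof (induction S arbitrary: x)
  case empty
  show ?case by (simp add: linear_0[OF linear_form_right])
next
  case (insert s S)
  obtain y where y: "y \<in> span S" "\<And>z. z \<in> span S \<Longrightarrow> form w (x - y) z = 0" using insert.IH by blast
  obtain s' where s': "s' \<in> span S" "\<And>z. z \<in> span S \<Longrightarrow> form w (s - s') z = 0"
    using insert.IH by blast
  define e where "e = s - s'"
  \<comment> \<open>\<open>s\<close> may already lie in \<open>span S\<close>; then
    \<open>e = 0\<close>, and division by zero gives the harmless coefficient 0.\<close>
  define c where "c = form w x e / form w e e"
  have ey: "form w y e = 0" using s'(2)[OF y(1)] by (simp add: form_commute e_def)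
  have c: "c * form w e e = form w x e"
  proof (cases "e = 0")
    case True then show ?thesis by (simp add: linear_0[OF linear_form_right])
  next
    case False then show ?thesis using form_pos[of w e, OF w] by (auto simp: c_def)
  qed
  have sp: "span S \<subseteq> span (insert s S)" by (intro span_mono) auto
  have mem: "y + c *\<^sub>R e \<in> span (insert s S)"
    unfolding e_def using y(1) s'(1) sp
    by (intro span_add span_scale span_diff) (auto intro: span_base)
  have "form w (x - (y + c *\<^sub>R e)) z = 0" if zin: "z \<in> span (insert s S)" for z
  proof -
    obtain k where k: "z - k *\<^sub>R s \<in> span S" using iffD1[OF span_breakdown_eq zin] by blast
    define u where "u = z - k *\<^sub>R s + k *\<^sub>R s'"
    have u: "u \<in> span S" unfolding u_def using k s'(1) by (intro span_add span_scale)
    have z: "z = u + k *\<^sub>R e" by (simp add: u_def e_def algebra_simps)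
    have 1: "form w (x - y) u = 0" "form w e u = 0" using y(2) s'(2) u by (auto simp: e_def)
    have 2: "form w (x - y) e = c * form w e e"
      using ey c by (simp add: form_linear)
    have "form w (x - (y + c *\<^sub>R e)) v = form w (x - y) v - c * form w e v" for v
      by (simp add: form_linear diff_diff_add[symmetric])
    then show ?thesis unfolding z using 1 2 by (simp add: form_linear)
  qed
  then show ?case using mem by blast
qed

lemma span_image_expansion:
  assumes "finite D" "x \<in> span (f ` D)" shows "\<exists>c. x = (\<Sum>A\<in>D. c A *\<^sub>R f A)"
proof -
  let ?V = "{x. \<exists>c. x = (\<Sum>A\<in>D. c A *\<^sub>R f A)}"
  have "subspace ?V"
  proof (rule subspaceI)
    show "0 \<in> ?V" by (auto intro!: exI[of _ "\<lambda>_. 0"])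
    fix x y and r :: real assume "x \<in> ?V"
    then obtain c where c: "x = (\<Sum>A\<in>D. c A *\<^sub>R f A)" by blast
    show "r *\<^sub>R x \<in> ?V" unfolding c by (auto intro!: exI[of _ "\<lambda>A. r * c A"] simp: scaleR_sum_right)
    assume "y \<in> ?V"
    then obtain d where d: "y = (\<Sum>A\<in>D. d A *\<^sub>R f A)" by blast
    show "x + y \<in> ?V" unfolding c d
      by (auto intro!: exI[of _ "\<lambda>A. c A + d A"] simp: scaleR_add_left sum.distrib)
  qed
  moreover have "f ` D \<subseteq> ?V"
  proof clarify
    fix A assume "A \<in> D"
    then show "\<exists>c. f A = (\<Sum>B\<in>D. c B *\<^sub>R f B)" using assms(1)
      by (intro exI[of _ "\<lambda>B. if B = A then 1 else 0"]) (simp add: if_distrib[of "\<lambda>x. x *\<^sub>R _"] cong: if_cong)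
  qed
  ultimately have "span (f ` D) \<subseteq> ?V" by (intro span_minimal)
  then show ?thesis using assms(2) by blast
qed

section \<open>Augmented monomial functions\<close>

text \<open>
  When \<open>q k\<close> is the \<open>k\<close>-th power sum, this is the sum of all monomials with exponents \<open>xs\<close> over
  ordered tuples of distinct variables: a further power sum either brings in a new variable or
  hits one of the old ones.
\<close>

fun mono_list :: "(nat \<Rightarrow> 'r::comm_ring_1) \<Rightarrow> nat list \<Rightarrow> 'r" where
  "mono_list q [] = 1"
| "mono_list q (k # xs) = q k * mono_list q xs - (\<Sum>t<length xs. mono_list q (xs[t := xs ! t + k]))"

text \<open>Sorting only picks one order of the parts; \<open>inv\<close> below shows that every
  order gives the same value. The general ring lets one recursion serve \<open>sym\<close>,
  \<open>wsym\<close> and real sequences.\<close>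

definition aug :: "(nat \<Rightarrow> 'r::comm_ring_1) \<Rightarrow> nat multiset \<Rightarrow> 'r" where
  "aug q A = mono_list q (sorted_list_of_multiset A)"

lemma sum_mset_pick_add:
  "(\<Sum>c\<in>#add_mset k A. f c (add_mset k A - {#c#})) = f k A + (\<Sum>c\<in>#A. f c (add_mset k (A - {#c#})))"
proof -
  have "image_mset (\<lambda>c. f c (add_mset k A - {#c#})) A = image_mset (\<lambda>c. f c (add_mset k (A - {#c#}))) A"
    by (rule image_mset_cong) auto
  then show ?thesis by simp
qed

text \<open>Both sides run over ordered pairs of different occurrences; the induction separates the
  pairs that involve the added element.\<close>

lemma sum_mset_pick_swap:
  "(\<Sum>c\<in>#A. \<Sum>b\<in>#A - {#c#}. f c b (A - {#c#} - {#b#})) =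
   (\<Sum>c\<in>#A. \<Sum>b\<in>#A - {#c#}. f b c (A - {#c#} - {#b#}))"
proof (induction A arbitrary: f)
  case (add k A)
  have *: "(\<Sum>c\<in>#add_mset k A. \<Sum>b\<in>#add_mset k A - {#c#}. g c b (add_mset k A - {#c#} - {#b#})) =
    (\<Sum>b\<in>#A. g k b (A - {#b#})) + (\<Sum>c\<in>#A. g c k (A - {#c#})) +
    (\<Sum>c\<in>#A. \<Sum>b\<in>#A - {#c#}. g c b (add_mset k (A - {#c#} - {#b#})))" for g
    by (subst sum_mset_pick_add[of "\<lambda>c X. \<Sum>b\<in>#X. g c b (X - {#b#})"],
        subst sum_mset_pick_add) (simp add: sum_mset.distrib add.assoc)
  show ?case
    unfolding *[of f] *[of "\<lambda>c b. f b c"]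
      add.IH[of "\<lambda>c b X. f c b (add_mset k X)"] by (simp only: add_ac)
qed simp

lemma sum_mset_subtractf:
  fixes f g :: "'a \<Rightarrow> 'b::ab_group_add"
  shows "(\<Sum>c\<in>#A. f c - g c) = (\<Sum>c\<in>#A. f c) - (\<Sum>c\<in>#A. g c)"
  by (induction A) simp_all

lemma sum_mset_mset_nth: "(\<Sum>c\<in>#mset xs. f c) = (\<Sum>t<length xs. f (xs ! t))"
  by (induction xs) (simp_all add: sum.lessThan_Suc_shift del: sum.lessThan_Suc)

context
  fixes q :: "nat \<Rightarrow> 'r::comm_ring_1"
begin

private definition inv :: "nat \<Rightarrow> bool" where
  "inv n \<longleftrightarrow> (\<forall>xs. length xs = n \<longrightarrow> mono_list q xs = aug q (mset xs))"

private lemma mono_list_Cons: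
  assumes "inv (length xs)"
  shows "mono_list q (k # xs) =
    q k * aug q (mset xs) - (\<Sum>c\<in>#mset xs. aug q (add_mset (c + k) (mset xs - {#c#})))"
proof -
  have "(\<Sum>t<length xs. mono_list q (xs[t := xs ! t + k])) =
      (\<Sum>t<length xs. aug q (add_mset (xs ! t + k) (mset xs - {#xs ! t#})))"
    using assms by (intro sum.cong) (auto simp: inv_def mset_update)
  also have "\<dots> = (\<Sum>c\<in>#mset xs. aug q (add_mset (c + k) (mset xs - {#c#})))"
    by (rule sum_mset_mset_nth[symmetric])
  finally show ?thesis using assms by (simp add: inv_def)
qed

private lemma aug_add_aux:
  assumes "inv (size A)" "inv (Suc (size A))"
  shows "aug q (add_mset k A) = q k * aug q A - (\<Sum>c\<in>#A. aug q (add_mset (c + k) (A - {#c#})))"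
proof -
  obtain xs where xs: "mset xs = A" using ex_mset by blast
  have "mono_list q (k # xs) = aug q (mset (k # xs))"
    using assms(2) xs unfolding inv_def by (metis length_Cons size_mset)
  moreover have "inv (length xs)" using assms(1) xs by auto
  ultimately show ?thesis using mono_list_Cons[of xs k] by (simp only: xs mset.simps)
qed

text \<open>Strong induction on the length. Lists with the same elements but different heads are
  compared by unfolding the recursion for both heads, which gives an expression symmetric in
  them.\<close>

private lemma inv: "inv n"
proof (induction n rule: less_induct)
  case (less n)
  show ?case
  proof (cases n)
    case 0 then show ?thesis by (simp add: inv_def aug_def)
  next
    case (Suc m)
    \<comment> \<open>\<open>\<Psi> k A\<close> is the value of the recursion when \<open>k\<close>
      is the part removed first.\<close>
    define \<Psi> where "\<Psi> k A = q k * aug q A - (\<Sum>c\<in>#A. aug q (add_mset (c + k) (A - {#c#})))" for k A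
    have swap: "\<Psi> k (add_mset j C) = \<Psi> j (add_mset k C)" if C: "Suc (size C) = m" for j k C
    proof -
      have rec: "aug q (add_mset k A) = q k * aug q A - (\<Sum>c\<in>#A. aug q (add_mset (c + k) (A - {#c#})))"
        if "size A \<le> size C" for k A
        using that C Suc less.IH by (intro aug_add_aux) auto
      \<comment> \<open>Only the double sum is not visibly symmetric in \<open>j\<close> and
        \<open>k\<close>; \<open>sum_mset_pick_swap\<close> takes care of it.\<close>
      have expand: "\<Psi> k (add_mset j C) = q k * q j * aug q C - q k * (\<Sum>c\<in>#C. aug q (add_mset (c + j) (C - {#c#})))
        - aug q (add_mset (j + k) C)
        - q j * (\<Sum>c\<in>#C. aug q (add_mset (c + k) (C - {#c#})))
        + (\<Sum>c\<in>#C. aug q (add_mset (c + k + j) (C - {#c#})))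
        + (\<Sum>c\<in>#C. \<Sum>b\<in>#C - {#c#}. aug q (add_mset (c + k) (add_mset (b + j) (C - {#c#} - {#b#}))))"
        for j k
      proof -
        have 1: "(\<Sum>c\<in>#C. aug q (add_mset j (add_mset (c + k) (C - {#c#})))) =
          (\<Sum>c\<in>#C. q j * aug q (add_mset (c + k) (C - {#c#})) - (aug q (add_mset (c + k + j) (C - {#c#}))
           + (\<Sum>b\<in>#C - {#c#}. aug q (add_mset (c + k) (add_mset (b + j) (C - {#c#} - {#b#}))))))"
        proof (intro arg_cong[where f=sum_mset] image_mset_cong)
          fix c assume c: "c \<in># C"
          have "size (C - {#c#}) = size C - 1" "size C > 0"
            using c by (auto simp: size_Diff_singleton nonempty_has_size[symmetric])
          then have "size (add_mset (c + k) (C - {#c#})) \<le> size C" by simp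
          from rec[OF this, of j] show "aug q (add_mset j (add_mset (c + k) (C - {#c#}))) =
            q j * aug q (add_mset (c + k) (C - {#c#})) - (aug q (add_mset (c + k + j) (C - {#c#}))
             + (\<Sum>b\<in>#C - {#c#}. aug q (add_mset (c + k) (add_mset (b + j) (C - {#c#} - {#b#})))))"
            using sum_mset_pick_add[of "\<lambda>b X. aug q (add_mset (b + j) X)" "c + k" "C - {#c#}"]
            by (simp add: add_mset_commute)
        qed
        have 2: "q k * aug q (add_mset j C) =
            q k * q j * aug q C - q k * (\<Sum>c\<in>#C. aug q (add_mset (c + j) (C - {#c#})))"
          using rec[of C j] by (simp add: right_diff_distrib mult.assoc)
        have 3: "(\<Sum>c\<in>#C. aug q (add_mset (c + k) (add_mset j (C - {#c#})))) =
            (\<Sum>c\<in>#C. aug q (add_mset j (add_mset (c + k) (C - {#c#}))))"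
          by (simp add: add_mset_commute)
        show ?thesis
          unfolding \<Psi>_def sum_mset_pick_add[of "\<lambda>c X. aug q (add_mset (c + k) X)" j C] 2 3 1
          by (simp add: sum_mset.distrib sum_mset_distrib_left sum_mset_subtractf)
      qed
      have "(\<Sum>c\<in>#C. \<Sum>b\<in>#C - {#c#}. aug q (add_mset (c + k) (add_mset (b + j) (C - {#c#} - {#b#})))) =
          (\<Sum>c\<in>#C. \<Sum>b\<in>#C - {#c#}. aug q (add_mset (c + j) (add_mset (b + k) (C - {#c#} - {#b#}))))"
        unfolding sum_mset_pick_swap[of "\<lambda>c b X. aug q (add_mset (c + k) (add_mset (b + j) X))"]
        by (simp only: add_mset_commute)
      then show ?thesis
        unfolding expand[of k j] expand[of j k] by (simp add: algebra_simps)
    qed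
    have eq: "\<Psi> k A = \<Psi> j B" if "add_mset k A = add_mset j B" "size A = m" for k j A B
    proof (cases "k = j")
      case False
      then obtain C where C: "A = add_mset j C" "B = add_mset k C"
        using \<open>add_mset k A = add_mset j B\<close> by (auto simp: add_eq_conv_ex)
      then show ?thesis using \<open>size A = m\<close> swap[of C k j] by simp
    qed (use that in simp)
    have "mono_list q xs = mono_list q ys" if l: "length xs = n" "mset xs = mset ys" for xs ys
    proof -
      obtain k xs' j ys' where xs: "xs = k # xs'" and ys: "ys = j # ys'"
        using l Suc by (metis length_Suc_conv mset_eq_length)
      have "length xs' = m" "length ys' = m" "inv m"
        using xs ys l Suc mset_eq_length[OF l(2)] less.IH by auto
      then show ?thesis unfolding xs ys using mono_list_Cons[of xs' k] mono_list_Cons[of ys' j]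
        eq[of k "mset xs'" j "mset ys'"] l xs ys by (simp add: \<Psi>_def)
    qed
    then show ?thesis unfolding inv_def aug_def by (metis mset_sorted_list_of_multiset)
  qed
qed

lemma aug_empty [simp]: "aug q {#} = 1"
  by (simp add: aug_def)

lemma aug_add_mset:
  "aug q (add_mset k A) = q k * aug q A - (\<Sum>c\<in>#A. aug q (add_mset (c + k) (A - {#c#})))"
  by (rule aug_add_aux) (rule inv)+

end

lemma aug_mult:
  fixes q :: "nat \<Rightarrow> 'r::comm_ring_1"
  shows "q k * aug q A = aug q (add_mset k A) + (\<Sum>c\<in>#A. aug q (add_mset (c + k) (A - {#c#})))"
  by (simp add: aug_add_mset[of q k])

lemma aug_single [simp]: "aug q {#k#} = q k"
  by (simp add: aug_add_mset[of q k "{#}"])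

text \<open>\<open>aug\<close> is built from the \<open>q k\<close> by ring operations, and merging
  positive parts never produces the index 0, so agreement at positive indices suffices.\<close>

lemma aug_hom:
  fixes \<phi> :: "'r::comm_ring_1 \<Rightarrow> 's::comm_ring_1"
  assumes one: "\<phi> 1 = 1" and add: "\<And>x y. \<phi> (x + y) = \<phi> x + \<phi> y"
    and mult: "\<And>x y. \<phi> (x * y) = \<phi> x * \<phi> y"
    and q: "\<And>k. k > 0 \<Longrightarrow> \<phi> (q k) = q' k" and "0 \<notin># A"
  shows "\<phi> (aug q A) = aug q' A"
  using \<open>0 \<notin># A\<close>
proof (induction "size A" arbitrary: A)
  case 0 then show ?case using one by simp
next
  case (Suc n)
  obtain k B where A: "A = add_mset k B" using Suc.hyps(2) by (metis size_eq_Suc_imp_eq_union)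
  have zero: "\<phi> 0 = 0" using add[of 0 0] by simp
  have diff: "\<phi> (x - y) = \<phi> x - \<phi> y" for x y using add[of "x - y" y] by simp
  have sum: "\<phi> (\<Sum>c\<in>#X. g c) = (\<Sum>c\<in>#X. \<phi> (g c))" for X g
    by (induction X) (simp_all add: zero add)
  have "\<phi> (aug q B) = aug q' B" using Suc A by auto
  moreover have "(\<Sum>c\<in>#B. \<phi> (aug q (add_mset (c + k) (B - {#c#})))) =
      (\<Sum>c\<in>#B. aug q' (add_mset (c + k) (B - {#c#})))"
    using Suc A by (intro arg_cong[where f = sum_mset] image_mset_cong)
      (auto simp: size_Suc_Diff1 dest: in_diffD intro!: Suc.hyps(1))
  ultimately show ?case using Suc.prems q[of k]
    by (cases "k = 0") (auto simp: A aug_add_mset[of q k B] aug_add_mset[of q' k B] diff mult sum)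
qed

text \<open>The variables of a tuple are distinct, so the new variable \<open>x\<close> carries at
  most one exponent \<open>c\<close>.\<close>

lemma aug_add_variable:
  fixes q :: "nat \<Rightarrow> 'r::comm_ring_1"
  shows "aug (\<lambda>k. q k + x ^ k) A = aug q A + (\<Sum>c\<in>#A. x ^ c * aug q (A - {#c#}))"
proof (induction "size A" arbitrary: A)
  case 0 then show ?case by simp
next
  case (Suc n)
  obtain k B where A: "A = add_mset k B" using Suc.hyps(2) by (metis size_eq_Suc_imp_eq_union)
  have IH: "aug (\<lambda>k. q k + x ^ k) B = aug q B + (\<Sum>c\<in>#B. x ^ c * aug q (B - {#c#}))"
    using Suc A by simp
  have 1: "(\<Sum>c\<in>#B. aug (\<lambda>k. q k + x ^ k) (add_mset (c + k) (B - {#c#}))) =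
      (\<Sum>c\<in>#B. aug q (add_mset (c + k) (B - {#c#})) + (x ^ (c + k) * aug q (B - {#c#}) +
        (\<Sum>b\<in>#B - {#c#}. x ^ b * aug q (add_mset (c + k) (B - {#c#} - {#b#})))))"
  proof (intro arg_cong[where f = sum_mset] image_mset_cong)
    fix c assume "c \<in># B"
    then have "n = size (add_mset (c + k) (B - {#c#}))" using Suc.hyps(2) A by (simp add: size_Suc_Diff1)
    from Suc.hyps(1)[OF this]
    show "aug (\<lambda>k. q k + x ^ k) (add_mset (c + k) (B - {#c#})) =
        aug q (add_mset (c + k) (B - {#c#})) + (x ^ (c + k) * aug q (B - {#c#}) +
        (\<Sum>b\<in>#B - {#c#}. x ^ b * aug q (add_mset (c + k) (B - {#c#} - {#b#}))))"
      unfolding sum_mset_pick_add[of "\<lambda>b X. x ^ b * aug q X"] by simp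
  qed
  have 2: "(\<Sum>c\<in>#B. \<Sum>b\<in>#B - {#c#}. x ^ b * aug q (add_mset (c + k) (B - {#c#} - {#b#}))) =
      (\<Sum>c\<in>#B. x ^ c * (\<Sum>b\<in>#B - {#c#}. aug q (add_mset (b + k) (B - {#c#} - {#b#}))))"
    unfolding sum_mset_pick_swap[of "\<lambda>c b X. x ^ b * aug q (add_mset (c + k) X)"]
    by (simp add: sum_mset_distrib_left)
  show ?case
    unfolding A sum_mset_pick_add[of "\<lambda>b X. x ^ b * aug q X"]
      aug_add_mset[of _ k B] aug_add_mset[of q k "B - {#_#}"] 1 IH
    using 2
    by (simp add: sum_mset.distrib sum_mset_subtractf sum_mset_distrib_left algebra_simps power_add)
qed

lemma image_mset_upd:
  assumes "finite I" "t \<in> I"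
  shows "image_mset (c(t := x)) (mset_set I) = add_mset x (image_mset c (mset_set I) - {#c t#})"
proof -
  have "mset_set I = add_mset t (mset_set (I - {t}))" using assms by (simp add: mset_set.remove)
  moreover have "image_mset (c(t := x)) (mset_set (I - {t})) = image_mset c (mset_set (I - {t}))"
    using assms by (intro image_mset_cong) auto
  ultimately show ?thesis by simp
qed

text \<open>With two alphabets, each exponent goes to a variable of one of them. Labelling the
  exponents by \<open>I\<close> makes this a sum over subsets without multiplicities.\<close>

lemma aug_coproduct:
  fixes q q' :: "nat \<Rightarrow> 'r::comm_ring_1"
  assumes "finite I"
  shows "aug (\<lambda>k. q k + q' k) (image_mset c (mset_set I)) =
    (\<Sum>S\<in>Pow I. aug q (image_mset c (mset_set S)) * aug q' (image_mset c (mset_set (I - S))))"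
  using assms
proof (induction I arbitrary: c rule: finite_induct)
  case (insert j I)
  let ?a = "\<lambda>c S. aug q (image_mset c (mset_set S))" and ?b = "\<lambda>c S. aug q' (image_mset c (mset_set S))"
  \<comment> \<open>\<open>u t\<close> merges the exponent of the label \<open>j\<close> into that
    of \<open>t\<close>.\<close>
  define u where "u t = c(t := c t + c j)" for t
  have rec: "aug p (image_mset c (mset_set (insert j S))) =
      p (c j) * aug p (image_mset c (mset_set S)) - (\<Sum>t\<in>S. aug p (image_mset (u t) (mset_set S)))"
    if "S \<subseteq> I" for S and p :: "nat \<Rightarrow> 'r"
  proof -
    have S: "finite S" "j \<notin> S" using that insert.hyps finite_subset by auto
    have "(\<Sum>c'\<in>#image_mset c (mset_set S). aug p (add_mset (c' + c j) (image_mset c (mset_set S) - {#c'#})))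
        = (\<Sum>t\<in>S. aug p (image_mset (u t) (mset_set S)))"
    proof -
      have "aug p (image_mset (u t) (mset_set S)) =
          aug p (add_mset (c t + c j) (image_mset c (mset_set S) - {#c t#}))" if "t \<in> S" for t
        unfolding u_def image_mset_upd[OF S(1) that] ..
      then show ?thesis by (simp add: sum_unfold_sum_mset multiset.map_comp o_def)
    qed
    then show ?thesis using S by (simp add: aug_add_mset[of p "c j" "image_mset c (mset_set S)"])
  qed
  have same: "?a (u t) S = ?a c S" "?b (u t) S = ?b c S" if "t \<notin> S" for t S
  proof -
    have "image_mset (u t) (mset_set S) = image_mset c (mset_set S)"
      using that by (cases "finite S") (auto intro!: image_mset_cong simp: u_def)
    then show "?a (u t) S = ?a c S" "?b (u t) S = ?b c S" by simp_all
  qed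
  \<comment> \<open>A merge into \<open>t\<close> changes only the factor that contains
    \<open>t\<close>, so the merges on the two sides add up to one sum over
    \<open>I\<close>.\<close>
  have split: "(\<Sum>t\<in>S. ?a (u t) S * ?b c (I - S)) + (\<Sum>t\<in>I - S. ?a c S * ?b (u t) (I - S)) =
      (\<Sum>t\<in>I. ?a (u t) S * ?b (u t) (I - S))" if "S \<subseteq> I" for S
    unfolding sum.subset_diff[OF that insert.hyps(1)]
    by (subst add.commute, intro arg_cong2[where f = "(+)"] sum.cong) (auto simp: same)
  have "(\<Sum>S\<in>Pow (insert j I). ?a c S * ?b c (insert j I - S)) =
      (\<Sum>S\<in>Pow I. ?a c S * ?b c (insert j I - S)) +
      (\<Sum>S\<in>Pow I. ?a c (insert j S) * ?b c (insert j I - insert j S))"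
  proof -
    have "inj_on (insert j) (Pow I)" using insert.hyps by (auto simp: inj_on_def)
    moreover have "Pow I \<inter> insert j ` Pow I = {}" using insert.hyps by auto
    ultimately show ?thesis using insert.hyps
      by (simp add: Pow_insert sum.union_disjoint sum.reindex)
  qed
  also have "\<dots> = (\<Sum>S\<in>Pow I. ?a c S * ?b c (insert j (I - S)) + ?a c (insert j S) * ?b c (I - S))"
    unfolding sum.distrib[symmetric]
  proof (intro sum.cong arg_cong2[where f = "(+)"])
    fix S assume "S \<in> Pow I"
    then have "insert j I - S = insert j (I - S)" "insert j I - insert j S = I - S"
      using insert.hyps by auto
    then show "?a c S * ?b c (insert j I - S) = ?a c S * ?b c (insert j (I - S))"
      "?a c (insert j S) * ?b c (insert j I - insert j S) = ?a c (insert j S) * ?b c (I - S)" by simp_all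
  qed auto
  also have "\<dots> = (\<Sum>S\<in>Pow I. (q (c j) + q' (c j)) * (?a c S * ?b c (I - S)) -
      (\<Sum>t\<in>I. ?a (u t) S * ?b (u t) (I - S)))"
  proof (intro sum.cong)
    fix S assume "S \<in> Pow I"
    then have S: "S \<subseteq> I" by simp
    show "?a c S * ?b c (insert j (I - S)) + ?a c (insert j S) * ?b c (I - S) =
      (q (c j) + q' (c j)) * (?a c S * ?b c (I - S)) - (\<Sum>t\<in>I. ?a (u t) S * ?b (u t) (I - S))"
      unfolding rec[OF S] rec[of "I - S", OF Diff_subset] split[OF S, symmetric]
      by (simp add: algebra_simps sum_distrib_left)
  qed simp
  also have "\<dots> = (q (c j) + q' (c j)) * aug (\<lambda>k. q k + q' k) (image_mset c (mset_set I)) -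
      (\<Sum>t\<in>I. aug (\<lambda>k. q k + q' k) (image_mset (u t) (mset_set I)))"
    unfolding insert.IH sum_subtractf sum_distrib_left by (subst sum.swap) simp
  also have "\<dots> = aug (\<lambda>k. q k + q' k) (image_mset c (mset_set (insert j I)))"
    using rec[of I "\<lambda>k. q k + q' k"] by simp
  finally show ?case ..
qed simp

lemma aug_add_nonneg:
  fixes v w :: "nat \<Rightarrow> real"
  assumes v: "\<And>A. 0 \<notin># A \<Longrightarrow> aug v A \<ge> 0" and w: "\<And>A. 0 \<notin># A \<Longrightarrow> aug w A \<ge> 0" and "0 \<notin># A"
  shows "aug (\<lambda>k. v k + w k) A \<ge> 0"
proof -
  obtain xs where A: "A = mset xs" using ex_mset by metis
  have im: "A = image_mset ((!) xs) (mset_set {..<length xs})"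
    unfolding A by (metis atLeast0LessThan map_nth mset_map mset_upt)
  have pos: "0 \<notin># image_mset ((!) xs) (mset_set S)" if "S \<subseteq> {..<length xs}" for S
    using that \<open>0 \<notin># A\<close> finite_subset[OF that] by (auto simp: A in_set_conv_nth)
  show ?thesis
    unfolding im by (subst aug_coproduct) (auto intro!: sum_nonneg mult_nonneg_nonneg v w pos)
qed

lemma aug_mult_nat_nonneg:
  fixes v :: "nat \<Rightarrow> real"
  assumes "\<And>A. 0 \<notin># A \<Longrightarrow> aug v A \<ge> 0" "0 \<notin># A"
  shows "aug (\<lambda>k. real (Suc n) * v k) A \<ge> 0"
  using assms(2)
proof (induction n arbitrary: A)
  case 0 then show ?case using assms by simp
next
  case (Suc n)
  have "aug (\<lambda>k. v k + real (Suc n) * v k) A \<ge> 0"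
    by (rule aug_add_nonneg[OF assms(1) Suc.IH Suc.prems])
  then show ?case by (simp add: distrib_right)
qed

section \<open>The dominance order on multisets\<close>

text \<open>\<open>excess x\<close> counts the boxes in the columns beyond the \<open>x\<close>-th, so this is the reverse
  dominance of the conjugate partitions.\<close>

definition excess :: "nat \<Rightarrow> nat multiset \<Rightarrow> nat" where
  "excess x A = (\<Sum>c\<in>#A. c - x)"

definition dle :: "nat multiset \<Rightarrow> nat multiset \<Rightarrow> bool" where
  "dle A B \<longleftrightarrow> 0 \<notin># A \<and> 0 \<notin># B \<and> sum_mset A = sum_mset B \<and> (\<forall>x. excess x A \<le> excess x B)"

lemma excess_empty [simp]: "excess x {#} = 0"
  and excess_add [simp]: "excess x (add_mset c A) = (c - x) + excess x A"
  by (simp_all add: excess_def)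

lemma excess_Suc: "excess x A = excess (Suc x) A + size {#c \<in># A. x < c#}"
  by (induction A) auto

text \<open>The multiplicities of the parts are the second differences of the excess.\<close>

lemma excess_antisym:
  assumes "0 \<notin># A" "0 \<notin># B" "\<And>x. excess x A = excess x B"
  shows "A = B"
proof (rule multiset_eqI)
  fix c
  have s: "size {#c \<in># A. x < c#} = size {#c \<in># B. x < c#}" for x
    using assms(3)[of x] assms(3)[of "Suc x"] by (simp add: excess_Suc[of x])
  have cnt: "size {#c \<in># X. x < c#} = size {#c \<in># X. Suc x < c#} + count X (Suc x)" for x and X :: "nat multiset"
    by (induction X) auto
  show "count A c = count B c"
  proof (cases c)
    case 0 then show ?thesis using assms(1,2) by (simp add: not_in_iff)
  next
    case (Suc x) then show ?thesis using s[of x] s[of c] cnt[where X = A and x = x] cnt[where X = B and x = x] by simp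
  qed
qed

lemma dle_refl: "0 \<notin># A \<Longrightarrow> dle A A"
  and dle_trans: "dle A B \<Longrightarrow> dle B C \<Longrightarrow> dle A C"
  and dle_antisym: "dle A B \<Longrightarrow> dle B A \<Longrightarrow> A = B"
  unfolding dle_def by (auto intro: le_trans intro!: excess_antisym[of A B] le_antisym)

text \<open>Truncated subtraction of \<open>x\<close> is convex, so moving two parts towards each
  other at fixed sum cannot raise an excess.\<close>

lemma dle_squeeze:
  assumes "0 \<notin># C" "0 < i" "0 < j" "i + j = a + b" "b \<le> i" "i \<le> a" "0 < b"
  shows "dle (add_mset i (add_mset j C)) (add_mset a (add_mset b C))"
  using assms by (auto simp: dle_def)

text \<open>Truncated subtraction of \<open>x\<close> is superadditive, so cutting a part cannot
  raise an excess.\<close>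

lemma dle_split:
  assumes "0 \<notin># C" "0 < i" "0 < j" "i + j = a"
  shows "dle (add_mset i (add_mset j C)) (add_mset a C)"
  using assms by (auto simp: dle_def)

lemma excess_eq_0: "excess x A = 0" if "sum_mset A \<le> x"
  using that by (induction A) auto

text \<open>Each part \<open>c\<close> contributes a triangular number. Through this identity the
  sum of squares becomes a strictly monotone rank for the inductions along dominance.\<close>

lemma sum_excess: "2 * (\<Sum>x<N. excess x A) = (\<Sum>c\<in>#A. c\<^sup>2) + sum_mset A" if "sum_mset A \<le> N"
proof -
  have 1: "2 * (\<Sum>x<N. c - x) = c\<^sup>2 + c" if "c \<le> N" for c :: nat
    using that
  proof (induction c)
    case (Suc c)
    have "(\<Sum>x<N. Suc c - x) = (\<Sum>x<N. c - x) + (\<Sum>x<N. if x < Suc c then 1 else 0)"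
      unfolding sum.distrib[symmetric] by (intro sum.cong) auto
    also have "(\<Sum>x<N. if x < Suc c then 1 else (0::nat)) = card ({..<N} \<inter> {x. x < Suc c})"
      by (simp add: sum.If_cases)
    also have "{..<N} \<inter> {x. x < Suc c} = {..<Suc c}" using Suc.prems by auto
    finally show ?case using Suc by (simp add: power2_eq_square)
  qed simp
  show ?thesis using that
  proof (induction A)
    case (add c A)
    then show ?case using 1[of c] by (simp add: sum.distrib)
  qed simp
qed

lemma sum_squares_less:
  assumes "dle A B" "A \<noteq> B"
  shows "(\<Sum>c\<in>#A. c\<^sup>2) < (\<Sum>c\<in>#B. c\<^sup>2)"
proof -
  obtain x where x: "excess x A < excess x B"
    using assms excess_antisym unfolding dle_def by (metis nat_less_le)
  define N where "N = Suc (x + sum_mset A + sum_mset B)"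
  have "(\<Sum>x<N. excess x A) < (\<Sum>x<N. excess x B)"
    using assms x by (intro sum_strict_mono_ex1) (auto simp: dle_def N_def)
  moreover have "2 * (\<Sum>x<N. excess x A) = (\<Sum>c\<in>#A. c\<^sup>2) + sum_mset A"
    "2 * (\<Sum>x<N. excess x B) = (\<Sum>c\<in>#B. c\<^sup>2) + sum_mset B" by (intro sum_excess; simp add: N_def)+
  moreover have "sum_mset A = sum_mset B" using assms by (simp add: dle_def)
  ultimately show ?thesis by linarith
qed

text \<open>The double sum is the sum of the squared column lengths. For fixed \<open>y\<close>, the
  sum of \<open>min y t\<close> is the total minus the excess beyond \<open>y\<close>, so
  \<open>B\<close> can be replaced by \<open>A\<close> in one argument at a time.\<close>

lemma sum_min_antimono:
  assumes "dle A B"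
  shows "(\<Sum>s\<in>#B. \<Sum>t\<in>#B. min s t) \<le> (\<Sum>s\<in>#A. \<Sum>t\<in>#A. min s t)"
proof -
  have min: "(\<Sum>t\<in>#X. min y t) + excess y X = sum_mset X" for y X
    by (induction X) auto
  have le: "(\<Sum>t\<in>#B. min y t) \<le> (\<Sum>t\<in>#A. min y t)" for y
    using min[of y A] min[of y B] assms unfolding dle_def by (metis add_le_cancel_right add_le_mono1 le_add_diff_inverse2 nat_add_left_cancel_le trans_le_add1)
  have mono: "(\<Sum>s\<in>#X. f s) \<le> (\<Sum>s\<in>#X. g s)" if "\<And>s. f s \<le> g s" for X and f g :: "nat \<Rightarrow> nat"
    by (rule sum_mset_mono) (rule that)
  have "(\<Sum>s\<in>#B. \<Sum>t\<in>#B. min s t) \<le> (\<Sum>s\<in>#B. \<Sum>t\<in>#A. min s t)" by (intro mono le)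
  also have "\<dots> = (\<Sum>t\<in>#A. \<Sum>s\<in>#B. min t s)"
    by (subst sum_mset.swap) (simp add: min.commute)
  also have "\<dots> \<le> (\<Sum>s\<in>#A. \<Sum>t\<in>#A. min s t)" by (intro mono le)
  finally show ?thesis .
qed

lemma finite_dle: "finite {A. dle A B}"
proof -
  let ?n = "sum_mset B"
  have "{A. dle A B} \<subseteq> mset ` {xs. set xs \<subseteq> {..?n} \<and> length xs \<le> ?n}"
  proof
    fix A assume "A \<in> {A. dle A B}"
    then have A: "0 \<notin># A" "sum_mset A = ?n" by (auto simp: dle_def)
    obtain xs where xs: "mset xs = A" using ex_mset by blast
    have s: "sum_list xs = ?n" using A xs by (metis sum_mset_sum_list)
    have "0 \<notin> set xs" using A xs by auto
    then have "length xs \<le> sum_list xs" by (induction xs) auto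
    moreover have "set xs \<subseteq> {..?n}" using member_le_sum_list[of _ xs] s by auto
    ultimately show "A \<in> mset ` {xs. set xs \<subseteq> {..?n} \<and> length xs \<le> ?n}"
      using xs s by (intro image_eqI[of _ _ xs]) auto
  qed
  then show ?thesis by (rule finite_subset) (intro finite_imageI finite_lists_length_le, simp)
qed

section \<open>A Lax operator whose moments are self-adjoint\<close>

text \<open>
  The basis element \<open>(a, \<kappa>)\<close> stands for \<open>w\<^sup>a\<^sup>+\<^sup>1 p\<^sub>\<kappa>\<close>, where \<open>w\<close> is a distinguished variable
  among those of the power sums. On \<open>w\<^sup>a\<^sup>+\<^sup>1\<close> times a symmetric function, \<open>lax\<close> is the
  Dunkl-type operator attached to the variable \<open>w\<close>, with the dependence on the number of
  variables dropped.
\<close>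

type_synonym wsym = "nat \<times> partition \<Rightarrow>\<^sub>0 real"

text \<open>As a vector the index \<open>a\<close> means w^(a+1); as a factor in the ring
  \<open>wsym\<close>, \<open>wpow a\<close> therefore multiplies by w^a.\<close>

definition wpow :: "nat \<Rightarrow> wsym" where
  "wpow a = Poly_Mapping.single (a, 0) 1"

definition wpsum :: "nat \<Rightarrow> wsym" where
  "wpsum k = Poly_Mapping.single (0, single_part k) 1"

text \<open>\<open>wpsum k - wpow k\<close> is the power sum of the variables other than
  \<open>w\<close>, so this is w^(a+1) times an augmented monomial in those.\<close>

definition waug :: "nat \<Rightarrow> nat multiset \<Rightarrow> wsym" where
  "waug a A = wpow a * aug (\<lambda>k. wpsum k - wpow k) A"

text \<open>In N variables this is \<alpha> w d/dw plus the sum, over the variables y other than w,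
  of w (1 - s) / (w - y) with s swapping w and y, minus N; subtracting N makes the result
  independent of N. Up to normalisation it is the Nazarov-Sklyanin Lax matrix without its row and
  column 0, which reappear as \<open>wclose\<close> and \<open>wopen\<close>.\<close>

definition lax_basis :: "real \<Rightarrow> nat \<times> partition \<Rightarrow> wsym" where
  "lax_basis \<alpha> = (\<lambda>(a, \<kappa>).
     (\<Sum>k\<in>#parts \<kappa>. Poly_Mapping.single (a + k, \<kappa> - single_part k) (\<alpha> * real k)) +
     Poly_Mapping.single (a, \<kappa>) ((\<alpha> - 1) * real (a + 1)) +
     (\<Sum>b\<in>{1..a}. Poly_Mapping.single (a - b, \<kappa> + single_part b) 1))"

definition lax :: "real \<Rightarrow> wsym \<Rightarrow> wsym" where
  "lax \<alpha> = lin (lax_basis \<alpha>)"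

text \<open>Summation over all choices of the distinguished variable, which turns w^(a+1) into
  p_(a+1).\<close>

definition wclose :: "wsym \<Rightarrow> sym" where
  "wclose = lin (\<lambda>(a, \<kappa>). Poly_Mapping.single (\<kappa> + single_part (a + 1)) 1)"

text \<open>This is \<alpha> w d/dw, since w d/dw sends p_k to k w^k; the index \<open>k - 1\<close>
  stands for w^k.\<close>

definition wopen_basis :: "real \<Rightarrow> partition \<Rightarrow> wsym" where
  "wopen_basis \<alpha> \<kappa> = (\<Sum>k\<in>#parts \<kappa>. Poly_Mapping.single (k - 1, \<kappa> - single_part k) (\<alpha> * real k))"

definition wopen :: "real \<Rightarrow> sym \<Rightarrow> wsym" where
  "wopen \<alpha> = lin (wopen_basis \<alpha>)"

definition ham :: "real \<Rightarrow> nat \<Rightarrow> sym \<Rightarrow> sym" where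
  "ham \<alpha> l F = wclose ((lax \<alpha> ^^ l) (wopen \<alpha> F))"

definition jweight :: "real \<Rightarrow> partition \<Rightarrow> real" where
  "jweight \<alpha> \<kappa> = \<alpha> ^ plen \<kappa> * real (zee \<kappa>)"

lemma jack_inner_form: "jack_inner \<alpha> = form (jweight \<alpha>)"
  by (intro ext) (simp add: jack_inner_def form_def lin_def jweight_def mult_ac)

lemma zero_notin_parts [simp]: "0 \<notin># parts \<kappa>"
  using parts[of \<kappa>] by simp

lemma parts_zero [simp]: "parts 0 = {#}"
  by (simp add: zero_partition.rep_eq)

lemma parts_add [simp]: "parts (\<kappa> + \<mu>) = parts \<kappa> + parts \<mu>"
  by (simp add: plus_partition.rep_eq)

lemma parts_diff [simp]: "parts (\<kappa> - \<mu>) = parts \<kappa> - parts \<mu>"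
  by (simp add: minus_partition.rep_eq)

lemma parts_single [simp]: "k > 0 \<Longrightarrow> parts (single_part k) = {#k#}"
  by (simp add: single_part.rep_eq)

lemma parts_pos: "k \<in># parts \<kappa> \<Longrightarrow> k > 0"
  by (metis zero_notin_parts not_gr0)

lemma jweight_pos: "\<alpha> > 0 \<Longrightarrow> jweight \<alpha> \<kappa> > 0"
  by (auto simp: jweight_def zee_def intro!: mult_pos_pos prod_pos dest: parts_pos)

text \<open>This ratio is what makes multiplication by p_k adjoint to \<alpha> k times the
  derivative in p_k.\<close>

lemma jweight_add:
  assumes "k > 0"
  shows "jweight \<alpha> (\<kappa> + single_part k) = jweight \<alpha> \<kappa> * (\<alpha> * real k * real (Suc (count (parts \<kappa>) k)))"
proof -
  let ?f = "\<lambda>A i. i ^ count A i * fact (count A i) :: nat"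
  let ?A = "parts \<kappa>" and ?S = "set_mset (parts \<kappa>) \<union> {k}"
  have ext: "(\<Prod>i\<in>set_mset A. ?f A i) = (\<Prod>i\<in>T. ?f A i)" if "set_mset A \<subseteq> T" "finite T" for A T
    using that by (intro prod.mono_neutral_left) (auto simp: not_in_iff)
  have "zee (\<kappa> + single_part k) = (\<Prod>i\<in>?S. ?f (add_mset k ?A) i)"
    unfolding zee_def using assms by (subst ext[where T = ?S]) auto
  also have "\<dots> = ?f (add_mset k ?A) k * (\<Prod>i\<in>?S - {k}. ?f (add_mset k ?A) i)"
    by (intro prod.remove) auto
  also have "(\<Prod>i\<in>?S - {k}. ?f (add_mset k ?A) i) = (\<Prod>i\<in>?S - {k}. ?f ?A i)"
    by (intro prod.cong) auto
  also have "?f (add_mset k ?A) k * \<dots> = k * Suc (count ?A k) * (?f ?A k * (\<Prod>i\<in>?S - {k}. ?f ?A i))"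
    by (simp add: algebra_simps)
  also have "?f ?A k * (\<Prod>i\<in>?S - {k}. ?f ?A i) = (\<Prod>i\<in>?S. ?f ?A i)"
    by (intro prod.remove[symmetric]) auto
  also have "\<dots> = zee \<kappa>" unfolding zee_def by (intro ext[symmetric]) auto
  finally show ?thesis using assms by (simp add: jweight_def plen_def algebra_simps)
qed

lemma lookup_sum_mset: "Poly_Mapping.lookup (\<Sum>x\<in>#A. f x) i = (\<Sum>x\<in>#A. Poly_Mapping.lookup (f x) i)"
  by (induction A) (simp_all add: lookup_add)

lemma sum_mset_delta: "(\<Sum>k\<in>#A. if k = x \<and> P then f k else 0) = (if P then real (count A x) * f x else (0::real))"
  by (induction A) (auto simp: algebra_simps)

lemma partition_diff_eq:
  assumes "k \<in># parts \<kappa>" shows "\<kappa> - single_part k = \<mu> \<longleftrightarrow> \<kappa> = \<mu> + single_part k"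
proof -
  have "k > 0" using assms by (rule parts_pos)
  then show ?thesis using insert_DiffM[OF assms] by (auto simp: parts_inject[symmetric])
qed

lemma lookup_raising:
  "Poly_Mapping.lookup (\<Sum>k\<in>#parts \<kappa>. Poly_Mapping.single (a + k, \<kappa> - single_part k) (f k)) (b, \<mu>) =
   (if a < b \<and> \<kappa> = \<mu> + single_part (b - a) then real (count (parts \<kappa>) (b - a)) * f (b - a) else 0)"
proof -
  have "image_mset (\<lambda>k. Poly_Mapping.lookup (Poly_Mapping.single (a + k, \<kappa> - single_part k) (f k)) (b, \<mu>)) (parts \<kappa>)
     = image_mset (\<lambda>k. if k = b - a \<and> (a < b \<and> \<kappa> = \<mu> + single_part (b - a)) then f k else 0) (parts \<kappa>)"
  proof (rule image_mset_cong)
    fix k assume k: "k \<in># parts \<kappa>"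
    then have "k > 0" by (rule parts_pos)
    then show "Poly_Mapping.lookup (Poly_Mapping.single (a + k, \<kappa> - single_part k) (f k)) (b, \<mu>) =
        (if k = b - a \<and> (a < b \<and> \<kappa> = \<mu> + single_part (b - a)) then f k else 0)"
      using partition_diff_eq[OF k] by (auto simp: lookup_single when_def)
  qed
  then show ?thesis by (simp only: lookup_sum_mset sum_mset_delta)
qed

lemma lookup_lowering:
  "Poly_Mapping.lookup (\<Sum>b\<in>{1..a}. Poly_Mapping.single (a - b, \<kappa> + single_part b) (1::real)) (c, \<mu>) =
   (if c < a \<and> \<mu> = \<kappa> + single_part (a - c) then 1 else 0)"
proof -
  have "Poly_Mapping.lookup (\<Sum>b\<in>{1..a}. Poly_Mapping.single (a - b, \<kappa> + single_part b) (1::real)) (c, \<mu>) =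
      (\<Sum>b\<in>{1..a}. if b = a - c then if c < a \<and> \<mu> = \<kappa> + single_part (a - c) then 1 else 0 else 0)"
    unfolding lookup_sum
  proof (intro sum.cong)
    fix b assume b: "b \<in> {1..a}"
    then have "a - b = c \<longleftrightarrow> b = a - c \<and> c < a" by auto
    moreover have "\<kappa> + single_part b = \<mu> \<longleftrightarrow> \<mu> = \<kappa> + single_part b" by (rule eq_commute)
    ultimately have "(a - b, \<kappa> + single_part b) = (c, \<mu>) \<longleftrightarrow>
        b = a - c \<and> c < a \<and> \<mu> = \<kappa> + single_part (a - c)" by (metis prod.inject)
    then show "Poly_Mapping.lookup (Poly_Mapping.single (a - b, \<kappa> + single_part b) 1) (c, \<mu>) =
        (if b = a - c then if c < a \<and> \<mu> = \<kappa> + single_part (a - c) then 1 else 0 else (0::real))"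
      unfolding lookup_single when_def by presburger
  qed simp
  also have "\<dots> = (if c < a \<and> \<mu> = \<kappa> + single_part (a - c) then 1 else 0)"
    by (subst sum.delta) auto
  finally show ?thesis .
qed

text \<open>The parts raising and lowering the power of \<open>w\<close> are transposes of each
  other for a weight that ignores this power; the diagonal part is its own transpose.\<close>

lemma lax_adjoint: "form (\<lambda>(a, \<kappa>). jweight \<alpha> \<kappa>) (lax \<alpha> F) G = form (\<lambda>(a, \<kappa>). jweight \<alpha> \<kappa>) F (lax \<alpha> G)"
  unfolding lax_def
proof (rule form_lin_adjoint)
  have aux: "jweight \<alpha> \<mu> * (if a < b \<and> \<kappa> = \<mu> + single_part (b - a)
      then real (count (parts \<kappa>) (b - a)) * (\<alpha> * real (b - a)) else 0) =
    jweight \<alpha> \<kappa> * (if a < b \<and> \<kappa> = \<mu> + single_part (b - a) then 1 else 0)" for a b \<kappa> \<mu>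
    by (auto simp: jweight_add)
  fix x y :: "nat \<times> partition"
  obtain a \<kappa> b \<mu> where xy: "x = (a, \<kappa>)" "y = (b, \<mu>)" by force
  show "(case y of (a, x) \<Rightarrow> jweight \<alpha> x) * Poly_Mapping.lookup (lax_basis \<alpha> x) y =
      (case x of (a, x) \<Rightarrow> jweight \<alpha> x) * Poly_Mapping.lookup (lax_basis \<alpha> y) x"
    unfolding xy lax_basis_def prod.case lookup_add lookup_raising lookup_lowering distrib_left
      aux[of \<mu> a b \<kappa>] aux[of \<kappa> b a \<mu>]
    by (auto simp: lookup_single when_def)
qed

lemma wclose_adjoint: "form (jweight \<alpha>) (wclose F) G = form (\<lambda>(a, \<kappa>). jweight \<alpha> \<kappa>) F (wopen \<alpha> G)"
  unfolding wclose_def wopen_def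
proof (rule form_lin_adjoint)
  fix x :: "nat \<times> partition" and \<mu> :: partition
  obtain a \<kappa> where x: "x = (a, \<kappa>)" by force
  have "image_mset (\<lambda>k. Poly_Mapping.lookup (Poly_Mapping.single (k - 1, \<mu> - single_part k) (\<alpha> * real k)) (a, \<kappa>)) (parts \<mu>)
     = image_mset (\<lambda>k. if k = Suc a \<and> \<mu> = \<kappa> + single_part (Suc a) then \<alpha> * real k else 0) (parts \<mu>)"
  proof (rule image_mset_cong)
    fix k assume k: "k \<in># parts \<mu>"
    then have "k > 0" by (rule parts_pos)
    then show "Poly_Mapping.lookup (Poly_Mapping.single (k - 1, \<mu> - single_part k) (\<alpha> * real k)) (a, \<kappa>) =
        (if k = Suc a \<and> \<mu> = \<kappa> + single_part (Suc a) then \<alpha> * real k else 0)"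
      using partition_diff_eq[OF k] by (auto simp: lookup_single when_def)
  qed
  then have "Poly_Mapping.lookup (wopen_basis \<alpha> \<mu>) (a, \<kappa>) =
      (if \<mu> = \<kappa> + single_part (Suc a) then real (count (parts \<mu>) (Suc a)) * (\<alpha> * real (Suc a)) else 0)"
    unfolding wopen_basis_def by (simp only: lookup_sum_mset sum_mset_delta)
  then show "jweight \<alpha> \<mu> * Poly_Mapping.lookup (case x of (a, \<kappa>) \<Rightarrow> Poly_Mapping.single (\<kappa> + single_part (a + 1)) 1) \<mu> =
      (case x of (a, \<kappa>) \<Rightarrow> jweight \<alpha> \<kappa>) * Poly_Mapping.lookup (wopen_basis \<alpha> \<mu>) x"
    by (auto simp: x lookup_single when_def jweight_add)
qed

lemma linear_lax: "linear (lax \<alpha>)" and linear_wclose: "linear wclose" and linear_wopen: "linear (wopen \<alpha>)"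
  by (simp_all add: lax_def wclose_def wopen_def)

lemma linear_funpow: "linear f \<Longrightarrow> linear (f ^^ n)" for f :: "'a::real_vector \<Rightarrow> 'a"
  by (induction n) (auto simp: linear_id[unfolded id_def] id_def intro: linear_compose)

lemma linear_ham: "linear (ham \<alpha> l)"
proof -
  have "linear (wclose \<circ> ((lax \<alpha> ^^ l) \<circ> wopen \<alpha>))"
    by (intro linear_compose linear_wclose linear_wopen linear_funpow linear_lax)
  moreover have "wclose \<circ> ((lax \<alpha> ^^ l) \<circ> wopen \<alpha>) = ham \<alpha> l" by (auto simp: ham_def)
  ultimately show ?thesis by simp
qed

lemma ham_adjoint: "jack_inner \<alpha> (ham \<alpha> l F) G = jack_inner \<alpha> F (ham \<alpha> l G)"
proof -
  have pow: "form (\<lambda>(a, \<kappa>). jweight \<alpha> \<kappa>) ((lax \<alpha> ^^ l) X) Y = form (\<lambda>(a, \<kappa>). jweight \<alpha> \<kappa>) X ((lax \<alpha> ^^ l) Y)" for X Y l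
    by (induction l arbitrary: Y) (simp, simp add: lax_adjoint, simp add: funpow_swap1)
  have "jack_inner \<alpha> (ham \<alpha> l F) G =
      form (\<lambda>(a, \<kappa>). jweight \<alpha> \<kappa>) (wopen \<alpha> F) ((lax \<alpha> ^^ l) (wopen \<alpha> G))"
    by (simp add: jack_inner_form ham_def wclose_adjoint pow)
  also have "\<dots> = form (jweight \<alpha>) F (wclose ((lax \<alpha> ^^ l) (wopen \<alpha> G)))"
    by (metis wclose_adjoint form_commute)
  finally show ?thesis by (simp add: jack_inner_form ham_def)
qed

lemma linear_sum_mset: "linear f \<Longrightarrow> f (\<Sum>x\<in>#A. g x) = (\<Sum>x\<in>#A. f (g x))"
  by (induction A) (simp_all add: linear_0 linear_add)

lemma scaleR_sum_mset: "r *\<^sub>R (\<Sum>x\<in>#A. g x) = (\<Sum>x\<in>#A. r *\<^sub>R g x)" for g :: "'a \<Rightarrow> 'b::real_vector"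
  by (rule linear_sum_mset) (rule linear_scale_self)

lemma linear_mult_poly: "linear ((*) F)" for F :: "'a::comm_monoid_add \<Rightarrow>\<^sub>0 real"
  by standard (simp_all add: distrib_left mult_scaleR_poly)

lemma linear_compose_fun: "linear f \<Longrightarrow> linear g \<Longrightarrow> linear (\<lambda>x. f (g x))"
  using linear_compose[of g f] by (simp add: o_def)

section \<open>The Lax operator on monomials\<close>

lemma single_diff_add:
  "j \<in># parts \<kappa> \<Longrightarrow> \<kappa> + \<mu> - single_part j = \<kappa> - single_part j + \<mu>"
  using parts_pos[of j \<kappa>] by (simp add: parts_inject[symmetric])

lemma wpow_add: "wpow (a + b) = wpow a * wpow b"
  by (simp add: wpow_def mult_single)

lemma wpow_0: "wpow 0 = 1"
  by (simp add: wpow_def zero_prod_def[symmetric] single_one)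

lemma wpow_power: "wpow 1 ^ k = wpow k"
proof (induction k)
  case (Suc k)
  then show ?case using wpow_add[of 1 k] by simp
qed (simp add: wpow_0)

text \<open>Only the part that replaces p_k by \<alpha> k w^k fails to commute with multiplication
  by p_k, and it is a derivation.\<close>

lemma lax_wpsum:
  assumes "k > 0"
  shows "lax \<alpha> (wpsum k * G) = wpsum k * lax \<alpha> G + (\<alpha> * real k) *\<^sub>R (wpow k * G)"
proof (rule linear_ext_single[of "\<lambda>G. lax \<alpha> (wpsum k * G)" "\<lambda>G. wpsum k * lax \<alpha> G + (\<alpha> * real k) *\<^sub>R (wpow k * G)"])
  show "linear (\<lambda>G. lax \<alpha> (wpsum k * G))"
    by (intro linear_compose_fun[OF linear_lax] linear_mult_poly)
  show "linear (\<lambda>G. wpsum k * lax \<alpha> G + (\<alpha> * real k) *\<^sub>R (wpow k * G))"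
    by (intro linear_compose_add linear_compose_fun[OF linear_mult_poly] linear_lax
        linear_compose_scale_right linear_mult_poly)
  fix x :: "nat \<times> partition"
  obtain a \<kappa> where x: "x = (a, \<kappa>)" by force
  have "image_mset (\<lambda>j. Poly_Mapping.single (a + j, \<kappa> + single_part k - single_part j) (\<alpha> * real j)) (parts \<kappa>) =
      image_mset (\<lambda>j. wpsum k * Poly_Mapping.single (a + j, \<kappa> - single_part j) (\<alpha> * real j)) (parts \<kappa>)"
    by (rule image_mset_cong) (simp add: single_diff_add wpsum_def mult_single add.commute)
  moreover have "\<kappa> + single_part k - single_part k = \<kappa>" by simp
  ultimately show "lax \<alpha> (wpsum k * Poly_Mapping.single x 1) =
      wpsum k * lax \<alpha> (Poly_Mapping.single x 1) + (\<alpha> * real k) *\<^sub>R (wpow k * Poly_Mapping.single x 1)"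
    using assms
    by (simp add: x lax_def lax_basis_def distrib_left sum_mset_distrib_left sum_distrib_left wpsum_def wpow_def
        mult_single scaleR_single add_ac)
qed

lemma lax_wpow:
  "lax \<alpha> (wpow a) = ((\<alpha> - 1) * real (a + 1)) *\<^sub>R wpow a + (\<Sum>b\<in>{1..a}. wpsum b * wpow (a - b))"
  by (simp add: wpow_def lax_def lax_basis_def wpsum_def mult_single scaleR_single)

lemma wpow_waug: "wpow k * waug a A = waug (a + k) A"
  by (simp add: waug_def wpow_add mult_ac)

lemma waug_empty: "waug a {#} = wpow a"
  by (simp add: waug_def)

text \<open>A factor p_k hits \<open>w\<close>, a new variable, or a variable that already carries a
  part of \<open>A\<close>.\<close>

lemma wpsum_waug:
  "wpsum k * waug a A = waug (a + k) A + waug a (add_mset k A) + (\<Sum>c\<in>#A. waug a (add_mset (c + k) (A - {#c#})))"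
proof -
  let ?q = "\<lambda>k. wpsum k - wpow k"
  have "wpsum k * waug a A = wpow k * waug a A + wpow a * (?q k * aug ?q A)"
    by (simp add: waug_def algebra_simps)
  also have "?q k * aug ?q A = aug ?q (add_mset k A) + (\<Sum>c\<in>#A. aug ?q (add_mset (c + k) (A - {#c#})))"
    by (rule aug_mult)
  finally show ?thesis
    unfolding wpow_waug by (simp add: waug_def distrib_left sum_mset_distrib_left add.assoc)
qed

definition wsplit :: "nat \<Rightarrow> nat multiset \<Rightarrow> wsym" where
  "wsplit a A = (\<Sum>i\<in>{1..a}. waug (a - i) (add_mset i A))"

text \<open>The divided difference w (w^(a+1) y^c - w^c y^(a+1)) / (w - y) for a variable y carrying
  the part \<open>c\<close>. The difference of two sums covers both signs of a + 1 - c at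
  once.\<close>

definition wexch :: "nat \<Rightarrow> nat \<Rightarrow> nat multiset \<Rightarrow> wsym" where
  "wexch a c A = (\<Sum>i\<in>{1..a}. waug (a + c - i) (add_mset i A)) - (\<Sum>i\<in>{1..<c}. waug (a + c - i) (add_mset i A))"

lemma sum_shift_upto:
  fixes h :: "nat \<Rightarrow> 'a::ab_group_add"
  shows "(\<Sum>i\<in>{1..a}. h (i + k)) = (\<Sum>i\<in>{1..a + k}. h i) - (\<Sum>i\<in>{1..k}. h i)"
  by (induction a) (simp_all add: algebra_simps)

lemma wpsum_sum_waug:
  assumes "a \<le> b"
  shows "wpsum k * (\<Sum>i\<in>{1..a}. waug (b - i) (add_mset i A)) =
    (\<Sum>i\<in>{1..a}. waug (b + k - i) (add_mset i A)) +
    (\<Sum>i\<in>{1..a}. waug (b - i) (add_mset i (add_mset k A))) +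
    ((\<Sum>i\<in>{1..a + k}. waug (b + k - i) (add_mset i A)) - (\<Sum>i\<in>{1..k}. waug (b + k - i) (add_mset i A))) +
    (\<Sum>c\<in>#A. \<Sum>i\<in>{1..a}. waug (b - i) (add_mset i (add_mset (c + k) (A - {#c#}))))"
proof -
  have sw: "(\<Sum>i\<in>I. \<Sum>c\<in>#A. f i c) = (\<Sum>c\<in>#A. \<Sum>i\<in>I. f i c)" for I and f :: "nat \<Rightarrow> nat \<Rightarrow> wsym"
    by (induction A) (simp_all add: sum.distrib)
  have "wpsum k * (\<Sum>i\<in>{1..a}. waug (b - i) (add_mset i A)) =
    (\<Sum>i\<in>{1..a}. waug (b + k - i) (add_mset i A) + waug (b - i) (add_mset i (add_mset k A)) +
      waug (b + k - (i + k)) (add_mset (i + k) A) +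
      (\<Sum>c\<in>#A. waug (b - i) (add_mset i (add_mset (c + k) (A - {#c#})))))"
    unfolding sum_distrib_left
  proof (intro sum.cong)
    fix i assume "i \<in> {1..a}"
    then have "b - i + k = b + k - i" "b + k - (i + k) = b - i" using assms by auto
    then show "wpsum k * waug (b - i) (add_mset i A) =
        waug (b + k - i) (add_mset i A) + waug (b - i) (add_mset i (add_mset k A)) +
        waug (b + k - (i + k)) (add_mset (i + k) A) +
        (\<Sum>c\<in>#A. waug (b - i) (add_mset i (add_mset (c + k) (A - {#c#}))))"
      unfolding wpsum_waug sum_mset_pick_add[of "\<lambda>c X. waug (b - i) (add_mset (c + k) X)"]
      by (simp add: add_mset_commute)
  qed simp
  then show ?thesis
    unfolding sum.distrib sw sum_shift_upto[of "\<lambda>i. waug (b + k - i) (add_mset i A)"] by simp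
qed

lemma wpsum_wsplit:
  assumes "k > 0"
  shows "wpsum k * wsplit a A = wsplit a (add_mset k A) + wsplit (a + k) A +
    (\<Sum>c\<in>#A. wsplit a (add_mset (c + k) (A - {#c#}))) + wexch a k A - waug a (add_mset k A)"
proof -
  have "{1..k} = insert k {1..<k}" using assms by auto
  then have "(\<Sum>i\<in>{1..k}. waug (a + k - i) (add_mset i A)) =
      waug a (add_mset k A) + (\<Sum>i\<in>{1..<k}. waug (a + k - i) (add_mset i A))" by simp
  then show ?thesis unfolding wsplit_def wpsum_sum_waug[OF order_refl] wexch_def by simp
qed

lemma wpsum_wexch:
  assumes "c > 0"
  shows "wpsum k * wexch a c A = wexch a c (add_mset k A) + wexch (a + k) c A + wexch a (c + k) A +
    (\<Sum>b\<in>#A. wexch a c (add_mset (b + k) (A - {#b#})))"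
proof -
  have c: "{1..<c} = {1..c - 1}" "{1..<c + k} = {1..c - 1 + k}" using assms by auto
  show ?thesis
    unfolding wexch_def right_diff_distrib c wpsum_sum_waug[OF le_add1, of k a c] 
      wpsum_sum_waug[of "c - 1" "a + c", OF le_trans[OF diff_le_self le_add2]] sum_mset_subtractf
    by (simp add: add_ac)
qed

lemma lax_waug:
  assumes "0 \<notin># A"
  shows "lax \<alpha> (waug a A) = (\<alpha> * real (a + 1) - 1 - real (size A)) *\<^sub>R waug a A + wsplit a A +
    (\<Sum>c\<in>#A. wexch a c (A - {#c#}))"
  using assms
proof (induction "size A" arbitrary: a A)
  case 0
  have "(\<Sum>b\<in>{1..a}. wpsum b * wpow (a - b)) = (\<Sum>b\<in>{1..a}. wpow a + waug (a - b) {#b#})"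
    by (intro sum.cong) (auto simp: wpsum_waug[of _ _ "{#}", unfolded waug_empty] waug_empty)
  also have "\<dots> = real a *\<^sub>R wpow a + wsplit a {#}"
    by (simp only: sum.distrib wsplit_def sum_constant_scaleR card_atLeastAtMost diff_Suc_1 Suc_eq_plus1[symmetric])
  finally show ?case using 0 by (simp add: waug_empty lax_wpow algebra_simps)
next
  case (Suc n)
  obtain k B where A: "A = add_mset k B" using Suc.hyps(2) by (metis size_eq_Suc_imp_eq_union)
  have k: "k > 0" and B: "0 \<notin># B" "n = size B" using Suc A by auto
  let ?s = "\<alpha> * real (a + 1) - 1 - real n"
  note IHB = Suc.hyps(1)[OF B(2) B(1)]
  have 1: "(\<Sum>c\<in>#B. lax \<alpha> (waug a (add_mset (c + k) (B - {#c#})))) =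
      (\<Sum>c\<in>#B. ?s *\<^sub>R waug a (add_mset (c + k) (B - {#c#})) + wsplit a (add_mset (c + k) (B - {#c#})) +
        (wexch a (c + k) (B - {#c#}) + (\<Sum>b\<in>#B - {#c#}. wexch a b (add_mset (c + k) (B - {#c#} - {#b#})))))"
  proof (intro arg_cong[where f = sum_mset] image_mset_cong)
    fix c assume c: "c \<in># B"
    have s: "n = size (add_mset (c + k) (B - {#c#}))" "0 \<notin># add_mset (c + k) (B - {#c#})"
      using c k B by (auto simp: size_Suc_Diff1 dest: in_diffD)
    from Suc.hyps(1)[OF s, of a] show "lax \<alpha> (waug a (add_mset (c + k) (B - {#c#}))) =
        ?s *\<^sub>R waug a (add_mset (c + k) (B - {#c#})) + wsplit a (add_mset (c + k) (B - {#c#})) +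
        (wexch a (c + k) (B - {#c#}) + (\<Sum>b\<in>#B - {#c#}. wexch a b (add_mset (c + k) (B - {#c#} - {#b#}))))"
      unfolding sum_mset_pick_add[of "\<lambda>b X. wexch a b X"] s(1)[symmetric] by simp
  qed
  have 2: "(\<Sum>c\<in>#B. wpsum k * wexch a c (B - {#c#})) =
      (\<Sum>c\<in>#B. wexch a c (add_mset k (B - {#c#})) + wexch (a + k) c (B - {#c#}) + wexch a (c + k) (B - {#c#}) +
        (\<Sum>b\<in>#B - {#c#}. wexch a c (add_mset (b + k) (B - {#c#} - {#b#}))))"
    using B by (intro arg_cong[where f = sum_mset] image_mset_cong wpsum_wexch) (metis not_gr0)
  have 3: "(\<Sum>c\<in>#B. \<Sum>b\<in>#B - {#c#}. wexch a c (add_mset (b + k) (B - {#c#} - {#b#}))) =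
      (\<Sum>c\<in>#B. \<Sum>b\<in>#B - {#c#}. wexch a b (add_mset (c + k) (B - {#c#} - {#b#})))"
    by (rule sum_mset_pick_swap[of "\<lambda>c b X. wexch a c (add_mset (b + k) X)"])
  \<comment> \<open>\<open>wpsum_waug\<close> solved for its longest term; in all other terms the
    multiset has one part fewer than \<open>A\<close>.\<close>
  have "waug a A = wpsum k * waug a B - waug (a + k) B - (\<Sum>c\<in>#B. waug a (add_mset (c + k) (B - {#c#})))"
    by (simp add: wpsum_waug A)
  then have "lax \<alpha> (waug a A) = lax \<alpha> (wpsum k * waug a B) - lax \<alpha> (waug (a + k) B)
      - (\<Sum>c\<in>#B. lax \<alpha> (waug a (add_mset (c + k) (B - {#c#}))))"
    by (simp add: linear_diff[OF linear_lax] linear_sum_mset[OF linear_lax])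
  also have "\<dots> = ?s *\<^sub>R (wpsum k * waug a B) + wpsum k * wsplit a B + (\<Sum>c\<in>#B. wpsum k * wexch a c (B - {#c#}))
      + (\<alpha> * real k) *\<^sub>R waug (a + k) B - lax \<alpha> (waug (a + k) B)
      - (\<Sum>c\<in>#B. lax \<alpha> (waug a (add_mset (c + k) (B - {#c#}))))"
    unfolding lax_wpsum[OF k] IHB wpow_waug B(2)[symmetric]
    by (simp add: distrib_left sum_mset_distrib_left mult_scaleR_poly)
  also have "\<dots> = ?s *\<^sub>R waug a A - waug a A + wsplit a A + wexch a k B + (\<Sum>c\<in>#B. wexch a c (add_mset k (B - {#c#})))"
    unfolding 1 2 IHB wpsum_wsplit[OF k] wpsum_waug B(2)[symmetric] sum_mset.distrib 3
    by (simp add: A scaleR_sum_mset algebra_simps)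
  finally have "lax \<alpha> (waug a A) = (?s - 1) *\<^sub>R waug a A + wsplit a A +
      (wexch a k B + (\<Sum>c\<in>#B. wexch a c (add_mset k (B - {#c#}))))"
    by (simp only: scaleR_diff_left scaleR_one add.assoc)
  moreover have "?s - 1 = \<alpha> * real (a + 1) - 1 - real (size A)" by (simp add: A B(2))
  ultimately show ?case
    by (simp only: A sum_mset_pick_add[of "\<lambda>c X. wexch a c X"])
qed

section \<open>Opening and closing of augmented monomials\<close>

abbreviation symaug :: "nat multiset \<Rightarrow> sym" where
  "symaug \<equiv> aug powersum"

definition wembed :: "sym \<Rightarrow> wsym" where
  "wembed = lin (\<lambda>\<kappa>. Poly_Mapping.single (0, \<kappa>) 1)"

lemma linear_wembed: "linear wembed"
  by (simp add: wembed_def)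

lemma wembed_mult: "wembed (F * G) = wembed F * wembed G"
proof -
  have 1: "wembed (Poly_Mapping.single \<kappa> 1 * H) = wembed (Poly_Mapping.single \<kappa> 1) * wembed H" for \<kappa> H
    by (rule linear_ext_single[OF linear_compose_fun[OF linear_wembed linear_mult_poly]
          linear_compose_fun[OF linear_mult_poly linear_wembed]]) (simp add: mult_single wembed_def)
  have "wembed (G * F) = wembed G * wembed F"
    by (rule linear_ext_single[OF linear_compose_fun[OF linear_wembed linear_mult_poly]
          linear_compose_fun[OF linear_mult_poly linear_wembed]]) (metis 1 mult.commute)
  then show ?thesis by (simp add: mult.commute)
qed

lemma wembed_symaug: "0 \<notin># A \<Longrightarrow> wembed (symaug A) = aug wpsum A"
  by (rule aug_hom)
    (auto simp: wembed_mult linear_add[OF linear_wembed], auto simp: wembed_def powersum_def wpsum_def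
        zero_prod_def[symmetric] simp flip: single_one)

text \<open>A monomial either avoids \<open>w\<close> or uses it for exactly one exponent
  \<open>c\<close>; this is \<open>aug_add_variable\<close> with new variable
  \<open>w\<close>.\<close>

lemma wpow_wembed:
  assumes "0 \<notin># A"
  shows "wpow a * wembed (symaug A) = waug a A + (\<Sum>c\<in>#A. waug (a + c) (A - {#c#}))"
proof -
  have "aug wpsum A = aug (\<lambda>k. (wpsum k - wpow k) + wpow 1 ^ k) A"
    unfolding wpow_power by simp
  also have "\<dots> = aug (\<lambda>k. wpsum k - wpow k) A + (\<Sum>c\<in>#A. wpow c * aug (\<lambda>k. wpsum k - wpow k) (A - {#c#}))"
    using aug_add_variable[of "\<lambda>k. wpsum k - wpow k" "wpow 1" A] by (simp only: wpow_power)
  finally show ?thesis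
    using assms by (simp add: wembed_symaug waug_def distrib_left sum_mset_distrib_left wpow_add mult.assoc)
qed

text \<open>The product rule for \<alpha> w d/dw; again the index \<open>k - 1\<close> means
  w^k.\<close>

lemma wopen_powersum:
  assumes "k > 0"
  shows "wopen \<alpha> (powersum k * F) = wpsum k * wopen \<alpha> F + (\<alpha> * real k) *\<^sub>R (wpow (k - 1) * wembed F)"
proof (rule linear_ext_single[of "\<lambda>F. wopen \<alpha> (powersum k * F)"
      "\<lambda>F. wpsum k * wopen \<alpha> F + (\<alpha> * real k) *\<^sub>R (wpow (k - 1) * wembed F)"])
  show "linear (\<lambda>F. wopen \<alpha> (powersum k * F))"
    by (intro linear_compose_fun[OF linear_wopen] linear_mult_poly)
  show "linear (\<lambda>F. wpsum k * wopen \<alpha> F + (\<alpha> * real k) *\<^sub>R (wpow (k - 1) * wembed F))"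
    by (intro linear_compose_add linear_compose_fun[OF linear_mult_poly] linear_wopen
        linear_compose_scale_right linear_wembed)
  fix \<kappa> :: partition
  have "image_mset (\<lambda>j. Poly_Mapping.single (j - 1, \<kappa> + single_part k - single_part j) (\<alpha> * real j)) (parts \<kappa>) =
      image_mset (\<lambda>j. wpsum k * Poly_Mapping.single (j - 1, \<kappa> - single_part j) (\<alpha> * real j)) (parts \<kappa>)"
    by (rule image_mset_cong) (simp add: single_diff_add wpsum_def mult_single add.commute)
  moreover have "\<kappa> + single_part k - single_part k = \<kappa>" by simp
  ultimately show "wopen \<alpha> (powersum k * Poly_Mapping.single \<kappa> 1) =
      wpsum k * wopen \<alpha> (Poly_Mapping.single \<kappa> 1) + (\<alpha> * real k) *\<^sub>R (wpow (k - 1) * wembed (Poly_Mapping.single \<kappa> 1))"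
    using assms
    by (simp add: powersum_def wopen_def wopen_basis_def wembed_def sum_mset_distrib_left wpow_def
        mult_single scaleR_single add.commute)
qed

text \<open>w d/dw multiplies a monomial by its exponent of \<open>w\<close>: terms without
  \<open>w\<close> disappear, the others carry the factor \<open>c\<close>.\<close>

lemma wopen_symaug:
  assumes "0 \<notin># A"
  shows "wopen \<alpha> (symaug A) = (\<Sum>c\<in>#A. (\<alpha> * real c) *\<^sub>R waug (c - 1) (A - {#c#}))"
  using assms
proof (induction "size A" arbitrary: A)
  case 0
  then show ?case by (simp add: wopen_def wopen_basis_def flip: single_one)
next
  case (Suc n)
  obtain k B where A: "A = add_mset k B" using Suc.hyps(2) by (metis size_eq_Suc_imp_eq_union)
  have k: "k > 0" and B: "0 \<notin># B" "n = size B" using Suc A by auto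
  have 1: "(\<Sum>c\<in>#B. wopen \<alpha> (symaug (add_mset (c + k) (B - {#c#})))) =
      (\<Sum>c\<in>#B. (\<alpha> * real (c + k)) *\<^sub>R waug (c + k - 1) (B - {#c#}) +
        (\<Sum>b\<in>#B - {#c#}. (\<alpha> * real b) *\<^sub>R waug (b - 1) (add_mset (c + k) (B - {#c#} - {#b#}))))"
  proof (intro arg_cong[where f = sum_mset] image_mset_cong)
    fix c assume c: "c \<in># B"
    have s: "n = size (add_mset (c + k) (B - {#c#}))" "0 \<notin># add_mset (c + k) (B - {#c#})"
      using c k B by (auto simp: size_Suc_Diff1 dest: in_diffD)
    from Suc.hyps(1)[OF s] show "wopen \<alpha> (symaug (add_mset (c + k) (B - {#c#}))) =
        (\<alpha> * real (c + k)) *\<^sub>R waug (c + k - 1) (B - {#c#}) +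
        (\<Sum>b\<in>#B - {#c#}. (\<alpha> * real b) *\<^sub>R waug (b - 1) (add_mset (c + k) (B - {#c#} - {#b#})))"
      unfolding sum_mset_pick_add[of "\<lambda>b X. (\<alpha> * real b) *\<^sub>R waug (b - 1) X"] by simp
  qed
  have 2: "(\<Sum>c\<in>#B. (\<alpha> * real c) *\<^sub>R (wpsum k * waug (c - 1) (B - {#c#}))) =
      (\<Sum>c\<in>#B. (\<alpha> * real c) *\<^sub>R waug (c + k - 1) (B - {#c#}) + (\<alpha> * real c) *\<^sub>R waug (c - 1) (add_mset k (B - {#c#})) +
        (\<Sum>b\<in>#B - {#c#}. (\<alpha> * real c) *\<^sub>R waug (c - 1) (add_mset (b + k) (B - {#c#} - {#b#}))))"
  proof (intro arg_cong[where f = sum_mset] image_mset_cong)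
    fix c assume c: "c \<in># B"
    then have "c - 1 + k = c + k - 1" using B(1) by (cases c) auto
    then show "(\<alpha> * real c) *\<^sub>R (wpsum k * waug (c - 1) (B - {#c#})) =
        (\<alpha> * real c) *\<^sub>R waug (c + k - 1) (B - {#c#}) + (\<alpha> * real c) *\<^sub>R waug (c - 1) (add_mset k (B - {#c#})) +
        (\<Sum>b\<in>#B - {#c#}. (\<alpha> * real c) *\<^sub>R waug (c - 1) (add_mset (b + k) (B - {#c#} - {#b#})))"
      unfolding wpsum_waug by (simp add: scaleR_add_right scaleR_sum_mset)
  qed
  have 3: "(\<Sum>c\<in>#B. \<Sum>b\<in>#B - {#c#}. (\<alpha> * real c) *\<^sub>R waug (c - 1) (add_mset (b + k) (B - {#c#} - {#b#}))) =
      (\<Sum>c\<in>#B. \<Sum>b\<in>#B - {#c#}. (\<alpha> * real b) *\<^sub>R waug (b - 1) (add_mset (c + k) (B - {#c#} - {#b#})))"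
    by (rule sum_mset_pick_swap[of "\<lambda>c b X. (\<alpha> * real c) *\<^sub>R waug (c - 1) (add_mset (b + k) X)"])
  have "wopen \<alpha> (symaug A) = wopen \<alpha> (powersum k * symaug B) -
      (\<Sum>c\<in>#B. wopen \<alpha> (symaug (add_mset (c + k) (B - {#c#}))))"
    by (simp add: A aug_add_mset[of powersum k B] linear_diff[OF linear_wopen] linear_sum_mset[OF linear_wopen])
  also have "\<dots> = (\<Sum>c\<in>#B. (\<alpha> * real c) *\<^sub>R (wpsum k * waug (c - 1) (B - {#c#}))) +
      (\<alpha> * real k) *\<^sub>R (waug (k - 1) B + (\<Sum>c\<in>#B. waug (c + k - 1) (B - {#c#}))) -
      (\<Sum>c\<in>#B. wopen \<alpha> (symaug (add_mset (c + k) (B - {#c#}))))"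
    unfolding wopen_powersum[OF k] Suc.hyps(1)[OF B(2,1)] wpow_wembed[OF B(1)]
    using k by (simp add: sum_mset_distrib_left mult_scaleR_poly add.commute)
  also have "\<dots> = (\<alpha> * real k) *\<^sub>R waug (k - 1) B + (\<Sum>c\<in>#B. (\<alpha> * real c) *\<^sub>R waug (c - 1) (add_mset k (B - {#c#})))"
    unfolding 1 2 sum_mset.distrib 3
    by (simp add: scaleR_sum_mset algebra_simps sum_mset.distrib)
  finally show ?case unfolding A sum_mset_pick_add[of "\<lambda>c X. (\<alpha> * real c) *\<^sub>R waug (c - 1) X"] .
qed

lemma wclose_wpsum: "k > 0 \<Longrightarrow> wclose (wpsum k * G) = powersum k * wclose G"
  by (rule linear_ext_single[OF linear_compose_fun[OF linear_wclose linear_mult_poly]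
        linear_compose_fun[OF linear_mult_poly linear_wclose]])
    (auto simp: wclose_def wpsum_def powersum_def mult_single add_ac)

text \<open>Once summed over, \<open>w\<close> is a variable like the others and carries the part
  \<open>a + 1\<close>.\<close>

lemma wclose_waug: "0 \<notin># A \<Longrightarrow> wclose (waug a A) = symaug (add_mset (a + 1) A)"
proof (induction "size A" arbitrary: a A)
  case 0
  then show ?case by (simp add: waug_empty wpow_def wclose_def powersum_def)
next
  case (Suc n)
  obtain k B where A: "A = add_mset k B" using Suc.hyps(2) by (metis size_eq_Suc_imp_eq_union)
  have k: "k > 0" and B: "0 \<notin># B" "n = size B" using Suc A by auto
  have 1: "(\<Sum>c\<in>#B. wclose (waug a (add_mset (c + k) (B - {#c#})))) =
      (\<Sum>c\<in>#B. symaug (add_mset (c + k) (add_mset (a + 1) (B - {#c#}))))"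
    using k B by (intro arg_cong[where f = sum_mset] image_mset_cong)
      (subst Suc.hyps(1), auto simp: size_Suc_Diff1 add_mset_commute dest: in_diffD)
  have "waug a A = wpsum k * waug a B - waug (a + k) B - (\<Sum>c\<in>#B. waug a (add_mset (c + k) (B - {#c#})))"
    by (simp add: wpsum_waug A)
  then have "wclose (waug a A) = powersum k * wclose (waug a B) - wclose (waug (a + k) B) -
      (\<Sum>c\<in>#B. wclose (waug a (add_mset (c + k) (B - {#c#}))))"
    using k by (simp add: linear_diff[OF linear_wclose] linear_sum_mset[OF linear_wclose] wclose_wpsum)
  also have "\<dots> = symaug (add_mset k (add_mset (a + 1) B))"
    unfolding 1 Suc.hyps(1)[OF B(2,1)] aug_add_mset[of powersum k "add_mset (a + 1) B"]
      sum_mset_pick_add[of "\<lambda>c X. symaug (add_mset (c + k) X)"] by (simp add: add_ac)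
  finally show ?case by (simp add: A add_mset_commute)
qed

section \<open>Triangularity\<close>

lemma lookup_powersum_mult:
  assumes "k > 0"
  shows "Poly_Mapping.lookup (powersum k * F) \<kappa> =
    (if k \<in># parts \<kappa> then Poly_Mapping.lookup F (\<kappa> - single_part k) else 0)"
proof (rule linear_ext_single[of "\<lambda>F. Poly_Mapping.lookup (powersum k * F) \<kappa>"
      "\<lambda>F. if k \<in># parts \<kappa> then Poly_Mapping.lookup F (\<kappa> - single_part k) else 0"])
  show "linear (\<lambda>F. Poly_Mapping.lookup (powersum k * F) \<kappa>)"
    by (rule linearI) (simp_all add: distrib_left lookup_add mult_scaleR_poly)
  show "linear (\<lambda>F :: sym. if k \<in># parts \<kappa> then Poly_Mapping.lookup F (\<kappa> - single_part k) else 0)"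
    by (rule linearI) (simp_all add: lookup_add)
  fix \<mu> :: partition
  have "single_part k + \<mu> = \<kappa> \<longleftrightarrow> k \<in># parts \<kappa> \<and> \<kappa> - single_part k = \<mu>"
  proof
    assume "single_part k + \<mu> = \<kappa>"
    then have "parts \<kappa> = add_mset k (parts \<mu>)" using assms by auto
    then show "k \<in># parts \<kappa> \<and> \<kappa> - single_part k = \<mu>" using assms by (simp add: parts_inject[symmetric])
  next
    assume "k \<in># parts \<kappa> \<and> \<kappa> - single_part k = \<mu>"
    then have "add_mset k (parts \<mu>) = parts \<kappa>" using assms by auto
    then show "single_part k + \<mu> = \<kappa>" using assms by (simp add: parts_inject[symmetric])
  qed
  then show "Poly_Mapping.lookup (powersum k * Poly_Mapping.single \<mu> 1) \<kappa> =
      (if k \<in># parts \<kappa> then Poly_Mapping.lookup (Poly_Mapping.single \<mu> 1) (\<kappa> - single_part k) else 0)"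
    by (auto simp: powersum_def mult_single lookup_single when_def)
qed

text \<open>Every correction in the recursion merges two parts, so p_A is the only power sum product
  of length at least \<open>size A\<close> in \<open>symaug A\<close>.\<close>

lemma lookup_symaug:
  assumes "0 \<notin># A" "size A \<le> plen \<kappa>"
  shows "Poly_Mapping.lookup (symaug A) \<kappa> = (if parts \<kappa> = A then 1 else 0)"
  using assms
proof (induction "size A" arbitrary: A \<kappa>)
  case 0
  then show ?case
    by (auto simp: lookup_one when_def parts_inject[symmetric])
next
  case (Suc n)
  obtain k B where A: "A = add_mset k B" using Suc.hyps(2) by (metis size_eq_Suc_imp_eq_union)
  have k: "k > 0" and B: "0 \<notin># B" "n = size B" using Suc A by auto
  have "(\<Sum>c\<in>#B. Poly_Mapping.lookup (symaug (add_mset (c + k) (B - {#c#}))) \<kappa>) = (\<Sum>c\<in>#B. 0)"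
  proof (intro arg_cong[where f = sum_mset] image_mset_cong)
    fix c assume c: "c \<in># B"
    have s: "n = size (add_mset (c + k) (B - {#c#}))" "0 \<notin># add_mset (c + k) (B - {#c#})"
      using c k B by (auto simp: size_Suc_Diff1 dest: in_diffD)
    moreover have "n < plen \<kappa>" using Suc.prems(2) A B by simp
    ultimately show "Poly_Mapping.lookup (symaug (add_mset (c + k) (B - {#c#}))) \<kappa> = 0"
      using Suc.hyps(1)[OF s, of \<kappa>] by (auto simp: plen_def)
  qed
  then have eq: "Poly_Mapping.lookup (symaug A) \<kappa> =
      (if k \<in># parts \<kappa> then Poly_Mapping.lookup (symaug B) (\<kappa> - single_part k) else 0)"
    by (simp add: A aug_add_mset[of powersum k B] lookup_minus lookup_sum_mset lookup_powersum_mult[OF k])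
  show ?case
  proof (cases "k \<in># parts \<kappa>")
    case True
    then have "size B \<le> plen (\<kappa> - single_part k)"
      using Suc.prems(2) k by (simp add: A plen_def size_Diff_singleton)
    with Suc.hyps(1)[OF B(2,1) this] True k eq insert_DiffM[OF True] show ?thesis
      by (auto simp: A)
  next
    case False
    then show ?thesis using eq A by auto
  qed
qed

text \<open>Among the multisets with nonzero coefficient a longest one is isolated by the
  coefficient of its power sum product.\<close>

lemma symaug_independent:
  assumes "finite D" "\<And>A. A \<in> D \<Longrightarrow> 0 \<notin># A" "(\<Sum>A\<in>D. c A *\<^sub>R symaug A) = 0" "A \<in> D"
  shows "c A = 0"
proof (rule ccontr)
  define S where "S = {A \<in> D. c A \<noteq> 0}"
  assume "c A \<noteq> 0"
  then have "finite S" "S \<noteq> {}" using assms by (auto simp: S_def)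
  then have "Max (size ` S) \<in> size ` S" by (intro Max_in) auto
  then obtain M where M: "M \<in> S" "size M = Max (size ` S)" by (metis imageE)
  then have M: "M \<in> S" "\<And>A. A \<in> S \<Longrightarrow> size A \<le> size M" using \<open>finite S\<close> by auto
  define \<kappa> where "\<kappa> = Abs_partition M"
  have \<kappa>: "parts \<kappa> = M" using M(1) assms(2) by (simp add: \<kappa>_def S_def Abs_partition_inverse)
  have "0 = (\<Sum>A\<in>D. c A * Poly_Mapping.lookup (symaug A) \<kappa>)"
    using arg_cong[OF assms(3), of "\<lambda>F. Poly_Mapping.lookup F \<kappa>"] by (simp add: lookup_sum)
  also have "\<dots> = (\<Sum>A\<in>D. if A = M then c M else 0)"
  proof (intro sum.cong)
    fix A assume A: "A \<in> D"
    show "c A * Poly_Mapping.lookup (symaug A) \<kappa> = (if A = M then c M else 0)"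
    proof (cases "c A = 0")
      case False
      then have "size A \<le> plen \<kappa>" using M(2)[of A] A by (simp add: S_def plen_def \<kappa>)
      then show ?thesis using lookup_symaug[OF assms(2)[OF A], of \<kappa>] by (auto simp: \<kappa>)
    qed auto
  qed simp
  also have "\<dots> = c M" using M(1) assms(1) by (simp add: S_def)
  finally show False using M(1) by (simp add: S_def)
qed

lemma subspace_sum_mset:
  assumes "subspace V" "\<And>x. x \<in># A \<Longrightarrow> f x \<in> V" shows "(\<Sum>x\<in>#A. f x) \<in> V"
  using assms(2) by (induction A) (auto intro: subspace_0[OF assms(1)] subspace_add[OF assms(1)])

lemma symaug_span: "F \<in> span (symaug ` {A. 0 \<notin># A})" (is "_ \<in> ?V")
proof -
  have mult: "powersum k * G \<in> ?V" if "k > 0" "G \<in> ?V" for k G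
  proof -
    have "powersum k * G \<in> span ((*) (powersum k) ` symaug ` {A. 0 \<notin># A})"
      using that(2) by (simp add: linear_span_image[OF linear_mult_poly])
    also have "\<dots> \<subseteq> ?V"
    proof (rule span_minimal)
      show "(*) (powersum k) ` symaug ` {A. 0 \<notin># A} \<subseteq> ?V"
      proof clarsimp
        fix A :: "nat multiset" assume A: "0 \<notin># A"
        have "(\<Sum>c\<in>#A. symaug (add_mset (c + k) (A - {#c#}))) \<in> ?V"
          using A that(1) by (intro subspace_sum_mset[OF subspace_span] span_base imageI) (auto dest: in_diffD)
        then show "powersum k * symaug A \<in> ?V"
          unfolding aug_mult[of powersum k A] using A that(1) by (intro span_add) (auto intro: span_base)
      qed
    qed (rule subspace_span)
    finally show ?thesis .
  qed
  have "Poly_Mapping.single \<kappa> 1 \<in> ?V" for \<kappa>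
  proof (induction "size (parts \<kappa>)" arbitrary: \<kappa>)
    case 0
    then have "\<kappa> = 0" by (simp add: parts_inject[symmetric])
    then have "Poly_Mapping.single \<kappa> 1 = symaug {#}" by simp
    then show ?case by (metis (mono_tags) empty_iff image_eqI mem_Collect_eq set_mset_empty span_base)
  next
    case (Suc n)
    obtain k B where A: "parts \<kappa> = add_mset k B" using Suc.hyps(2) by (metis size_eq_Suc_imp_eq_union)
    then have k: "k > 0" using parts_pos[of k \<kappa>] by simp
    have "\<kappa> = single_part k + (\<kappa> - single_part k)" using k A by (simp add: parts_inject[symmetric])
    then have "Poly_Mapping.single \<kappa> 1 = powersum k * Poly_Mapping.single (\<kappa> - single_part k) 1"
      by (simp add: powersum_def mult_single)
    moreover have "Poly_Mapping.single (\<kappa> - single_part k) 1 \<in> ?V"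
      using Suc A k by (intro Suc.hyps) simp
    ultimately show ?case using mult[OF k] by simp
  qed
  then have "range (\<lambda>\<kappa>. Poly_Mapping.single \<kappa> 1) \<subseteq> ?V" by auto
  from span_minimal[OF this subspace_span] show ?thesis using poly_mapping_span by blast
qed

section \<open>Strictly lower terms and triangular action\<close>

definition dless :: "nat multiset \<Rightarrow> nat multiset \<Rightarrow> bool" where
  "dless A B \<longleftrightarrow> dle A B \<and> A \<noteq> B"

lemma dless_trans2: "dless A B \<Longrightarrow> dle B C \<Longrightarrow> dless A C"
  unfolding dless_def by (auto intro: dle_trans dest: dle_antisym)

lemma dless_imp_dle: "dless A B \<Longrightarrow> dle A B"
  by (simp add: dless_def)

lemma dle_no_zero: "dle A B \<Longrightarrow> 0 \<notin># A" "dle A B \<Longrightarrow> 0 \<notin># B"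
  by (simp_all add: dle_def)

lemma dless_squeeze:
  assumes "0 \<notin># C" "i + j = a + b" "b < i" "i < a" "0 < b"
  shows "dless (add_mset i (add_mset j C)) (add_mset a (add_mset b C))"
proof -
  have "add_mset i (add_mset j C) \<noteq> add_mset a (add_mset b C)"
  proof
    assume "add_mset i (add_mset j C) = add_mset a (add_mset b C)"
    then have "{#i, j#} = {#a, b#}" by (metis add_right_cancel union_mset_add_mset_left empty_neutral(1))
    then have "i \<in># {#a, b#}" by (metis union_single_eq_member)
    then show False using assms by auto
  qed
  then show ?thesis using assms dle_squeeze[of C i j a b] by (simp add: dless_def)
qed

lemma dless_split:
  assumes "0 \<notin># C" "0 < i" "0 < j" "i + j = a"
  shows "dless (add_mset i (add_mset j C)) (add_mset a C)"
proof -
  have "size (add_mset i (add_mset j C)) \<noteq> size (add_mset a C)" by simp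
  then show ?thesis using assms dle_split[of C i j a] by (auto simp: dless_def simp del: size_add_mset)
qed

definition low :: "nat multiset \<Rightarrow> sym set" where
  "low B = span (symaug ` {A. dless A B})"

text \<open>Terms are compared after the exponent of \<open>w\<close> has been counted as the part
  \<open>Suc e\<close>.\<close>

definition wlow :: "nat multiset \<Rightarrow> wsym set" where
  "wlow B = span {waug e A | e A. dless (add_mset (Suc e) A) B}"

lemma subspace_low: "subspace (low B)" and subspace_wlow: "subspace (wlow B)"
  by (simp_all add: low_def wlow_def)

lemma symaug_low: "dless A B \<Longrightarrow> symaug A \<in> low B"
  unfolding low_def by (intro span_base) auto

lemma waug_wlow: "dless (add_mset (Suc e) A) B \<Longrightarrow> waug e A \<in> wlow B"
  unfolding wlow_def by (intro span_base) auto

lemma low_mono: "dle A B \<Longrightarrow> low A \<subseteq> low B"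
  unfolding low_def by (intro span_mono) (auto intro: dless_trans2)

lemma wlow_mono: "dle A B \<Longrightarrow> wlow A \<subseteq> wlow B"
  unfolding wlow_def by (intro span_mono) (auto intro: dless_trans2)



lemma wsplit_wlow:
  assumes "0 \<notin># A" shows "wsplit a A \<in> wlow (add_mset (Suc a) A)"
  unfolding wsplit_def
proof (intro subspace_sum[OF subspace_wlow] waug_wlow)
  fix i assume "i \<in> {1..a}"
  then show "dless (add_mset (Suc (a - i)) (add_mset i A)) (add_mset (Suc a) A)"
    using assms by (intro dless_split) auto
qed

text \<open>The exchange produces exponents between \<open>c\<close> and \<open>a + 1\<close>. Those
  strictly inside are strictly lower; one end term reproduces the pair itself, in place if
  \<open>c \<le> a\<close> and with the two variables interchanged if
  \<open>c > Suc a\<close>.\<close>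

lemma wexch_wlow:
  assumes "0 \<notin># C" "c > 0"
  shows "wexch a c C - (if c \<le> a then waug a (add_mset c C) else 0) +
    (if c > Suc a then waug (c - 1) (add_mset (Suc a) C) else 0) \<in> wlow (add_mset (Suc a) (add_mset c C))"
proof -
  define h where "h i = waug (a + c - i) (add_mset i C)" for i
  have wexch: "wexch a c C = (\<Sum>i\<in>{1..<Suc a}. h i) - (\<Sum>i\<in>{1..<c}. h i)"
    by (simp add: wexch_def h_def atLeastLessThanSuc_atLeastAtMost)
  have h: "h i \<in> wlow (add_mset (Suc a) (add_mset c C))" if "min c (Suc a) < i" "i < max c (Suc a)" for i
    unfolding h_def
  proof (rule waug_wlow, cases "c \<le> Suc a")
    case True
    then show "dless (add_mset (Suc (a + c - i)) (add_mset i C)) (add_mset (Suc a) (add_mset c C))"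
      using that assms by (intro dless_squeeze) auto
  next
    case False
    then have "dless (add_mset (Suc (a + c - i)) (add_mset i C)) (add_mset c (add_mset (Suc a) C))"
      using that assms by (intro dless_squeeze) auto
    then show "dless (add_mset (Suc (a + c - i)) (add_mset i C)) (add_mset (Suc a) (add_mset c C))"
      by (simp add: add_mset_commute)
  qed
  consider "c \<le> a" | "c = Suc a" | "c > Suc a" by linarith
  then show ?thesis
  proof cases
    case 1
    have "(\<Sum>i\<in>{1..<Suc a}. h i) = (\<Sum>i\<in>{1..<c}. h i) + (\<Sum>i\<in>{c..<Suc a}. h i)"
      using 1 assms by (intro sum.atLeastLessThan_concat[symmetric]) auto
    also have "(\<Sum>i\<in>{c..<Suc a}. h i) = h c + (\<Sum>i\<in>{Suc c..<Suc a}. h i)"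
      using 1 by (intro sum.atLeast_Suc_lessThan) auto
    finally have "wexch a c C = waug a (add_mset c C) + (\<Sum>i\<in>{Suc c..<Suc a}. h i)"
      unfolding wexch by (simp add: h_def)
    moreover have "(\<Sum>i\<in>{Suc c..<Suc a}. h i) \<in> wlow (add_mset (Suc a) (add_mset c C))"
      using 1 by (intro subspace_sum[OF subspace_wlow] h) auto
    ultimately show ?thesis using 1 by simp
  next
    case 2
    then show ?thesis unfolding wexch by (simp add: subspace_0[OF subspace_wlow])
  next
    case 3
    have "(\<Sum>i\<in>{1..<c}. h i) = (\<Sum>i\<in>{1..<Suc a}. h i) + (\<Sum>i\<in>{Suc a..<c}. h i)"
      using 3 assms by (intro sum.atLeastLessThan_concat[symmetric]) auto
    also have "(\<Sum>i\<in>{Suc a..<c}. h i) = h (Suc a) + (\<Sum>i\<in>{Suc (Suc a)..<c}. h i)"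
      using 3 by (intro sum.atLeast_Suc_lessThan) auto
    finally have "wexch a c C = - waug (c - 1) (add_mset (Suc a) C) - (\<Sum>i\<in>{Suc (Suc a)..<c}. h i)"
      unfolding wexch by (simp add: h_def)
    moreover have "- (\<Sum>i\<in>{Suc (Suc a)..<c}. h i) \<in> wlow (add_mset (Suc a) (add_mset c C))"
      using 3 by (intro subspace_neg[OF subspace_wlow] subspace_sum[OF subspace_wlow] h) auto
    ultimately show ?thesis using 3 by simp
  qed
qed

text \<open>Each part \<open>c \<le> a\<close> returns one diagonal term and cancels one unit of
  \<open>- 1 - size A\<close>. What remains counts the parts of \<open>B\<close> that are at least
  \<open>Suc a\<close>, including that of \<open>w\<close>.\<close>

lemma lax_waug_triangular:
  fixes a :: nat
  assumes "0 \<notin># A"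
  defines "B \<equiv> add_mset (Suc a) A"
  shows "lax \<alpha> (waug a A) - ((\<alpha> * real (Suc a) - real (size {#b \<in># B. Suc a \<le> b#})) *\<^sub>R waug a A -
    (\<Sum>c\<in>#A. if c > Suc a then waug (c - 1) (B - {#c#}) else 0)) \<in> wlow B"
proof -
  let ?t = "\<lambda>c. if c > Suc a then waug (c - 1) (add_mset (Suc a) (A - {#c#})) else 0"
  have 1: "(\<Sum>c\<in>#A. wexch a c (A - {#c#}) - (if c \<le> a then waug a A else 0) + ?t c) \<in> wlow B"
  proof (rule subspace_sum_mset[OF subspace_wlow])
    fix c assume c: "c \<in># A"
    moreover have "c > 0" "0 \<notin># A - {#c#}" using c assms by (metis not_gr0, metis in_diffD)
    ultimately show "wexch a c (A - {#c#}) - (if c \<le> a then waug a A else 0) + ?t c \<in> wlow B"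
      using wexch_wlow[of "A - {#c#}" c a] by (simp only: insert_DiffM[OF c] B_def simp_thms)
  qed
  have t: "(\<Sum>c\<in>#A. if c > Suc a then waug (c - 1) (B - {#c#}) else 0) = (\<Sum>c\<in>#A. ?t c)"
    by (intro arg_cong[where f = sum_mset] image_mset_cong) (auto simp: B_def)
  have "(\<Sum>c\<in>#X. if c \<le> a then waug a A else 0) = real (size {#b \<in># X. b \<le> a#}) *\<^sub>R waug a A" for X
    by (induction X) (auto simp: scaleR_add_left)
  note this[of A]
  moreover have "real (size A) = real (size {#b \<in># A. b \<le> a#}) + real (size {#b \<in># A. Suc a \<le> b#})"
    by (induction A) auto
  moreover have "size {#b \<in># B. Suc a \<le> b#} = Suc (size {#b \<in># A. Suc a \<le> b#})" by (simp add: B_def)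
  ultimately have "lax \<alpha> (waug a A) - ((\<alpha> * real (Suc a) - real (size {#b \<in># B. Suc a \<le> b#})) *\<^sub>R waug a A -
      (\<Sum>c\<in>#A. ?t c)) = wsplit a A + (\<Sum>c\<in>#A. wexch a c (A - {#c#}) - (if c \<le> a then waug a A else 0) + ?t c)"
    unfolding lax_waug[OF assms(1)] by (simp add: sum_mset.distrib sum_mset_subtractf algebra_simps)
  then show ?thesis
    unfolding t using 1 wsplit_wlow[OF assms(1), of a, folded B_def] subspace_add[OF subspace_wlow] by simp
qed

lemma linear_span_into:
  assumes "linear f" "\<And>x. x \<in> S \<Longrightarrow> f x \<in> V" "subspace V" "x \<in> span S"
  shows "f x \<in> V"
proof -
  have "f x \<in> span (f ` S)" using assms(4) by (simp add: linear_span_image[OF assms(1)])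
  moreover have "span (f ` S) \<subseteq> V" using assms(2,3) by (intro span_minimal) auto
  ultimately show ?thesis by blast
qed

lemma lax_wlow: "X \<in> wlow B \<Longrightarrow> lax \<alpha> X \<in> wlow B"
proof (rule linear_span_into[OF linear_lax _ subspace_wlow])
  show "X \<in> wlow B \<Longrightarrow> X \<in> span {waug e A | e A. dless (add_mset (Suc e) A) B}" by (simp add: wlow_def)
  fix x assume "x \<in> {waug e A | e A. dless (add_mset (Suc e) A) B}"
  then obtain a A where x: "x = waug a A" and B: "dless (add_mset (Suc a) A) B" by blast
  let ?B = "add_mset (Suc a) A"
  have A: "0 \<notin># A" using dle_no_zero[OF dless_imp_dle[OF B]] by simp
  let ?m = "(\<alpha> * real (Suc a) - real (size {#b \<in># ?B. Suc a \<le> b#})) *\<^sub>R waug a A -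
    (\<Sum>c\<in>#A. if c > Suc a then waug (c - 1) (?B - {#c#}) else 0)"
  have "?m \<in> wlow B"
  proof (intro subspace_diff[OF subspace_wlow] subspace_scale[OF subspace_wlow] subspace_sum_mset[OF subspace_wlow])
    show "waug a A \<in> wlow B" using B by (rule waug_wlow)
    fix c assume c: "c \<in># A"
    then have "c > 0" using A by (metis not_gr0)
    then have "add_mset (Suc (c - 1)) (?B - {#c#}) = ?B" using c by simp
    then have "waug (c - 1) (?B - {#c#}) \<in> wlow B"
      using B waug_wlow[of "c - 1" "?B - {#c#}" B] by (simp only: simp_thms)
    then show "(if c > Suc a then waug (c - 1) (?B - {#c#}) else 0) \<in> wlow B"
      by (simp only: subspace_0[OF subspace_wlow] split: if_split) simp
  qed
  moreover have "lax \<alpha> x - ?m \<in> wlow B"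
    using lax_waug_triangular[OF A, of \<alpha> a] wlow_mono[OF dless_imp_dle[OF B]] by (auto simp: x)
  ultimately have "?m + (lax \<alpha> x - ?m) \<in> wlow B" by (rule subspace_add[OF subspace_wlow])
  then show "lax \<alpha> x \<in> wlow B" by simp
qed

lemma lax_pow_wlow: "X \<in> wlow B \<Longrightarrow> (lax \<alpha> ^^ l) X \<in> wlow B"
  by (induction l) (auto intro: lax_wlow)

lemma wclose_wlow: "X \<in> wlow B \<Longrightarrow> wclose X \<in> low B"
proof (rule linear_span_into[OF linear_wclose _ subspace_low])
  show "X \<in> wlow B \<Longrightarrow> X \<in> span {waug e A | e A. dless (add_mset (Suc e) A) B}" by (simp add: wlow_def)
  fix x assume "x \<in> {waug e A | e A. dless (add_mset (Suc e) A) B}"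
  then obtain a A where x: "x = waug a A" and B: "dless (add_mset (Suc a) A) B" by blast
  have A: "0 \<notin># A" using dle_no_zero[OF dless_imp_dle[OF B]] by simp
  show "wclose x \<in> low B" using symaug_low[OF B] by (simp add: x wclose_waug[OF A])
qed

text \<open>\<open>part_eig \<alpha> B l c\<close> is the coefficient of \<open>symaug B\<close> in \<open>R D\<^sup>l\<close> applied to the sum of those
  terms of \<open>symaug B\<close> in which the part \<open>c\<close> of \<open>B\<close> is the exponent of \<open>w\<close>, modulo lower terms.\<close>

fun part_eig :: "real \<Rightarrow> nat multiset \<Rightarrow> nat \<Rightarrow> nat \<Rightarrow> real" where
  "part_eig \<alpha> B 0 a = 1"
| "part_eig \<alpha> B (Suc l) a = (\<alpha> * real a - real (size {#b \<in># B. a \<le> b#})) * part_eig \<alpha> B l a -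
     (\<Sum>b\<in>#B. if a < b then part_eig \<alpha> B l b else 0)"

definition eig :: "real \<Rightarrow> nat \<Rightarrow> nat multiset \<Rightarrow> real" where
  "eig \<alpha> l B = \<alpha> * (\<Sum>c\<in>#B. real c * part_eig \<alpha> B l c)"

lemma linear_lax_pow: "linear (\<lambda>X. wclose ((lax \<alpha> ^^ l) X))"
  by (intro linear_compose_fun[OF linear_wclose] linear_funpow linear_lax)

lemma lax_pow_triangular:
  assumes "0 \<notin># B" "c \<in># B"
  shows "wclose ((lax \<alpha> ^^ l) (waug (c - 1) (B - {#c#}))) - part_eig \<alpha> B l c *\<^sub>R symaug B \<in> low B"
  using assms(2)
proof (induction l arbitrary: c)
  case 0
  then have "c > 0" "0 \<notin># B - {#c#}" using assms by (metis not_gr0, metis in_diffD)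
  then show ?case using 0 by (simp add: wclose_waug subspace_0[OF subspace_low])
next
  case (Suc l)
  define A where "A = B - {#c#}"
  have c: "c > 0" "0 \<notin># A" unfolding A_def using Suc.prems assms by (metis not_gr0, metis in_diffD)
  have B: "add_mset (Suc (c - 1)) A = B" using Suc.prems c by (simp add: A_def)
  let ?f = "\<lambda>X. wclose ((lax \<alpha> ^^ l) X)"
  let ?d = "\<alpha> * real c - real (size {#b \<in># B. c \<le> b#})"
  let ?R = "lax \<alpha> (waug (c - 1) A) - (?d *\<^sub>R waug (c - 1) A - (\<Sum>b\<in>#A. if c < b then waug (b - 1) (B - {#b#}) else 0))"
  have R: "?R \<in> wlow B" using lax_waug_triangular[OF c(2), of \<alpha> "c - 1"] c(1) unfolding B by simp
  have 1: "?f ?R \<in> low B" by (intro wclose_wlow lax_pow_wlow R)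
  have 2: "?d *\<^sub>R (?f (waug (c - 1) A) - part_eig \<alpha> B l c *\<^sub>R symaug B) \<in> low B"
    using Suc.IH[OF Suc.prems] by (intro subspace_scale[OF subspace_low]) (simp add: A_def)
  have 3: "(\<Sum>b\<in>#A. if c < b then ?f (waug (b - 1) (B - {#b#})) - part_eig \<alpha> B l b *\<^sub>R symaug B else 0) \<in> low B"
    using Suc.IH by (intro subspace_sum_mset[OF subspace_low])
      (auto simp: A_def subspace_0[OF subspace_low] dest: in_diffD)
  have "(\<Sum>b\<in>#A. if c < b then ?f (waug (b - 1) (B - {#b#})) - part_eig \<alpha> B l b *\<^sub>R symaug B else 0) =
      (\<Sum>b\<in>#A. ?f (if c < b then waug (b - 1) (B - {#b#}) else 0)) -
      (\<Sum>b\<in>#A. if c < b then part_eig \<alpha> B l b else 0) *\<^sub>R symaug B"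
    unfolding linear_sum_mset[OF linear_scaleR_left]
    by (subst sum_mset_subtractf[symmetric], intro arg_cong[where f = sum_mset] image_mset_cong)
      (simp add: linear_0[OF linear_lax_pow])
  moreover have "(\<Sum>b\<in>#A. if c < b then part_eig \<alpha> B l b else 0) = (\<Sum>b\<in>#B. if c < b then part_eig \<alpha> B l b else 0)"
    unfolding B[symmetric] using c(1) by simp
  moreover have "?f ?R = ?f (lax \<alpha> (waug (c - 1) A)) - (?d *\<^sub>R ?f (waug (c - 1) A) -
      (\<Sum>b\<in>#A. ?f (if c < b then waug (b - 1) (B - {#b#}) else 0)))"
    by (simp only: linear_diff[OF linear_lax_pow] linear_scale[OF linear_lax_pow] linear_sum_mset[OF linear_lax_pow])
  ultimately have "?f (lax \<alpha> (waug (c - 1) A)) - part_eig \<alpha> B (Suc l) c *\<^sub>R symaug B =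
      ?f ?R + ?d *\<^sub>R (?f (waug (c - 1) A) - part_eig \<alpha> B l c *\<^sub>R symaug B) -
      (\<Sum>b\<in>#A. if c < b then ?f (waug (b - 1) (B - {#b#})) - part_eig \<alpha> B l b *\<^sub>R symaug B else 0)"
    by (simp add: algebra_simps)
  also have "\<dots> \<in> low B" by (intro subspace_diff[OF subspace_low] subspace_add[OF subspace_low] 1 2 3)
  finally show ?case by (simp add: A_def funpow_swap1)
qed

lemma ham_triangular:
  assumes "0 \<notin># B" shows "ham \<alpha> l (symaug B) - eig \<alpha> l B *\<^sub>R symaug B \<in> low B"
proof -
  let ?f = "\<lambda>X. wclose ((lax \<alpha> ^^ l) X)"
  have "(\<Sum>c\<in>#B. (\<alpha> * real c) *\<^sub>R (?f (waug (c - 1) (B - {#c#})) - part_eig \<alpha> B l c *\<^sub>R symaug B)) \<in> low B"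
    by (intro subspace_sum_mset[OF subspace_low] subspace_scale[OF subspace_low] lax_pow_triangular assms)
  also have "(\<Sum>c\<in>#B. (\<alpha> * real c) *\<^sub>R (?f (waug (c - 1) (B - {#c#})) - part_eig \<alpha> B l c *\<^sub>R symaug B)) =
      ham \<alpha> l (symaug B) - eig \<alpha> l B *\<^sub>R symaug B"
    by (simp add: ham_def wopen_symaug[OF assms] linear_sum_mset[OF linear_lax_pow] linear_scale[OF linear_lax_pow]
        scaleR_diff_right sum_mset_subtractf eig_def sum_mset_distrib_left linear_sum_mset[OF linear_scaleR_left]
        mult.assoc)
  finally show ?thesis .
qed

lemma ham_low: "X \<in> low B \<Longrightarrow> ham \<alpha> l X \<in> low B"
proof (rule linear_span_into[OF linear_ham _ subspace_low])
  show "X \<in> low B \<Longrightarrow> X \<in> span (symaug ` {A. dless A B})" by (simp add: low_def)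
  fix x assume "x \<in> symaug ` {A. dless A B}"
  then obtain A where A: "dless A B" "x = symaug A" by blast
  have "ham \<alpha> l x - eig \<alpha> l A *\<^sub>R x \<in> low B"
    using ham_triangular[of A \<alpha> l] low_mono[OF dless_imp_dle[OF A(1)]] A dle_no_zero[OF dless_imp_dle[OF A(1)]]
    by auto
  then have "(ham \<alpha> l x - eig \<alpha> l A *\<^sub>R x) + eig \<alpha> l A *\<^sub>R x \<in> low B"
    using symaug_low[OF A(1)] A(2) by (intro subspace_add[OF subspace_low] subspace_scale[OF subspace_low]) auto
  then show "ham \<alpha> l x \<in> low B" by simp
qed

text \<open>Monic Jack functions, up to the normalisation constants of the monomials.\<close>

definition jackP :: "real \<Rightarrow> nat multiset \<Rightarrow> sym" where
  "jackP \<alpha> B = (SOME P. P - symaug B \<in> low B \<and> (\<forall>z\<in>low B. jack_inner \<alpha> P z = 0))"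

lemma
  assumes "\<alpha> > 0"
  shows jackP_low: "jackP \<alpha> B - symaug B \<in> low B"
    and jackP_orthogonal_low: "z \<in> low B \<Longrightarrow> jack_inner \<alpha> (jackP \<alpha> B) z = 0"
proof -
  have "finite (symaug ` {A. dless A B})"
    by (intro finite_imageI finite_subset[OF _ finite_dle[of B]]) (auto simp: dless_def)
  from orthogonal_projection[of "jweight \<alpha>", OF jweight_pos[OF assms] this, of "symaug B"]
  obtain y where y: "y \<in> low B" "\<forall>z\<in>low B. jack_inner \<alpha> (symaug B - y) z = 0"
    unfolding low_def jack_inner_form by blast
  have "\<exists>P. P - symaug B \<in> low B \<and> (\<forall>z\<in>low B. jack_inner \<alpha> P z = 0)"
    using y subspace_neg[OF subspace_low y(1)] by (intro exI[of _ "symaug B - y"]) simp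
  from someI_ex[OF this, folded jackP_def]
  show "jackP \<alpha> B - symaug B \<in> low B" "z \<in> low B \<Longrightarrow> jack_inner \<alpha> (jackP \<alpha> B) z = 0" by auto
qed

text \<open>The defect lies in \<open>low B\<close> by triangularity. Since \<open>ham\<close> is
  self-adjoint and preserves \<open>low B\<close>, the defect is also orthogonal to
  \<open>low B\<close>, hence to itself.\<close>

lemma ham_jackP:
  assumes "\<alpha> > 0" "0 \<notin># B"
  shows "ham \<alpha> l (jackP \<alpha> B) = eig \<alpha> l B *\<^sub>R jackP \<alpha> B"
proof -
  let ?P = "jackP \<alpha> B"
  define D where "D = ham \<alpha> l ?P - eig \<alpha> l B *\<^sub>R ?P"
  have "D = (ham \<alpha> l (symaug B) - eig \<alpha> l B *\<^sub>R symaug B) + ham \<alpha> l (?P - symaug B) - eig \<alpha> l B *\<^sub>R (?P - symaug B)"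
    by (simp add: D_def linear_diff[OF linear_ham] algebra_simps)
  also have "\<dots> \<in> low B"
    by (intro subspace_diff[OF subspace_low] subspace_add[OF subspace_low] subspace_scale[OF subspace_low]
        ham_triangular ham_low jackP_low assms)
  finally have D: "D \<in> low B" .
  have "jack_inner \<alpha> D D = jack_inner \<alpha> ?P (ham \<alpha> l D) - eig \<alpha> l B * jack_inner \<alpha> ?P D"
    by (subst D_def) (simp add: jack_inner_form form_linear ham_adjoint[unfolded jack_inner_form])
  also have "\<dots> = 0" using jackP_orthogonal_low[OF assms(1)] ham_low[OF D] D by simp
  finally have "D = 0" using form_pos[of "jweight \<alpha>" D, OF jweight_pos[OF assms(1)]] by (simp add: jack_inner_form)
  then show ?thesis by (simp add: D_def)
qed

section \<open>Separation of the eigenvalues\<close>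

text \<open>Part \<open>j\<close> of the conjugate partition.\<close>

definition tail :: "nat multiset \<Rightarrow> nat \<Rightarrow> nat" where
  "tail B j = size {#b \<in># B. j \<le> b#}"

lemma tail_Suc: "tail B j = tail B (Suc j) + count B j"
  unfolding tail_def by (induction B) (auto simp: Suc_le_eq)

lemma tail_eq_0: "sum_mset B < j \<Longrightarrow> tail B j = 0"
  unfolding tail_def by (induction B) auto

lemma fps_of_poly_one_minus: "fps_of_poly [:1, - c:] = 1 - fps_const c * fps_X" for c :: "'a::comm_ring_1"
  by (simp add: fps_of_poly_linear' flip: fps_const_neg)

context
  fixes \<alpha> :: real and B :: "nat multiset"
begin

text \<open>Generating functions in the power \<open>l\<close>: \<open>F a\<close> belongs to one
  part, \<open>\<Gamma> j\<close> collects the parts from \<open>j\<close> on. For positive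
  \<open>j\<close>, \<open>G j\<close> is \<open>\<Gamma> j\<close> with its denominator cleared,
  see \<open>\<Gamma>_mult\<close>.\<close>

private definition F :: "nat \<Rightarrow> real fps" where "F a = Abs_fps (\<lambda>l. part_eig \<alpha> B l a)"
private definition \<Gamma> :: "nat \<Rightarrow> real fps" where
  "\<Gamma> j = 1 - fps_X * (\<Sum>b\<in>#B. if j \<le> b then F b else 0)"
private definition G :: "nat \<Rightarrow> real fps" where
  "G j = (1 - fps_const (\<alpha> * real j - real (tail B (Suc j))) * fps_X) * \<Gamma> (Suc j)"

private lemma F_eq:
  "(1 - fps_const (\<alpha> * real j - real (tail B j)) * fps_X) * F j = \<Gamma> (Suc j)"
proof -
  have "fps_nth (\<Sum>b\<in>#X. if j < b then F b else 0) l = (\<Sum>b\<in>#X. if j < b then part_eig \<alpha> B l b else 0)" for X l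
    by (induction X) (auto simp: F_def)
  then have "F j = 1 + fps_X * (fps_const (\<alpha> * real j - real (tail B j)) * F j - (\<Sum>b\<in>#B. if j < b then F b else 0))"
  proof (intro fps_ext)
    fix l
    assume "\<And>X l. fps_nth (\<Sum>b\<in>#X. if j < b then F b else 0) l = (\<Sum>b\<in>#X. if j < b then part_eig \<alpha> B l b else 0)"
    then show "fps_nth (F j) l = fps_nth (1 + fps_X * (fps_const (\<alpha> * real j - real (tail B j)) * F j -
        (\<Sum>b\<in>#B. if j < b then F b else 0))) l"
      by (cases l) (simp_all add: F_def tail_def)
  qed
  then show ?thesis unfolding \<Gamma>_def Suc_le_eq by (simp add: algebra_simps)
qed

private lemma \<Gamma>_Suc: "\<Gamma> j = \<Gamma> (Suc j) - fps_const (real (count B j)) * fps_X * F j"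
proof -
  have "(\<Sum>b\<in>#X. if j \<le> b then F b else 0) = (\<Sum>b\<in>#X. if Suc j \<le> b then F b else 0) + fps_const (real (count X j)) * F j" for X
  proof (induction X)
    case (add x X)
    then show ?case by (cases "x = j") (auto simp: algebra_simps simp flip: fps_const_add)
  qed simp
  then show ?thesis unfolding \<Gamma>_def by (simp add: algebra_simps)
qed

private lemma \<Gamma>_mult: "\<Gamma> (Suc j) * (1 - fps_const (\<alpha> * real (Suc j) - real (tail B (Suc j))) * fps_X) = G (Suc j)"
proof -
  let ?d = "\<alpha> * real (Suc j) - real (tail B (Suc j))"
  have "\<Gamma> (Suc j) * (1 - fps_const ?d * fps_X) = \<Gamma> (Suc (Suc j)) * (1 - fps_const ?d * fps_X) -
      fps_const (real (count B (Suc j))) * fps_X * ((1 - fps_const ?d * fps_X) * F (Suc j))"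
    by (subst \<Gamma>_Suc) (simp add: algebra_simps)
  also have "\<dots> = (1 - (fps_const ?d + fps_const (real (count B (Suc j)))) * fps_X) * \<Gamma> (Suc (Suc j))"
    unfolding F_eq by (simp only: algebra_simps)
  also have "fps_const ?d + fps_const (real (count B (Suc j))) = fps_const (\<alpha> * real (Suc j) - real (tail B (Suc (Suc j))))"
    using tail_Suc[of B "Suc j"] by simp
  finally show ?thesis by (simp add: G_def)
qed

text \<open>The additive relation: it telescopes to \<open>G 0\<close> in terms of all
  \<open>\<Gamma>\<close>, hence of the eigenvalues.\<close>

private lemma G_Suc: "G j = G (Suc j) + fps_const \<alpha> * fps_X * \<Gamma> (Suc j)"
proof -
  have "fps_const (\<alpha> * real (Suc j) - real (tail B (Suc j))) = fps_const (\<alpha> * real j - real (tail B (Suc j))) + fps_const \<alpha>"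
    by (simp add: algebra_simps)
  then show ?thesis unfolding G_def[of j] \<Gamma>_mult[symmetric]
    by (simp only: algebra_simps)
qed

text \<open>The multiplicative relation: consecutive \<open>G\<close> have an explicit quotient,
  which gives a second evaluation of \<open>G 0\<close>.\<close>

private lemma G_prod:
  "G 0 * (\<Prod>j<n. 1 - fps_const (\<alpha> * real (Suc j) - real (tail B (Suc j))) * fps_X) =
   G n * (\<Prod>j<n. 1 - fps_const (\<alpha> * real j - real (tail B (Suc j))) * fps_X)"
proof (induction n)
  case (Suc n)
  let ?p = "1 - fps_const (\<alpha> * real (Suc n) - real (tail B (Suc n))) * fps_X"
  let ?q = "1 - fps_const (\<alpha> * real n - real (tail B (Suc n))) * fps_X"
  let ?B = "\<Prod>j<n. 1 - fps_const (\<alpha> * real j - real (tail B (Suc j))) * fps_X"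
  have step: "G n * ?p = G (Suc n) * ?q"
    unfolding G_def[of n] \<Gamma>_mult[symmetric] by (simp only: mult_ac)
  have "G 0 * (\<Prod>j<Suc n. 1 - fps_const (\<alpha> * real (Suc j) - real (tail B (Suc j))) * fps_X) =
      (G 0 * (\<Prod>j<n. 1 - fps_const (\<alpha> * real (Suc j) - real (tail B (Suc j))) * fps_X)) * ?p"
    by (simp only: prod.lessThan_Suc mult.assoc)
  also have "\<dots> = (G n * ?p) * ?B" unfolding Suc.IH by (simp only: mult_ac)
  also have "\<dots> = G (Suc n) * (?B * ?q)" unfolding step by (simp only: mult_ac)
  finally show ?case by (simp only: prod.lessThan_Suc)
qed simp

private lemma G_0:
  assumes "sum_mset B \<le> n"
  shows "G 0 = 1 - fps_X ^ 2 * Abs_fps (\<lambda>l. eig \<alpha> l B)" and "G n = 1 - fps_const (\<alpha> * real n) * fps_X"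
proof -
  have big: "\<not> Suc n \<le> b" if "b \<in># B" for b
    using that assms by (metis le_trans not_less_eq_eq sum_mset.remove le_add1)
  have "(\<Sum>b\<in>#B. if Suc n \<le> b then F b else 0) = (\<Sum>b\<in>#B. 0)"
    by (intro arg_cong[where f = sum_mset] image_mset_cong) (simp add: big)
  then show Gn: "G n = 1 - fps_const (\<alpha> * real n) * fps_X"
    using tail_eq_0[of B "Suc n"] assms by (simp add: G_def \<Gamma>_def)
  have "G 0 = G m + fps_const \<alpha> * fps_X * (\<Sum>j<m. \<Gamma> (Suc j))" for m
  proof (induction m)
    case (Suc m)
    then show ?case by (subst (asm) G_Suc[of m]) (simp add: algebra_simps)
  qed simp
  then have "G 0 = 1 - fps_const (\<alpha> * real n) * fps_X + fps_const \<alpha> * fps_X * (\<Sum>j<n. \<Gamma> (Suc j))"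
    by (simp add: Gn[symmetric])
  also have "(\<Sum>j<n. \<Gamma> (Suc j)) = fps_const (real n) - fps_X * (\<Sum>j<n. \<Sum>b\<in>#B. if Suc j \<le> b then F b else 0)"
    by (simp add: \<Gamma>_def sum_subtractf sum_distrib_left fps_of_nat)
  also have "(\<Sum>j<n. \<Sum>b\<in>#X. if Suc j \<le> b then F b else 0) = (\<Sum>b\<in>#X. fps_const (real b) * F b)"
    if "sum_mset X \<le> n" for X
    using that
  proof (induction X)
    case (add b X)
    have "(\<Sum>j<n. if Suc j \<le> b then F b else 0) = (\<Sum>j\<in>{..<n} \<inter> {j. Suc j \<le> b}. F b)"
      by (simp add: sum.If_cases)
    also have "{..<n} \<inter> {j. Suc j \<le> b} = {..<b}" using add.prems by auto
    finally show ?case using add by (simp add: sum.distrib fps_of_nat)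
  qed simp
  from this[OF assms] have "(\<Sum>j<n. \<Sum>b\<in>#B. if Suc j \<le> b then F b else 0) = (\<Sum>b\<in>#B. fps_const (real b) * F b)" .
  also have "fps_const \<alpha> * (\<Sum>b\<in>#B. fps_const (real b) * F b) = Abs_fps (\<lambda>l. eig \<alpha> l B)"
  proof (rule fps_ext)
    have "fps_nth (\<Sum>b\<in>#X. fps_const (real b) * F b) l = (\<Sum>b\<in>#X. real b * part_eig \<alpha> B l b)" for X l
      by (induction X) (auto simp: F_def)
    then show "fps_nth (fps_const \<alpha> * (\<Sum>b\<in>#B. fps_const (real b) * F b)) l = fps_nth (Abs_fps (\<lambda>l. eig \<alpha> l B)) l" for l
      by (simp add: eig_def)
  qed
  ultimately show "G 0 = 1 - fps_X ^ 2 * Abs_fps (\<lambda>l. eig \<alpha> l B)"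
    by (simp add: algebra_simps power2_eq_square)
qed

text \<open>Equating the two evaluations of \<open>G 0\<close> shows that the eigenvalues determine
  a rational function built from the numbers
  \<open>\<alpha> * real (Suc j) - real (tail B (Suc j))\<close>, which encode the conjugate
  partition.\<close>

lemma eig_generating_function:
  assumes "sum_mset B \<le> n"
  shows "(1 - fps_X ^ 2 * Abs_fps (\<lambda>l. eig \<alpha> l B)) *
      fps_of_poly (\<Prod>j<n. [:1, - (\<alpha> * real (Suc j) - real (tail B (Suc j))):]) =
    (1 - fps_const (\<alpha> * real n) * fps_X) *
      fps_of_poly (\<Prod>j<n. [:1, - (\<alpha> * real (Suc j) - real (tail B (Suc j)) - \<alpha>):])"
proof -
  have "\<alpha> * real (Suc j) - real (tail B (Suc j)) - \<alpha> = \<alpha> * real j - real (tail B (Suc j))" for j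
    by (simp add: algebra_simps)
  then show ?thesis
    using G_prod[of n] unfolding G_0[OF assms] fps_of_poly_prod fps_of_poly_one_minus by (simp only:)
qed

end

text \<open>
  The hypothesis says that the quotient of the monic polynomials with roots \<open>s\<close> and \<open>s'\<close> has
  period \<open>\<alpha>\<close>; since it tends to 1 at infinity, it is constant.
\<close>

lemma shift_invariant_roots:
  fixes s s' :: "nat \<Rightarrow> real" and \<alpha> :: real
  assumes "\<alpha> > 0"
    and eq: "(\<Prod>j<n. [:1, - (s j - \<alpha>):]) * (\<Prod>j<n. [:1, - s' j:]) = (\<Prod>j<n. [:1, - (s' j - \<alpha>):]) * (\<Prod>j<n. [:1, - s j:])"
  shows "s ` {..<n} = s' ` {..<n}"
proof -
  define P where "P s z = (\<Prod>j<n. z - s j)" for s :: "nat \<Rightarrow> real" and z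
  define m where "m = Max (insert 1 (s ` {..<n} \<union> s' ` {..<n}))"
  have m: "m \<ge> 1" "\<And>j. j < n \<Longrightarrow> s j \<le> m" "\<And>j. j < n \<Longrightarrow> s' j \<le> m" by (auto simp: m_def intro!: Max_ge)
  have poly: "poly (\<Prod>j<n. [:1, - t j:]) (1 / z) = P t z / z ^ n" if "z > 0" for t z
  proof -
    have "(\<Prod>j<n. 1 - t j / z) = (\<Prod>j<n. (z - t j) / z)"
      using that by (intro prod.cong) (simp_all add: diff_divide_distrib)
    then show ?thesis by (simp add: poly_prod P_def prod_dividef)
  qed
  have shift: "P (\<lambda>j. t j - \<alpha>) z = P t (z + \<alpha>)" for t z
    by (simp add: P_def algebra_simps)
  have rel: "P s (z + \<alpha>) * P s' z = P s' (z + \<alpha>) * P s z" if "z > 0" for z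
  proof -
    \<comment> \<open>Evaluation at 1/z turns a factor 1 - t x into (z - t) / z.\<close>
    have "P (\<lambda>j. s j - \<alpha>) z / z ^ n * (P s' z / z ^ n) = P (\<lambda>j. s' j - \<alpha>) z / z ^ n * (P s z / z ^ n)"
      using arg_cong[OF eq, of "\<lambda>p. poly p (1 / z)"] poly[OF that] by (simp only: poly_mult)
    then show ?thesis using that by (simp add: shift)
  qed
  \<comment> \<open>Beyond \<open>m\<close> neither polynomial vanishes, so their quotient can be
    followed along z, z + \<alpha>, z + 2 \<alpha> and so on.\<close>
  have nz: "P t z \<noteq> 0" if "z > m" "t = s \<or> t = s'" for t z
    using that m by (force simp: P_def)
  have ratio: "P s (z + real k * \<alpha>) / P s' (z + real k * \<alpha>) = P s z / P s' z" if "z > m" for z k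
  proof (induction k)
    case (Suc k)
    let ?z = "z + real k * \<alpha>"
    have z: "?z > m" "?z > 0" "?z + \<alpha> > m"
    proof -
      have "real k * \<alpha> \<ge> 0" using \<open>\<alpha> > 0\<close> by simp
      then show "?z > m" "?z > 0" "?z + \<alpha> > m" using that \<open>\<alpha> > 0\<close> m(1) by linarith+
    qed
    have "P s (?z + \<alpha>) / P s' (?z + \<alpha>) = P s ?z / P s' ?z"
      using rel[OF z(2)] nz[OF z(1)] nz[OF z(3)] by (simp add: field_simps)
    then show ?case using Suc by (simp add: algebra_simps)
  qed simp
  have lim: "((\<lambda>z. P s z / P s' z) \<longlongrightarrow> 1) at_top"
  proof -
    have "((\<lambda>z. (z - a) / (z - b)) \<longlongrightarrow> 1) at_top" for a b :: real by real_asymp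
    then have "((\<lambda>z. \<Prod>j<n. (z - s j) / (z - s' j)) \<longlongrightarrow> (\<Prod>j<n. 1)) at_top" by (intro tendsto_prod)
    then show ?thesis by (simp add: P_def prod_dividef)
  qed
  have agree: "P s z = P s' z" if "z > m" for z
  proof -
    have "filterlim (\<lambda>k. z + real k * \<alpha>) at_top sequentially" using \<open>\<alpha> > 0\<close> by real_asymp
    from filterlim_compose[OF lim this] have "(\<lambda>k. P s z / P s' z) \<longlonglongrightarrow> 1" by (simp add: ratio[OF that])
    then have "P s z / P s' z = 1" by (simp add: LIMSEQ_const_iff)
    then show ?thesis using nz[OF that] by (simp add: field_simps)
  qed
  define pol where "pol t = (\<Prod>j<n. [:- t j, 1:])" for t :: "nat \<Rightarrow> real"
  have pol: "poly (pol t) z = P t z" for t z by (simp add: pol_def P_def poly_prod)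
  have "pol s - pol s' = 0"
  proof (rule ccontr)
    assume "pol s - pol s' \<noteq> 0"
    then have "finite {z. poly (pol s - pol s') z = 0}" by (rule poly_roots_finite)
    moreover have "{m<..} \<subseteq> {z. poly (pol s - pol s') z = 0}" using agree by (auto simp: pol)
    ultimately show False using infinite_Ioi finite_subset by blast
  qed
  moreover have "{z. poly (pol t) z = 0} = t ` {..<n}" for t
    unfolding pol P_def by auto
  ultimately show ?thesis by (metis right_minus_eq)
qed

text \<open>Equal eigenvalues give equal rational functions, and
  \<open>shift_invariant_roots\<close> recovers the set of the numbers \<open>s X j\<close>, hence
  the column lengths.\<close>

theorem eig_separates:
  assumes "\<alpha> > 0" "0 \<notin># A" "0 \<notin># B" "\<And>l. eig \<alpha> l A = eig \<alpha> l B"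
  shows "A = B"
proof -
  define n where "n = max (sum_mset A) (sum_mset B)"
  define s where "s X j = \<alpha> * real (Suc j) - real (tail X (Suc j))" for X j
  let ?p = "\<lambda>X. (\<Prod>j<n. [:1, - s X j:])" and ?q = "\<lambda>X. (\<Prod>j<n. [:1, - (s X j - \<alpha>):])"
  define E where "E = 1 - fps_X ^ 2 * Abs_fps (\<lambda>l. eig \<alpha> l B)"
  define U where "U = 1 - fps_const (\<alpha> * real n) * fps_X"
  have A: "E * fps_of_poly (?p A) = U * fps_of_poly (?q A)" and B: "E * fps_of_poly (?p B) = U * fps_of_poly (?q B)"
    using eig_generating_function[of A n \<alpha>] eig_generating_function[of B n \<alpha>] assms(4)
    by (simp_all add: E_def U_def n_def s_def)
  have "fps_nth U 0 = 1" by (simp add: U_def)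
  then have "U \<noteq> 0" by auto
  \<comment> \<open>Cross multiplication eliminates \<open>E\<close>, the only place where the
    eigenvalues occur.\<close>
  moreover have "U * fps_of_poly (?q A * ?p B) = U * fps_of_poly (?q B * ?p A)"
    using A B by (metis (no_types, lifting) fps_of_poly_mult mult.assoc mult.left_commute mult.commute)
  ultimately have "?q A * ?p B = ?q B * ?p A" by simp
  from shift_invariant_roots[OF assms(1) this] have im: "s A ` {..<n} = s B ` {..<n}" .
  \<comment> \<open>Column lengths weakly decrease, so these numbers strictly increase, and their
    set determines the sequence.\<close>
  have mono: "strict_mono (s X)" for X
    unfolding strict_mono_Suc_iff
  proof
    fix j
    show "s X j < s X (Suc j)" using assms(1) tail_Suc[of X "Suc j"] by (simp add: s_def algebra_simps)
  qed
  have sorted: "sorted (map (s X) [0..<n])" "distinct (map (s X) [0..<n])" for X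
    using strict_mono_mono[OF mono[of X]] strict_mono_imp_inj_on[OF mono[of X]]
    by (auto simp: distinct_map sorted_iff_nth_mono monoD intro: inj_on_subset)
  have "map (s A) [0..<n] = map (s B) [0..<n]"
    using im by (intro sorted_distinct_set_unique sorted) (simp add: atLeast0LessThan)
  then have "s A j = s B j" if "j < n" for j using that by simp
  then have t: "tail A (Suc j) = tail B (Suc j)" for j
    using tail_eq_0[of A "Suc j"] tail_eq_0[of B "Suc j"] by (cases "j < n") (auto simp: s_def n_def)
  show ?thesis
  proof (rule multiset_eqI)
    fix c show "count A c = count B c"
    proof (cases c)
      case 0 then show ?thesis using assms(2,3) by (simp add: not_in_iff)
    next
      case (Suc j) then show ?thesis using tail_Suc[of A c] tail_Suc[of B c] t[of j] t[of c] by simp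
    qed
  qed
qed

lemma jackP_orthogonal:
  assumes "\<alpha> > 0" "0 \<notin># A" "0 \<notin># B" "A \<noteq> B"
  shows "jack_inner \<alpha> (jackP \<alpha> A) (jackP \<alpha> B) = 0"
proof -
  obtain l where l: "eig \<alpha> l A \<noteq> eig \<alpha> l B" using eig_separates[OF assms(1-3)] assms(4) by blast
  have "eig \<alpha> l A * jack_inner \<alpha> (jackP \<alpha> A) (jackP \<alpha> B) = eig \<alpha> l B * jack_inner \<alpha> (jackP \<alpha> A) (jackP \<alpha> B)"
    using ham_adjoint[of \<alpha> l "jackP \<alpha> A" "jackP \<alpha> B"]
    by (simp add: ham_jackP assms jack_inner_form form_linear)
  then show ?thesis using l by simp
qed

section \<open>Positivity of the monomial coefficients\<close>

definition exch :: "nat \<Rightarrow> nat \<Rightarrow> nat multiset \<Rightarrow> sym" where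
  "exch c b C = (\<Sum>i\<in>{1..<c}. symaug (add_mset (c + b - i) (add_mset i C))) -
     (\<Sum>i\<in>{1..<b}. symaug (add_mset (c + b - i) (add_mset i C)))"

lemma wclose_wexch:
  assumes "c > 0" "0 \<notin># C" shows "wclose (wexch (c - 1) b C) = exch c b C"
proof -
  obtain k where c: "c = Suc k" using assms(1) by (cases c) auto
  have *: "wclose (waug (k + b - i) (add_mset i C)) = symaug (add_mset (c + b - i) (add_mset i C))"
    if "0 < i" "i < c \<or> i < b" for i
  proof -
    have "k + b - i + 1 = c + b - i" using that c by auto
    then show ?thesis using wclose_waug[of "add_mset i C" "k + b - i"] that assms by simp
  qed
  have "(\<Sum>i\<in>{1..k}. wclose (waug (k + b - i) (add_mset i C))) = (\<Sum>i\<in>{1..<c}. symaug (add_mset (c + b - i) (add_mset i C)))"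
    by (rule sum.cong) (use * c in auto)
  moreover have "(\<Sum>i\<in>{1..<b}. wclose (waug (k + b - i) (add_mset i C))) = (\<Sum>i\<in>{1..<b}. symaug (add_mset (c + b - i) (add_mset i C)))"
    by (rule sum.cong[OF refl], rule *) auto
  ultimately show ?thesis
    by (simp only: wexch_def exch_def linear_diff[OF linear_wclose] linear_sum[OF linear_wclose] c diff_Suc_1)
qed

lemma wclose_wsplit:
  assumes "c > 0" "0 \<notin># C"
  shows "wclose (wsplit (c - 1) C) = (\<Sum>i\<in>{1..<c}. symaug (add_mset (c - i) (add_mset i C)))"
proof -
  have "wclose (waug (c - 1 - i) (add_mset i C)) = symaug (add_mset (c - i) (add_mset i C))"
    if "i \<in> {1..c - 1}" for i
  proof -
    have "c - 1 - i + 1 = c - i" using that by auto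
    then show ?thesis using wclose_waug[of "add_mset i C" "c - 1 - i"] that assms by simp
  qed
  moreover have "{1..c - 1} = {1..<c}" using assms by auto
  ultimately show ?thesis
    by (simp only: wsplit_def linear_sum[OF linear_wclose] cong: sum.cong)
qed

lemma exch_antisym: "exch b c C = - exch c b C"
  by (simp add: exch_def add.commute)

text \<open>\<open>exch c b\<close> is a sum over \<open>min c b \<le> i < max c b\<close> taken
  with the sign of \<open>c - b\<close>, so the product has nonnegative coefficients. Its end
  \<open>i = min c b\<close> is the diagonal term.\<close>

lemma exch_scaled:
  assumes "c > 0" "b > 0"
  shows "(real c - real b) *\<^sub>R exch c b C = \<bar>real c - real b\<bar> *\<^sub>R symaug (add_mset c (add_mset b C)) +
    \<bar>real c - real b\<bar> *\<^sub>R (\<Sum>i\<in>{min c b<..<max c b}. symaug (add_mset (c + b - i) (add_mset i C)))"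
    (is "?l c b = ?r c b")
proof -
  have 1: "?l c b = ?r c b" if "b < c" "b > 0" for c b
  proof -
    let ?h = "\<lambda>i. symaug (add_mset (c + b - i) (add_mset i C))"
    have "(\<Sum>i\<in>{1..<c}. ?h i) = (\<Sum>i\<in>{1..<b}. ?h i) + (\<Sum>i\<in>{b..<c}. ?h i)"
      using that by (intro sum.atLeastLessThan_concat[symmetric]) auto
    also have "(\<Sum>i\<in>{b..<c}. ?h i) = ?h b + (\<Sum>i\<in>{Suc b..<c}. ?h i)"
      using that by (intro sum.atLeast_Suc_lessThan) auto
    also have "{Suc b..<c} = {min c b<..<max c b}" using that by auto
    finally have "exch c b C = symaug (add_mset c (add_mset b C)) + (\<Sum>i\<in>{min c b<..<max c b}. ?h i)"
      by (simp add: exch_def)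
    then show ?thesis using that by (simp add: scaleR_add_right)
  qed
  consider "c = b" | "b < c" | "c < b" by linarith
  then show ?thesis
  proof cases
    case 3
    then have "?l b c = ?r b c" using assms by (intro 1)
    moreover have "?l c b = ?l b c"
      unfolding exch_antisym[of c b] by (simp add: algebra_simps)
    moreover have "?r c b = ?r b c"
      by (simp add: add_mset_commute add.commute min.commute max.commute abs_minus_commute)
    ultimately show ?thesis by (simp only:)
  qed (use assms 1 in auto)
qed

text \<open>The off-diagonal part of \<open>ham \<alpha> 1\<close>; its independence of \<open>\<alpha>\<close>, up to a factor \<open>\<alpha>\<close>, is
  what makes the limit \<open>\<alpha> \<rightarrow> \<infinity>\<close> work.\<close>

definition hamX :: "nat multiset \<Rightarrow> sym" where
  "hamX A = (\<Sum>c\<in>#A. real c *\<^sub>R (\<Sum>i\<in>{1..<c}. symaug (add_mset (c - i) (add_mset i (A - {#c#}))))) +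
    (1/2) *\<^sub>R (\<Sum>c\<in>#A. \<Sum>b\<in>#A - {#c#}. \<bar>real c - real b\<bar> *\<^sub>R
      (\<Sum>i\<in>{min c b<..<max c b}. symaug (add_mset (c + b - i) (add_mset i (A - {#c#} - {#b#})))))"

text \<open>The eigenvalue of \<open>ham \<alpha> 1\<close> divided by \<alpha>. The double sum is
  the sum of the squared column lengths.\<close>

definition energy :: "real \<Rightarrow> nat multiset \<Rightarrow> real" where
  "energy \<alpha> A = \<alpha> * real (\<Sum>c\<in>#A. c\<^sup>2) - real (\<Sum>s\<in>#A. \<Sum>t\<in>#A. min s t)"

text \<open>Rests on |c - b| = c + b - 2 min(c, b).\<close>

lemma energy_eq:
  "(\<Sum>c\<in>#A. real c * (\<alpha> * real c - real (size A))) + (\<Sum>c\<in>#A. \<Sum>b\<in>#A - {#c#}. \<bar>real c - real b\<bar>) / 2 = energy \<alpha> A"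
proof -
  have e: "(\<Sum>b\<in>#A - {#c#}. \<bar>real c - real b\<bar>) = (\<Sum>b\<in>#A. \<bar>real c - real b\<bar>)" if c: "c \<in># A" for c
    by (subst (2) insert_DiffM[OF c, symmetric]) simp
  have "(\<Sum>c\<in>#A. \<Sum>b\<in>#A - {#c#}. \<bar>real c - real b\<bar>) = (\<Sum>c\<in>#A. \<Sum>b\<in>#A. \<bar>real c - real b\<bar>)"
    by (rule arg_cong[where f = sum_mset], rule image_mset_cong, erule e)
  also have "\<dots> = (\<Sum>c\<in>#A. \<Sum>b\<in>#A. real c + real b - 2 * real (min c b))"
    by (intro arg_cong[where f = sum_mset] image_mset_cong) (auto simp: min_def)
  also have "\<dots> = 2 * real (size A) * (\<Sum>c\<in>#A. real c) - 2 * (\<Sum>s\<in>#A. \<Sum>t\<in>#A. real (min s t))"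
  proof -
    have const: "(\<Sum>c\<in>#X. z) = real (size X) * z" for X :: "nat multiset" and z :: real
      by (induction X) (auto simp: algebra_simps)
    have "(\<Sum>c\<in>#A. \<Sum>b\<in>#A. real c + real b - 2 * real (min c b)) =
        (\<Sum>c\<in>#A. real (size A) * real c + (\<Sum>b\<in>#A. real b) - 2 * (\<Sum>b\<in>#A. real (min c b)))"
      by (simp only: sum_mset_subtractf sum_mset.distrib const sum_mset_distrib_left)
    also have "\<dots> = real (size A) * (\<Sum>c\<in>#A. real c) + real (size A) * (\<Sum>b\<in>#A. real b) -
        2 * (\<Sum>c\<in>#A. \<Sum>b\<in>#A. real (min c b))"
      by (simp only: sum_mset_subtractf sum_mset.distrib const sum_mset_distrib_left)
    finally show ?thesis by simp
  qed
  finally have *: "(\<Sum>c\<in>#A. \<Sum>b\<in>#A - {#c#}. \<bar>real c - real b\<bar>) =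
      2 * real (size A) * (\<Sum>c\<in>#A. real c) - 2 * (\<Sum>s\<in>#A. \<Sum>t\<in>#A. real (min s t))" .
  have "(\<Sum>c\<in>#X. real c * (\<alpha> * real c - r)) = \<alpha> * (\<Sum>c\<in>#X. (real c)\<^sup>2) - r * (\<Sum>c\<in>#X. real c)" for X r
    by (induction X) (auto simp: algebra_simps power2_eq_square)
  then show ?thesis unfolding * by (simp add: energy_def multiset.map_comp o_def diff_divide_distrib)
qed

lemma ham_1_symaug:
  assumes "0 \<notin># A"
  shows "ham \<alpha> 1 (symaug A) = \<alpha> *\<^sub>R (energy \<alpha> A *\<^sub>R symaug A + hamX A)"
proof -
  let ?S = "\<lambda>c. \<Sum>i\<in>{1..<c}. symaug (add_mset (c - i) (add_mset i (A - {#c#})))"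
  let ?I = "\<lambda>c b. \<Sum>i\<in>{min c b<..<max c b}. symaug (add_mset (c + b - i) (add_mset i (A - {#c#} - {#b#})))"
  have trm: "wclose (lax \<alpha> (waug (c - 1) (A - {#c#}))) =
      (\<alpha> * real c - real (size A)) *\<^sub>R symaug A + ?S c + (\<Sum>b\<in>#A - {#c#}. exch c b (A - {#c#} - {#b#}))"
    if c: "c \<in># A" for c
  proof -
    have c0: "c > 0" "0 \<notin># A - {#c#}" using c assms by (metis not_gr0, metis in_diffD)
    have C0: "0 \<notin># A - {#c#} - {#b#}" for b using c0 by (metis in_diffD)
    have "(\<Sum>b\<in>#A - {#c#}. wclose (wexch (c - 1) b (A - {#c#} - {#b#}))) = (\<Sum>b\<in>#A - {#c#}. exch c b (A - {#c#} - {#b#}))"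
      by (intro arg_cong[where f = sum_mset] image_mset_cong wclose_wexch c0 C0)
    moreover have "\<alpha> * real (c - 1 + 1) - 1 - real (size (A - {#c#})) = \<alpha> * real c - real (size A)"
      using c c0 size_Suc_Diff1[OF c] by simp
    moreover have "wclose (waug (c - 1) (A - {#c#})) = symaug A"
      using wclose_waug[OF c0(2), of "c - 1"] c c0 by simp
    ultimately show ?thesis
      unfolding lax_waug[OF c0(2)] linear_add[OF linear_wclose] linear_scale[OF linear_wclose]
        linear_sum_mset[OF linear_wclose] wclose_wsplit[OF c0] by simp
  qed
  \<comment> \<open>\<open>exch\<close> is antisymmetric in the pair, so averaging over its two
    orders replaces the weight \<open>c\<close> by (c - b) / 2.\<close>
  have sym: "2 *\<^sub>R (\<Sum>c\<in>#A. real c *\<^sub>R (\<Sum>b\<in>#A - {#c#}. exch c b (A - {#c#} - {#b#}))) =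
      (\<Sum>c\<in>#A. \<Sum>b\<in>#A - {#c#}. \<bar>real c - real b\<bar>) *\<^sub>R symaug A +
      (\<Sum>c\<in>#A. \<Sum>b\<in>#A - {#c#}. \<bar>real c - real b\<bar> *\<^sub>R ?I c b)"
  proof -
    let ?T = "\<Sum>c\<in>#A. \<Sum>b\<in>#A - {#c#}. real c *\<^sub>R exch c b (A - {#c#} - {#b#})"
    let ?T' = "\<Sum>c\<in>#A. \<Sum>b\<in>#A - {#c#}. real b *\<^sub>R exch c b (A - {#c#} - {#b#})"
    have neg: "(\<Sum>x\<in>#X. - f x) = - (\<Sum>x\<in>#X. f x)" for X :: "nat multiset" and f :: "nat \<Rightarrow> sym"
      by (induction X) simp_all
    have "?T = (\<Sum>c\<in>#A. \<Sum>b\<in>#A - {#c#}. - (real b *\<^sub>R exch c b (A - {#c#} - {#b#})))"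
      unfolding sum_mset_pick_swap[of "\<lambda>c b X. real c *\<^sub>R exch c b X"]
      by (intro arg_cong[where f = sum_mset] image_mset_cong) (subst exch_antisym, simp)
    then have "?T = - ?T'" by (simp only: neg)
    moreover have "?T - ?T' = (\<Sum>c\<in>#A. \<Sum>b\<in>#A - {#c#}. (real c - real b) *\<^sub>R exch c b (A - {#c#} - {#b#}))"
      by (simp only: scaleR_diff_left sum_mset_subtractf)
    ultimately have "?T + ?T = (\<Sum>c\<in>#A. \<Sum>b\<in>#A - {#c#}. (real c - real b) *\<^sub>R exch c b (A - {#c#} - {#b#}))"
      by (simp only: add_uminus_conv_diff)
    also have "\<dots> = (\<Sum>c\<in>#A. \<Sum>b\<in>#A - {#c#}. \<bar>real c - real b\<bar> *\<^sub>R symaug A + \<bar>real c - real b\<bar> *\<^sub>R ?I c b)"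
    proof (intro arg_cong[where f = sum_mset] image_mset_cong)
      fix c b assume cb: "c \<in># A" "b \<in># A - {#c#}"
      then have "c > 0" "b > 0" using assms by (metis not_gr0, metis in_diffD not_gr0)
      moreover have "add_mset c (add_mset b (A - {#c#} - {#b#})) = A" using cb by (metis insert_DiffM)
      ultimately show "(real c - real b) *\<^sub>R exch c b (A - {#c#} - {#b#}) =
          \<bar>real c - real b\<bar> *\<^sub>R symaug A + \<bar>real c - real b\<bar> *\<^sub>R ?I c b"
        using exch_scaled[of c b "A - {#c#} - {#b#}"] by (simp only:)
    qed
    finally show ?thesis
      by (simp only: scaleR_2 scaleR_sum_mset sum_mset.distrib linear_sum_mset[OF linear_scaleR_left])
  qed
  have "ham \<alpha> 1 (symaug A) = (\<Sum>c\<in>#A. (\<alpha> * real c) *\<^sub>R wclose (lax \<alpha> (waug (c - 1) (A - {#c#}))))"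
    by (simp add: ham_def wopen_symaug[OF assms] linear_sum_mset[OF linear_lax] linear_sum_mset[OF linear_wclose]
        linear_scale[OF linear_lax] linear_scale[OF linear_wclose])
  also have "\<dots> = (\<Sum>c\<in>#A. \<alpha> *\<^sub>R ((real c * (\<alpha> * real c - real (size A))) *\<^sub>R symaug A + real c *\<^sub>R ?S c +
      real c *\<^sub>R (\<Sum>b\<in>#A - {#c#}. exch c b (A - {#c#} - {#b#}))))"
    by (intro arg_cong[where f = sum_mset] image_mset_cong) (simp only: trm, simp add: scaleR_add_right)
  also have "\<dots> = \<alpha> *\<^sub>R ((\<Sum>c\<in>#A. real c * (\<alpha> * real c - real (size A))) *\<^sub>R symaug A + (\<Sum>c\<in>#A. real c *\<^sub>R ?S c) +
      (1/2) *\<^sub>R (2 *\<^sub>R (\<Sum>c\<in>#A. real c *\<^sub>R (\<Sum>b\<in>#A - {#c#}. exch c b (A - {#c#} - {#b#})))))"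
    by (simp add: scaleR_sum_mset[symmetric] sum_mset.distrib linear_sum_mset[OF linear_scaleR_left])
  also have "\<dots> = \<alpha> *\<^sub>R (energy \<alpha> A *\<^sub>R symaug A + hamX A)"
    unfolding sym energy_eq[symmetric] hamX_def by (simp add: scaleR_add_right scaleR_add_left)
  finally show ?thesis .
qed

section \<open>Nonnegative combinations of lower terms and the coefficient recursion\<close>

lemma finite_dless: "finite {A. dless A B}"
  by (rule finite_subset[OF _ finite_dle[of B]]) (auto simp: dless_def)

definition cone :: "nat multiset \<Rightarrow> sym set" where
  "cone A = {\<Sum>\<nu> | dless \<nu> A. C \<nu> *\<^sub>R symaug \<nu> | C. \<forall>\<nu>. C \<nu> \<ge> 0}"

lemma cone_0: "0 \<in> cone A"
  unfolding cone_def by (auto intro!: exI[of _ "\<lambda>_. 0"])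

lemma cone_add:
  assumes "x \<in> cone A" "y \<in> cone A" shows "x + y \<in> cone A"
proof -
  obtain C D where "\<forall>\<nu>. C \<nu> \<ge> 0" "x = (\<Sum>\<nu> | dless \<nu> A. C \<nu> *\<^sub>R symaug \<nu>)"
    "\<forall>\<nu>. D \<nu> \<ge> 0" "y = (\<Sum>\<nu> | dless \<nu> A. D \<nu> *\<^sub>R symaug \<nu>)"
    using assms unfolding cone_def by blast
  then show ?thesis unfolding cone_def
    by (auto intro!: exI[of _ "\<lambda>\<nu>. C \<nu> + D \<nu>"] simp: scaleR_add_left sum.distrib)
qed

lemma cone_scale:
  assumes "x \<in> cone A" "r \<ge> 0" shows "r *\<^sub>R x \<in> cone A"
proof -
  obtain C where "\<forall>\<nu>. C \<nu> \<ge> 0" "x = (\<Sum>\<nu> | dless \<nu> A. C \<nu> *\<^sub>R symaug \<nu>)"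
    using assms unfolding cone_def by blast
  then show ?thesis using assms(2) unfolding cone_def
    by (auto intro!: exI[of _ "\<lambda>\<nu>. r * C \<nu>"] simp: scaleR_sum_right)
qed

lemma cone_sum: "(\<And>i. i \<in> I \<Longrightarrow> f i \<in> cone A) \<Longrightarrow> (\<Sum>i\<in>I. f i) \<in> cone A"
  by (induction I rule: infinite_finite_induct) (auto intro: cone_0 cone_add)

lemma cone_sum_mset: "(\<And>i. i \<in># I \<Longrightarrow> f i \<in> cone A) \<Longrightarrow> (\<Sum>i\<in>#I. f i) \<in> cone A"
  by (induction I) (auto intro: cone_0 cone_add)

lemma symaug_cone: "dless \<nu> A \<Longrightarrow> symaug \<nu> \<in> cone A"
  unfolding cone_def using finite_dless
  by (auto intro!: exI[of _ "\<lambda>\<mu>. if \<mu> = \<nu> then 1 else 0"] simp: if_distrib[of "\<lambda>x. x *\<^sub>R _"] cong: if_cong)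

text \<open>For the second claim: cutting a 1 off the part \<open>c\<close> has coefficient at least
  \<open>c\<close>, so one copy can be removed without leaving the cone.\<close>

lemma hamX_cone:
  assumes "0 \<notin># A"
  shows "hamX A \<in> cone A"
    and "c \<in># A \<Longrightarrow> c > 1 \<Longrightarrow> hamX A - symaug (add_mset (c - 1) (add_mset 1 (A - {#c#}))) \<in> cone A"
proof -
  let ?S = "\<lambda>c. \<Sum>i\<in>{1..<c}. symaug (add_mset (c - i) (add_mset i (A - {#c#})))"
  let ?I = "\<lambda>c b. \<Sum>i\<in>{min c b<..<max c b}. symaug (add_mset (c + b - i) (add_mset i (A - {#c#} - {#b#})))"
  let ?Q = "\<Sum>c\<in>#A. \<Sum>b\<in>#A - {#c#}. \<bar>real c - real b\<bar> *\<^sub>R ?I c b"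
  have S: "symaug (add_mset (c - i) (add_mset i (A - {#c#}))) \<in> cone A" if "c \<in># A" "i \<in> {1..<c}" for c i
  proof -
    have "dless (add_mset (c - i) (add_mset i (A - {#c#}))) (add_mset c (A - {#c#}))"
      using that assms by (intro dless_split) (auto dest: in_diffD)
    then show ?thesis using that by (intro symaug_cone) simp
  qed
  have "?Q \<in> cone A"
  proof (intro cone_sum_mset cone_scale cone_sum symaug_cone)
    fix c b i assume cb: "c \<in># A" "b \<in># A - {#c#}" and i: "i \<in> {min c b<..<max c b}"
    have pos: "c > 0" "b > 0" "0 \<notin># A - {#c#} - {#b#}"
      using cb assms by (metis not_gr0, metis in_diffD not_gr0, metis in_diffD)
    have "dless (add_mset i (add_mset (c + b - i) (A - {#c#} - {#b#}))) (add_mset c (add_mset b (A - {#c#} - {#b#})))"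
    proof (cases "b < c")
      case True then show ?thesis using i pos by (intro dless_squeeze) auto
    next
      case False
      then have "dless (add_mset i (add_mset (c + b - i) (A - {#c#} - {#b#}))) (add_mset b (add_mset c (A - {#c#} - {#b#})))"
        using i pos by (intro dless_squeeze) auto
      then show ?thesis by (simp add: add_mset_commute)
    qed
    moreover have "add_mset c (add_mset b (A - {#c#} - {#b#})) = A" using cb by (metis insert_DiffM)
    ultimately show "dless (add_mset (c + b - i) (add_mset i (A - {#c#} - {#b#}))) A"
      by (simp only: add_mset_commute)
  qed simp
  then have Q: "(1/2) *\<^sub>R ?Q \<in> cone A" by (rule cone_scale) simp
  have S': "real c *\<^sub>R ?S c \<in> cone A" if "c \<in># A" for c
    using S[OF that] by (intro cone_scale cone_sum) auto
  show "hamX A \<in> cone A"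
    unfolding hamX_def by (intro cone_add cone_sum_mset Q S')
  show "hamX A - symaug (add_mset (c - 1) (add_mset 1 (A - {#c#}))) \<in> cone A" if c: "c \<in># A" "c > 1"
  proof -
    let ?s = "symaug (add_mset (c - 1) (add_mset 1 (A - {#c#})))"
    have "?S c = ?s + (\<Sum>i\<in>{2..<c}. symaug (add_mset (c - i) (add_mset i (A - {#c#}))))"
      using c sum.atLeast_Suc_lessThan[of 1 c "\<lambda>i. symaug (add_mset (c - i) (add_mset i (A - {#c#})))"]
      by (simp add: numeral_2_eq_2)
    then have "real c *\<^sub>R ?S c = ?s + ((real c - 1) *\<^sub>R ?s + real c *\<^sub>R (\<Sum>i\<in>{2..<c}. symaug (add_mset (c - i) (add_mset i (A - {#c#})))))"
      by (simp add: scaleR_add_right scaleR_diff_left)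
    moreover have "(\<Sum>c\<in>#A. real c *\<^sub>R ?S c) = real c *\<^sub>R ?S c + (\<Sum>c\<in>#A - {#c#}. real c *\<^sub>R ?S c)"
      using c(1) by (metis (mono_tags, lifting) image_mset_add_mset insert_DiffM sum_mset.insert)
    ultimately have eq: "hamX A - ?s = ((real c - 1) *\<^sub>R ?s + real c *\<^sub>R (\<Sum>i\<in>{2..<c}. symaug (add_mset (c - i) (add_mset i (A - {#c#}))))) +
        (\<Sum>c\<in>#A - {#c#}. real c *\<^sub>R ?S c) + (1/2) *\<^sub>R ?Q"
      unfolding hamX_def by simp
    show ?thesis
      unfolding eq using c S[OF c(1)] S[OF c(1), of 1]
      by (intro cone_add cone_scale cone_sum cone_sum_mset Q S') (auto dest: in_diffD)
  qed
qed

text \<open>The last clause prepares \<open>jackP_ones_pos\<close>: as long as a part exceeds 1, a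
  longer multiset is reached with positive coefficient.\<close>

lemma hamX_coefficients:
  assumes "0 \<notin># A"
  shows "\<exists>C. (\<forall>\<nu>. C \<nu> \<ge> 0) \<and> hamX A = (\<Sum>\<nu> | dless \<nu> A. C \<nu> *\<^sub>R symaug \<nu>) \<and>
    (\<forall>c\<in>#A. c > 1 \<longrightarrow> (\<exists>\<nu>. dless \<nu> A \<and> size \<nu> = Suc (size A) \<and> C \<nu> > 0))"
proof (cases "\<exists>c. c \<in># A \<and> c > 1")
  case True
  then obtain c where c: "c \<in># A" "c > 1" by blast
  define \<mu> where "\<mu> = add_mset (c - 1) (add_mset 1 (A - {#c#}))"
  have \<mu>: "dless \<mu> A" "size \<mu> = Suc (size A)"
  proof -
    have "dless \<mu> (add_mset c (A - {#c#}))" unfolding \<mu>_def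
      using c assms by (intro dless_split) (auto dest: in_diffD)
    then show "dless \<mu> A" using c by simp
    show "size \<mu> = Suc (size A)" using size_Suc_Diff1[OF c(1)] by (simp add: \<mu>_def)
  qed
  obtain C where C: "\<forall>\<nu>. C \<nu> \<ge> 0" "hamX A - symaug \<mu> = (\<Sum>\<nu> | dless \<nu> A. C \<nu> *\<^sub>R symaug \<nu>)"
    using hamX_cone(2)[OF assms c] unfolding \<mu>_def cone_def by blast
  have "hamX A = (\<Sum>\<nu> | dless \<nu> A. (C \<nu> + (if \<nu> = \<mu> then 1 else 0)) *\<^sub>R symaug \<nu>)"
    using C(2) \<mu>(1) finite_dless
    by (simp add: scaleR_add_left sum.distrib if_distrib[of "\<lambda>x. x *\<^sub>R _"] algebra_simps cong: if_cong)
  moreover have "C \<mu> + 1 > 0" using C(1) by (simp add: add_nonneg_pos)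
  ultimately show ?thesis using C(1) \<mu>
    by (intro exI[of _ "\<lambda>\<nu>. C \<nu> + (if \<nu> = \<mu> then 1 else 0)"]) (auto intro!: exI[of _ \<mu>])
next
  case False
  then show ?thesis using hamX_cone(1)[OF assms] unfolding cone_def by blast
qed

definition hcoef :: "nat multiset \<Rightarrow> nat multiset \<Rightarrow> real" where
  "hcoef A = (SOME C. (\<forall>\<nu>. C \<nu> \<ge> 0) \<and> hamX A = (\<Sum>\<nu> | dless \<nu> A. C \<nu> *\<^sub>R symaug \<nu>) \<and>
    (\<forall>c\<in>#A. c > 1 \<longrightarrow> (\<exists>\<nu>. dless \<nu> A \<and> size \<nu> = Suc (size A) \<and> C \<nu> > 0)))"

lemma
  assumes "0 \<notin># A"
  shows hcoef_nonneg: "hcoef A \<nu> \<ge> 0"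
    and hamX_hcoef: "hamX A = (\<Sum>\<nu> | dless \<nu> A. hcoef A \<nu> *\<^sub>R symaug \<nu>)"
    and hcoef_pos: "c \<in># A \<Longrightarrow> c > 1 \<Longrightarrow> \<exists>\<nu>. dless \<nu> A \<and> size \<nu> = Suc (size A) \<and> hcoef A \<nu> > 0"
  using someI_ex[OF hamX_coefficients[OF assms], folded hcoef_def] by blast+

text \<open>Sums of squares are integers, so they differ by at least 1, and the column term only
  helps. The gap makes the recursion solvable with positive denominators and forces decay of order
  1/\<alpha>.\<close>

lemma energy_less:
  assumes "dless A B" "\<alpha> > 0" shows "energy \<alpha> B - energy \<alpha> A \<ge> \<alpha>"
proof -
  let ?q = "\<lambda>A. \<Sum>c\<in>#A. c\<^sup>2" and ?m = "\<lambda>A. \<Sum>s\<in>#A. \<Sum>t\<in>#A. min s t"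
  have "?q A < ?q B" using assms sum_squares_less by (simp add: dless_def)
  then have "real (?q A + 1) \<le> real (?q B)" by (simp only: of_nat_le_iff Suc_eq_plus1[symmetric] Suc_le_eq)
  then have "\<alpha> * real (?q A + 1) \<le> \<alpha> * real (?q B)"
    by (rule mult_left_mono[OF _ less_imp_le[OF assms(2)]])
  moreover have "?m B \<le> ?m A" using assms sum_min_antimono by (simp add: dless_def)
  then have "real (?m B) \<le> real (?m A)" by (simp only: of_nat_le_iff)
  ultimately show ?thesis unfolding energy_def by (simp add: distrib_left)
qed

lemma low_expansion:
  assumes "x \<in> low B" shows "\<exists>c. x = (\<Sum>A | dless A B. c A *\<^sub>R symaug A)"
  using span_image_expansion[OF finite_dless] assms unfolding low_def by blast

theorem jackP_coefficients:
  assumes "\<alpha> > 0" "0 \<notin># B"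
  shows "\<exists>c. jackP \<alpha> B = (\<Sum>A | dle A B. c A *\<^sub>R symaug A) \<and> c B = 1 \<and> (\<forall>A. dle A B \<longrightarrow> c A \<ge> 0) \<and>
    (\<forall>A. dless A B \<longrightarrow> (energy \<alpha> B - energy \<alpha> A) * c A = (\<Sum>\<nu> | dle \<nu> B \<and> dless A \<nu>. c \<nu> * hcoef \<nu> A))"
proof -
  let ?D = "{A. dle A B}"
  have D: "?D = insert B {A. dless A B}" "B \<notin> {A. dless A B}" using dle_refl[OF assms(2)] by (auto simp: dless_def)
  have fin: "finite ?D" "finite {A. dless A B}" by (rule finite_dle finite_dless)+
  have D0: "0 \<notin># A" if "A \<in> ?D" for A using that dle_no_zero by blast
  obtain c0 where c0: "jackP \<alpha> B - symaug B = (\<Sum>A | dless A B. c0 A *\<^sub>R symaug A)"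
    using low_expansion[OF jackP_low[OF assms(1)]] by blast
  define c where "c = c0(B := 1)"
  have "(\<Sum>A\<in>?D. c A *\<^sub>R symaug A) = symaug B + (\<Sum>A | dless A B. c A *\<^sub>R symaug A)"
    unfolding D(1) using fin(2) D(2) by (simp add: c_def)
  also have "(\<Sum>A | dless A B. c A *\<^sub>R symaug A) = (\<Sum>A | dless A B. c0 A *\<^sub>R symaug A)"
    using D(2) by (intro sum.cong) (auto simp: c_def)
  finally have P: "jackP \<alpha> B = (\<Sum>A\<in>?D. c A *\<^sub>R symaug A)" using c0 by (simp add: algebra_simps)
  have cB: "c B = 1" by (simp add: c_def)
  let ?w = "\<lambda>A. \<Sum>\<nu> | dle \<nu> B \<and> dless A \<nu>. c \<nu> * hcoef \<nu> A"
  have "(\<Sum>A\<in>?D. c A *\<^sub>R hamX A) = (\<Sum>\<nu>\<in>?D. \<Sum>A | A \<in> ?D \<and> dless A \<nu>. (c \<nu> * hcoef \<nu> A) *\<^sub>R symaug A)"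
  proof (intro sum.cong)
    fix \<nu> assume \<nu>: "\<nu> \<in> ?D"
    have "{A. dless A \<nu>} = {A. A \<in> ?D \<and> dless A \<nu>}" using \<nu> by (auto intro: dle_trans dless_imp_dle)
    then show "c \<nu> *\<^sub>R hamX \<nu> = (\<Sum>A | A \<in> ?D \<and> dless A \<nu>. (c \<nu> * hcoef \<nu> A) *\<^sub>R symaug A)"
      unfolding hamX_hcoef[OF D0[OF \<nu>]] by (simp add: scaleR_sum_right)
  qed simp
  also have "\<dots> = (\<Sum>A\<in>?D. \<Sum>\<nu> | \<nu> \<in> ?D \<and> dless A \<nu>. (c \<nu> * hcoef \<nu> A) *\<^sub>R symaug A)"
    by (rule sum.swap_restrict[OF fin(1) fin(1)])
  also have "\<dots> = (\<Sum>A\<in>?D. ?w A *\<^sub>R symaug A)" by (simp add: scaleR_sum_left)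
  finally have X: "(\<Sum>A\<in>?D. c A *\<^sub>R hamX A) = (\<Sum>A\<in>?D. ?w A *\<^sub>R symaug A)" .
  have "ham \<alpha> 1 (jackP \<alpha> B) = (\<Sum>A\<in>?D. c A *\<^sub>R ham \<alpha> 1 (symaug A))"
    unfolding P by (simp add: linear_sum[OF linear_ham] linear_scale[OF linear_ham])
  also have "\<dots> = (\<Sum>A\<in>?D. c A *\<^sub>R (\<alpha> *\<^sub>R (energy \<alpha> A *\<^sub>R symaug A + hamX A)))"
    by (rule sum.cong) (use ham_1_symaug[OF D0] in \<open>simp_all only:\<close>)
  also have "\<dots> = (\<Sum>A\<in>?D. (\<alpha> * energy \<alpha> A * c A) *\<^sub>R symaug A) + \<alpha> *\<^sub>R (\<Sum>A\<in>?D. c A *\<^sub>R hamX A)"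
    by (simp add: scaleR_add_right sum.distrib scaleR_sum_right mult_ac)
  also have "\<dots> = (\<Sum>A\<in>?D. (\<alpha> * energy \<alpha> A * c A + \<alpha> * ?w A) *\<^sub>R symaug A)"
    unfolding X by (simp add: scaleR_add_left sum.distrib scaleR_sum_right)
  finally have "(\<Sum>A\<in>?D. (\<alpha> * energy \<alpha> A * c A + \<alpha> * ?w A) *\<^sub>R symaug A) = eig \<alpha> 1 B *\<^sub>R (\<Sum>A\<in>?D. c A *\<^sub>R symaug A)"
    using ham_jackP[OF assms, of 1] P by simp
  then have "(\<Sum>A\<in>?D. (\<alpha> * energy \<alpha> A * c A + \<alpha> * ?w A - eig \<alpha> 1 B * c A) *\<^sub>R symaug A) = 0"
    by (simp add: scaleR_diff_left sum_subtractf scaleR_sum_right)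
  from symaug_independent[OF fin(1) D0 this]
  have eq: "\<alpha> * energy \<alpha> A * c A + \<alpha> * ?w A = eig \<alpha> 1 B * c A" if "dle A B" for A using that by simp
  \<comment> \<open>Nothing in the range lies strictly above \<open>B\<close>, so the coefficient at
    \<open>B\<close> identifies the eigenvalue without evaluating \<open>part_eig\<close>.\<close>
  have "{\<nu>. dle \<nu> B \<and> dless B \<nu>} = {}" by (auto simp: dless_def dest: dle_antisym)
  then have "?w B = 0" by (simp only: sum.empty)
  with eq[OF dle_refl[OF assms(2)]] have eig: "eig \<alpha> 1 B = \<alpha> * energy \<alpha> B" by (simp add: cB)
  have rec: "(energy \<alpha> B - energy \<alpha> A) * c A = ?w A" if "dless A B" for A
  proof -
    have "\<alpha> * ((energy \<alpha> B - energy \<alpha> A) * c A) = \<alpha> * ?w A"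
      using eq[OF dless_imp_dle[OF that]] unfolding eig by (simp add: algebra_simps)
    then show ?thesis using assms(1) by simp
  qed
  have nonneg: "c A \<ge> 0" if "dle A B" for A
    using that
  \<comment> \<open>Downward from \<open>B\<close>: every \<nu> in the recursion for
    \<open>A\<close> lies strictly above \<open>A\<close> and is closer to \<open>B\<close> in the
    sum of squares.\<close>
  proof (induction "(\<Sum>c\<in>#B. c\<^sup>2) - (\<Sum>c\<in>#A. c\<^sup>2)" arbitrary: A rule: less_induct)
    case less
    show ?case
    proof (cases "A = B")
      case False
      then have A: "dless A B" using less.prems by (simp add: dless_def)
      have "?w A \<ge> 0"
      proof (rule sum_nonneg)
        fix \<nu> assume \<nu>: "\<nu> \<in> {\<nu>. dle \<nu> B \<and> dless A \<nu>}"
        have "(\<Sum>c\<in>#A. c\<^sup>2) < (\<Sum>c\<in>#\<nu>. c\<^sup>2)" "(\<Sum>c\<in>#A. c\<^sup>2) < (\<Sum>c\<in>#B. c\<^sup>2)"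
          using \<nu> A sum_squares_less by (auto simp: dless_def)
        then have "c \<nu> \<ge> 0" using \<nu> by (intro less.hyps) auto
        then show "c \<nu> * hcoef \<nu> A \<ge> 0" using \<nu> dle_no_zero by (intro mult_nonneg_nonneg hcoef_nonneg) auto
      qed
      then have "(energy \<alpha> B - energy \<alpha> A) * c A \<ge> 0" using rec[OF A] by simp
      moreover have "energy \<alpha> B - energy \<alpha> A > 0" using energy_less[OF A assms(1)] assms(1) by linarith
      ultimately show ?thesis by (simp add: zero_le_mult_iff)
    qed (simp add: cB)
  qed
  show ?thesis using P cB rec nonneg by (intro exI[of _ c]) simp
qed

section \<open>The coefficient of the highest power of p_1\<close>

lemma size_le_sum_mset: "0 \<notin># A \<Longrightarrow> size A \<le> sum_mset A" for A :: "nat multiset"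
  by (induction A) auto

lemma parts_ones: "parts (ones n) = replicate_mset n 1"
  by (simp add: ones.rep_eq)

lemma eq_replicate_ones:
  fixes A :: "nat multiset"
  assumes "0 \<notin># A" "\<And>c. c \<in># A \<Longrightarrow> c \<le> 1"
  shows "A = replicate_mset (sum_mset A) 1"
proof -
  have "c = 1" if "c \<in># A" for c using assms that by (metis le_less less_one)
  then have A: "A = replicate_mset (size A) 1" by (metis set_mset_subset_singletonD subsetI singletonI)
  then have "sum_mset A = size A" by (metis mult.right_neutral sum_mset_replicate_mset of_nat_id)
  with A show ?thesis by simp
qed

text \<open>No partition of n is longer than \<open>ones n\<close>, so \<open>lookup_symaug\<close>
  applies to every term.\<close>

lemma lookup_ones_expansion:
  assumes "0 \<notin># B"
  shows "Poly_Mapping.lookup (\<Sum>A | dle A B. c A *\<^sub>R symaug A) (ones (sum_mset B)) =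
    (if dle (parts (ones (sum_mset B))) B then c (parts (ones (sum_mset B))) else 0)"
proof -
  let ?o = "ones (sum_mset B)"
  have "Poly_Mapping.lookup (\<Sum>A | dle A B. c A *\<^sub>R symaug A) ?o = (\<Sum>A | dle A B. if parts ?o = A then c A else 0)"
    unfolding lookup_sum
  proof (intro sum.cong refl)
    fix A assume "A \<in> {A. dle A B}"
    then have "0 \<notin># A" "sum_mset A = sum_mset B" by (auto simp: dle_def)
    then have "Poly_Mapping.lookup (symaug A) ?o = (if parts ?o = A then 1 else 0)"
      using size_le_sum_mset[of A] by (intro lookup_symaug) (auto simp: plen_def parts_ones)
    then show "Poly_Mapping.lookup (c A *\<^sub>R symaug A) ?o = (if parts ?o = A then c A else 0)" by simp
  qed
  then show ?thesis using finite_dle[of B] by simp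
qed

text \<open>Among the multisets with positive coefficient take a longest one. A part larger than 1
  in it would, by the recursion and \<open>hcoef_pos\<close>, give a positive coefficient to a
  longer one; hence it consists of ones.\<close>

lemma jackP_ones_pos:
  assumes "\<alpha> > 0" "0 \<notin># B"
  shows "Poly_Mapping.lookup (jackP \<alpha> B) (ones (sum_mset B)) > 0"
proof -
  obtain c where c: "jackP \<alpha> B = (\<Sum>A | dle A B. c A *\<^sub>R symaug A)" "c B = 1" "\<And>A. dle A B \<Longrightarrow> c A \<ge> 0"
    "\<And>A. dless A B \<Longrightarrow> (energy \<alpha> B - energy \<alpha> A) * c A = (\<Sum>\<nu> | dle \<nu> B \<and> dless A \<nu>. c \<nu> * hcoef \<nu> A)"
    using jackP_coefficients[OF assms] by blast
  define S where "S = {A. dle A B \<and> c A > 0}"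
  have S: "finite S" "B \<in> S"
    using finite_dle[of B] c(2) dle_refl[OF assms(2)] by (auto simp: S_def)
  then have "Max (size ` S) \<in> size ` S" by (intro Max_in) auto
  then obtain M where M: "M \<in> S" "size M = Max (size ` S)" by (metis imageE)
  have max: "size A \<le> size M" if "A \<in> S" for A using that S(1) M(2) by auto
  have M0: "0 \<notin># M" "sum_mset M = sum_mset B" "dle M B" "c M > 0" using M(1) by (auto simp: S_def dle_def)
  have "b \<le> 1" if b: "b \<in># M" for b
  proof (rule ccontr)
    assume "\<not> b \<le> 1"
    then obtain \<nu> where \<nu>: "dless \<nu> M" "size \<nu> = Suc (size M)" "hcoef M \<nu> > 0"
      using hcoef_pos[OF M0(1) b] by auto
    have \<nu>B: "dless \<nu> B" using \<nu>(1) M0(3) by (rule dless_trans2)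
    have "0 < c M * hcoef M \<nu>" using M0 \<nu> by simp
    also have "\<dots> \<le> (\<Sum>\<mu> | dle \<mu> B \<and> dless \<nu> \<mu>. c \<mu> * hcoef \<mu> \<nu>)"
    proof (rule member_le_sum)
      show "M \<in> {\<mu>. dle \<mu> B \<and> dless \<nu> \<mu>}" using M0 \<nu> by simp
      show "finite {\<mu>. dle \<mu> B \<and> dless \<nu> \<mu>}" by (rule finite_subset[OF _ finite_dle[of B]]) auto
      fix \<mu> assume "\<mu> \<in> {\<mu>. dle \<mu> B \<and> dless \<nu> \<mu>} - {M}"
      then show "0 \<le> c \<mu> * hcoef \<mu> \<nu>" using c(3) hcoef_nonneg dle_no_zero(1)[of \<mu> B] by auto
    qed
    finally have "(energy \<alpha> B - energy \<alpha> \<nu>) * c \<nu> > 0" by (simp add: c(4)[OF \<nu>B])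
    moreover have "energy \<alpha> B - energy \<alpha> \<nu> > 0" using energy_less[OF \<nu>B assms(1)] assms(1) by linarith
    ultimately have "c \<nu> > 0" by (simp add: zero_less_mult_iff)
    then have "\<nu> \<in> S" using \<nu>B by (simp add: S_def dless_def)
    then show False using max \<nu>(2) by force
  qed
  then have "M = parts (ones (sum_mset B))"
    using eq_replicate_ones[OF M0(1)] M0(2) by (simp add: parts_ones)
  then show ?thesis unfolding c(1) lookup_ones_expansion[OF assms(2)] using M0 by simp
qed

definition jackJ :: "real \<Rightarrow> partition \<Rightarrow> sym" where
  "jackJ \<alpha> \<kappa> = (1 / Poly_Mapping.lookup (jackP \<alpha> (parts \<kappa>)) (ones (psize \<kappa>))) *\<^sub>R jackP \<alpha> (parts \<kappa>)"

section \<open>Dominance of partitions\<close>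

text \<open>Row sums and excesses are dual in the sense of Legendre: the sum of the k largest parts
  is the minimum over x of k x plus the excess at x. This is the inequality.\<close>

lemma sum_list_take_le: "sum_list (take k xs) \<le> k * x + (\<Sum>c\<leftarrow>xs. c - x)" for xs :: "nat list"
proof (induction xs arbitrary: k)
  case (Cons c xs)
  show ?case using Cons[of "k - 1"] by (cases k) auto
qed simp

text \<open>Equality holds when \<open>x\<close> separates the first \<open>k\<close> entries from
  the rest. If \<open>k\<close> exceeds the length, the missing entries would count as
  \<open>x\<close>, hence \<open>x = 0\<close>.\<close>

lemma sum_list_take_eq:
  fixes xs :: "nat list"
  assumes "\<And>c. c \<in> set (take k xs) \<Longrightarrow> x \<le> c" "\<And>c. c \<in> set (drop k xs) \<Longrightarrow> c \<le> x" "k \<le> length xs \<or> x = 0"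
  shows "sum_list (take k xs) = k * x + (\<Sum>c\<leftarrow>xs. c - x)"
  using assms
proof (induction xs arbitrary: k)
  case (Cons c xs)
  show ?case
  proof (cases k)
    case 0
    then have "\<forall>c\<in>set (c # xs). c \<le> x" using Cons.prems(2) by simp
    then have "(\<Sum>c\<leftarrow>c # xs. c - x) = 0" by auto
    then show ?thesis using 0 by simp
  next
    case (Suc k')
    then have "sum_list (take k' xs) = k' * x + (\<Sum>c\<leftarrow>xs. c - x)"
      using Cons.prems by (intro Cons.IH) auto
    moreover have "x \<le> c" using Cons.prems(1) Suc by simp
    ultimately show ?thesis using Suc by simp
  qed
qed auto

definition rows :: "partition \<Rightarrow> nat list" where
  "rows \<kappa> = rev (sorted_list_of_multiset (parts \<kappa>))"

lemma mset_rows: "mset (rows \<kappa>) = parts \<kappa>"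
  by (simp add: rows_def)

lemma length_rows: "length (rows \<kappa>) = plen \<kappa>"
  by (metis mset_rows plen_def size_mset)

lemma sorted_rows: "sorted_wrt (\<ge>) (rows \<kappa>)"
  by (simp add: rows_def sorted_wrt_rev)

lemma sum_row: "(\<Sum>i = 1..k. row \<kappa> i) = sum_list (take k (rows \<kappa>))"
proof (induction k)
  case (Suc k)
  have "row \<kappa> (Suc k) = (if k < length (rows \<kappa>) then rows \<kappa> ! k else 0)"
    by (auto simp: row_def length_rows) (simp_all add: rows_def)
  then show ?case using Suc by (auto simp: take_Suc_conv_app_nth)
qed simp

lemma sum_rows_excess: "(\<Sum>c\<leftarrow>rows \<kappa>. c - x) = excess x (parts \<kappa>)"
  unfolding excess_def by (metis mset_map mset_rows sum_mset_sum_list)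

lemma excess_attained: "\<exists>k. sum_list (take k (rows \<kappa>)) = k * x + excess x (parts \<kappa>)"
proof -
  define k where "k = length (takeWhile (\<lambda>c. x \<le> c) (rows \<kappa>))"
  have t: "take k (rows \<kappa>) = takeWhile (\<lambda>c. x \<le> c) (rows \<kappa>)"
    and d: "drop k (rows \<kappa>) = dropWhile (\<lambda>c. x \<le> c) (rows \<kappa>)"
    by (simp_all add: k_def takeWhile_eq_take[symmetric] dropWhile_eq_drop[symmetric])
  have "sum_list (take k (rows \<kappa>)) = k * x + (\<Sum>c\<leftarrow>rows \<kappa>. c - x)"
  proof (rule sum_list_take_eq)
    fix c assume "c \<in> set (take k (rows \<kappa>))"
    then show "x \<le> c" unfolding t by (rule set_takeWhileD[THEN conjunct2])
  next
    fix c assume c: "c \<in> set (drop k (rows \<kappa>))"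
    have s: "sorted_wrt (\<ge>) (drop k (rows \<kappa>))" using sorted_rows by (rule sorted_wrt_drop)
    obtain y ys where y: "drop k (rows \<kappa>) = y # ys" using c by (cases "drop k (rows \<kappa>)") auto
    then have "\<not> x \<le> y" using hd_dropWhile[of "\<lambda>c. x \<le> c" "rows \<kappa>"] d by auto
    then show "c \<le> x" using s c unfolding y by auto
  next
    show "k \<le> length (rows \<kappa>) \<or> x = 0" unfolding k_def by (simp add: length_takeWhile_le)
  qed
  then show ?thesis unfolding sum_rows_excess by blast
qed

text \<open>The minimum is attained at the k-th row; beyond the last row at 0, and for
  \<open>k = 0\<close> at any \<open>x\<close> so large that the excess vanishes.\<close>

lemma row_sum_attained: "\<exists>x. sum_list (take k (rows \<kappa>)) = k * x + excess x (parts \<kappa>)"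
proof (cases "0 < k \<and> k \<le> length (rows \<kappa>)")
  case True
  let ?x = "rows \<kappa> ! (k - 1)"
  have s: "\<And>i j. i \<le> j \<Longrightarrow> j < length (rows \<kappa>) \<Longrightarrow> rows \<kappa> ! j \<le> rows \<kappa> ! i"
    using sorted_rows[of \<kappa>] by (auto simp: sorted_wrt_iff_nth_less le_less)
  have "sum_list (take k (rows \<kappa>)) = k * ?x + (\<Sum>c\<leftarrow>rows \<kappa>. c - ?x)"
  proof (rule sum_list_take_eq)
    fix c assume "c \<in> set (take k (rows \<kappa>))"
    then obtain i where "i < k" "c = rows \<kappa> ! i" using True by (auto simp: in_set_conv_nth)
    then show "?x \<le> c" using s[of i "k - 1"] True by auto
  next
    fix c assume "c \<in> set (drop k (rows \<kappa>))"
    then obtain i where "i < length (rows \<kappa>) - k" "c = rows \<kappa> ! (k + i)" by (auto simp: in_set_conv_nth)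
    then show "c \<le> ?x" using s[of "k - 1" "k + i"] by auto
  qed (use True in simp)
  then show ?thesis unfolding sum_rows_excess by blast
next
  case False
  show ?thesis
  proof (cases "k = 0")
    case True
    then show ?thesis using excess_eq_0[of "parts \<kappa>" "sum_mset (parts \<kappa>)"] by (intro exI[of _ "sum_mset (parts \<kappa>)"]) simp
  next
    case 2: False
    then have "take k (rows \<kappa>) = rows \<kappa>" using False by simp
    then show ?thesis using sum_rows_excess[of 0 \<kappa>] by (intro exI[of _ 0]) simp
  qed
qed

lemma dominated_iff_dle: "dominated \<mu> \<kappa> \<longleftrightarrow> dle (parts \<mu>) (parts \<kappa>)"
proof -
  have le: "sum_list (take k (rows \<kappa>)) \<le> k * x + excess x (parts \<kappa>)" for k x \<kappa>
    using sum_list_take_le[of k "rows \<kappa>" x] by (simp add: sum_rows_excess)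
  have "(\<forall>k. sum_list (take k (rows \<mu>)) \<le> sum_list (take k (rows \<kappa>))) \<longleftrightarrow> (\<forall>x. excess x (parts \<mu>) \<le> excess x (parts \<kappa>))"
  proof (intro iffI allI)
    fix x assume *: "\<forall>k. sum_list (take k (rows \<mu>)) \<le> sum_list (take k (rows \<kappa>))"
    obtain k where "sum_list (take k (rows \<mu>)) = k * x + excess x (parts \<mu>)" using excess_attained by blast
    then show "excess x (parts \<mu>) \<le> excess x (parts \<kappa>)" using *[rule_format, of k] le[of k \<kappa> x] by linarith
  next
    fix k assume *: "\<forall>x. excess x (parts \<mu>) \<le> excess x (parts \<kappa>)"
    obtain x where "sum_list (take k (rows \<kappa>)) = k * x + excess x (parts \<kappa>)" using row_sum_attained by blast
    then show "sum_list (take k (rows \<mu>)) \<le> sum_list (take k (rows \<kappa>))" using *[rule_format, of x] le[of k \<mu> x] by linarith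
  qed
  then show ?thesis by (simp add: dominated_def dle_def sum_row psize_def del: One_nat_def)
qed

section \<open>Evaluation in finitely many variables\<close>

text \<open>\<open>exponents\<close> for multisets, so that a part can be removed in
  \<open>expo_Suc\<close>.\<close>

definition expo :: "nat \<Rightarrow> nat multiset \<Rightarrow> (nat \<Rightarrow> nat) set" where
  "expo N A = {a. (\<forall>i\<ge>N. a i = 0) \<and> {#k \<in># image_mset a (mset_set {..<N}). k \<noteq> 0#} = A}"

text \<open>How many ordered tuples of variables give the same monomial.\<close>

definition aut :: "nat multiset \<Rightarrow> real" where
  "aut A = (\<Prod>c\<in>set_mset A. fact (count A c))"

lemma exponents_expo: "exponents N \<mu> = expo N (parts \<mu>)"
  by (simp add: exponents_def expo_def)

lemma finite_expo: "finite (expo N A)"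
proof (cases "0 \<in># A")
  case True
  then have "expo N A = {}" by (auto simp: expo_def)
  then show ?thesis by simp
next
  case False
  then show ?thesis using finite_exponents[of N "Abs_partition A"] by (simp add: exponents_expo Abs_partition_inverse)
qed

lemma aut_pos: "aut A > 0"
  by (auto simp: aut_def intro!: prod_pos)

lemma aut_remove: "c \<in># A \<Longrightarrow> aut A = real (count A c) * aut (A - {#c#})"
proof -
  assume c: "c \<in># A"
  have sub: "set_mset (A - {#c#}) \<subseteq> set_mset A" by (auto dest: in_diffD)
  have "aut (A - {#c#}) = (\<Prod>b\<in>set_mset A. fact (count (A - {#c#}) b))"
    unfolding aut_def using sub by (intro prod.mono_neutral_left) (auto simp: not_in_iff)
  also have "\<dots> = fact (count A c - 1) * (\<Prod>b\<in>set_mset A - {c}. fact (count (A - {#c#}) b))"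
    using c by (subst prod.remove[of _ c]) auto
  also have "(\<Prod>b\<in>set_mset A - {c}. fact (count (A - {#c#}) b)) = (\<Prod>b\<in>set_mset A - {c}. fact (count A b) :: real)"
    by (intro prod.cong) auto
  finally have "real (count A c) * aut (A - {#c#}) = fact (count A c) * (\<Prod>b\<in>set_mset A - {c}. fact (count A b))"
    using c by (simp add: fact_reduce[of "count A c"])
  also have "\<dots> = aut A" unfolding aut_def using c by (subst prod.remove[of _ c]) auto
  finally show ?thesis ..
qed

lemma sum_mset_count: "(\<Sum>c\<in>#A. f c) = (\<Sum>c\<in>set_mset A. real (count A c) * f c)" for f :: "_ \<Rightarrow> real"
proof (induction A)
  case (add x A)
  have "(\<Sum>c\<in>set_mset (add_mset x A). real (count (add_mset x A) c) * f c) =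
      (\<Sum>c\<in>insert x (set_mset A). real (count A c) * f c + (if c = x then f c else 0))"
    by (intro sum.cong) (auto simp: algebra_simps)
  also have "\<dots> = (\<Sum>c\<in>insert x (set_mset A). real (count A c) * f c) + f x"
    by (simp add: sum.distrib)
  also have "(\<Sum>c\<in>insert x (set_mset A). real (count A c) * f c) = (\<Sum>c\<in>set_mset A. real (count A c) * f c)"
    by (intro sum.mono_neutral_right) (auto simp: not_in_iff)
  finally show ?case using add by simp
qed simp

lemma expo_Suc:
  assumes "0 \<notin># A"
  shows "expo (Suc N) A = expo N A \<union> (\<Union>c\<in>set_mset A. (\<lambda>a. a(N := c)) ` expo N (A - {#c#}))"
proof (intro set_eqI iffI)
  have im: "image_mset (a(N := c)) (mset_set {..<N}) = image_mset a (mset_set {..<N})" for a c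
    by (intro image_mset_cong) auto
  fix a assume a: "a \<in> expo (Suc N) A"
  show "a \<in> expo N A \<union> (\<Union>c\<in>set_mset A. (\<lambda>a. a(N := c)) ` expo N (A - {#c#}))"
  proof (cases "a N = 0")
    case True
    then have "a i = 0" if "i \<ge> N" for i using a that by (cases "i = N") (auto simp: expo_def)
    then show ?thesis using a True by (auto simp: expo_def lessThan_Suc)
  next
    case False
    then have eq: "add_mset (a N) {#k \<in># image_mset a (mset_set {..<N}). k \<noteq> 0#} = A"
      using a by (auto simp: expo_def lessThan_Suc)
    then have "a N \<in># A" "A - {#a N#} = {#k \<in># image_mset a (mset_set {..<N}). k \<noteq> 0#}" by auto
    moreover have "a(N := 0) \<in> expo N {#k \<in># image_mset a (mset_set {..<N}). k \<noteq> 0#}"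
      using a by (auto simp: expo_def im le_Suc_eq not_less_eq_eq)
    moreover have "a = (a(N := 0))(N := a N)" by simp
    ultimately show ?thesis by (metis (no_types, lifting) UN_I UnI2 image_eqI)
  qed
next
  have im: "image_mset (a(N := c)) (mset_set {..<N}) = image_mset a (mset_set {..<N})" for a c
    by (intro image_mset_cong) auto
  fix a assume "a \<in> expo N A \<union> (\<Union>c\<in>set_mset A. (\<lambda>a. a(N := c)) ` expo N (A - {#c#}))"
  then consider "a \<in> expo N A" | c b where "c \<in># A" "b \<in> expo N (A - {#c#})" "a = b(N := c)" by blast
  then show "a \<in> expo (Suc N) A"
  proof cases
    case 1 then show ?thesis by (auto simp: expo_def lessThan_Suc)
  next
    case 2
    then have "c \<noteq> 0" using assms by metis
    then show ?thesis using 2 by (auto simp: expo_def lessThan_Suc im)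
  qed
qed

text \<open>Induction on the number of variables: \<open>aug_add_variable\<close> matches the split
  of \<open>expo\<close> by the exponent of the last variable.\<close>

lemma aug_power_sums:
  fixes x :: "nat \<Rightarrow> real"
  assumes "0 \<notin># A"
  shows "aug (\<lambda>k. \<Sum>i<N. x i ^ k) A = aut A * (\<Sum>a\<in>expo N A. \<Prod>i<N. x i ^ a i)"
  using assms
proof (induction N arbitrary: A)
  case 0
  have zero: "aug (\<lambda>k. 0) B = (0::real)" if "B \<noteq> {#}" for B
    using that
  proof (induction "size B" arbitrary: B)
    case (Suc n)
    obtain k B' where B: "B = add_mset k B'" using Suc.hyps(2) by (metis size_eq_Suc_imp_eq_union)
    have "(\<Sum>c\<in>#B'. aug (\<lambda>k. 0) (add_mset (c + k) (B' - {#c#}))) = (\<Sum>c\<in>#B'. (0::real))"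
      using Suc B by (intro arg_cong[where f = sum_mset] image_mset_cong Suc.hyps) (auto simp: size_Suc_Diff1)
    then show ?case unfolding B aug_add_mset[of _ k B'] by simp
  qed simp
  have "expo 0 A = (if A = {#} then {\<lambda>_. 0} else {})" by (auto simp: expo_def)
  then show ?case using zero[of A] by (auto simp: aut_def)
next
  case (Suc N)
  let ?m = "\<lambda>N A. \<Sum>a\<in>expo N A. \<Prod>i<N. x i ^ a i"
  have A0: "0 \<notin># A - {#c#}" for c using Suc.prems by (auto dest: in_diffD)
  have "aug (\<lambda>k. \<Sum>i<Suc N. x i ^ k) A = aut A * ?m N A + (\<Sum>c\<in>#A. x N ^ c * (aut (A - {#c#}) * ?m N (A - {#c#})))"
    unfolding sum.lessThan_Suc aug_add_variable by (simp only: Suc.IH[OF Suc.prems] Suc.IH[OF A0])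
  \<comment> \<open>Each value \<open>c\<close> occurs \<open>count A c\<close> times, which is the
    quotient of \<open>aut A\<close> by \<open>aut (A - {#c#})\<close>.\<close>
  also have "(\<Sum>c\<in>#A. x N ^ c * (aut (A - {#c#}) * ?m N (A - {#c#}))) = (\<Sum>c\<in>set_mset A. aut A * (x N ^ c * ?m N (A - {#c#})))"
    unfolding sum_mset_count by (intro sum.cong) (auto simp: aut_remove)
  also have "\<dots> = aut A * (\<Sum>c\<in>set_mset A. \<Sum>a\<in>(\<lambda>a. a(N := c)) ` expo N (A - {#c#}). \<Prod>i<Suc N. x i ^ a i)"
    unfolding sum_distrib_left[symmetric]
  proof (intro arg_cong2[where f = "(*)"] sum.cong refl)
    fix c
    have "inj_on (\<lambda>a. a(N := c)) (expo N (A - {#c#}))"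
    proof (rule inj_onI)
      fix a b assume ab: "a \<in> expo N (A - {#c#})" "b \<in> expo N (A - {#c#})" "a(N := c) = b(N := c)"
      then have "a N = b N" by (simp add: expo_def)
      then show "a = b" using ab(3) by (metis fun_upd_triv fun_upd_upd)
    qed
    then show "x N ^ c * ?m N (A - {#c#}) = (\<Sum>a\<in>(\<lambda>a. a(N := c)) ` expo N (A - {#c#}). \<Prod>i<Suc N. x i ^ a i)"
      by (simp add: sum.reindex sum_distrib_left mult.commute)
  qed
  also have "(\<Sum>c\<in>set_mset A. \<Sum>a\<in>(\<lambda>a. a(N := c)) ` expo N (A - {#c#}). \<Prod>i<Suc N. x i ^ a i) =
      (\<Sum>a\<in>(\<Union>c\<in>set_mset A. (\<lambda>a. a(N := c)) ` expo N (A - {#c#})). \<Prod>i<Suc N. x i ^ a i)"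
    by (intro sum.UNION_disjoint[symmetric]) (auto simp: finite_expo dest!: fun_upd_eqD)
  also have "aut A * ?m N A = aut A * (\<Sum>a\<in>expo N A. \<Prod>i<Suc N. x i ^ a i)"
    by (auto simp: expo_def intro!: sum.cong)
  finally have "aug (\<lambda>k. \<Sum>i<Suc N. x i ^ k) A = aut A * ((\<Sum>a\<in>expo N A. \<Prod>i<Suc N. x i ^ a i) +
      (\<Sum>a\<in>(\<Union>c\<in>set_mset A. (\<lambda>a. a(N := c)) ` expo N (A - {#c#})). \<Prod>i<Suc N. x i ^ a i))"
    by (simp only: distrib_left)
  also have "(\<Sum>a\<in>expo N A. \<Prod>i<Suc N. x i ^ a i) +
      (\<Sum>a\<in>(\<Union>c\<in>set_mset A. (\<lambda>a. a(N := c)) ` expo N (A - {#c#})). \<Prod>i<Suc N. x i ^ a i) = ?m (Suc N) A"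
    unfolding expo_Suc[OF Suc.prems]
  proof (intro sum.union_disjoint[symmetric])
    show "expo N A \<inter> (\<Union>c\<in>set_mset A. (\<lambda>a. a(N := c)) ` expo N (A - {#c#})) = {}"
      using Suc.prems by (auto simp: expo_def)
  qed (auto simp: finite_expo)
  finally show ?case .
qed

section \<open>From values in finitely many variables to symmetric functions\<close>

lemma spec_scaleR: "spec v (r *\<^sub>R F) = r * spec v F"
  by (simp add: scaleR_eq_times spec_scale)

lemma linear_spec: "linear (spec v)"
  by (rule linearI) (simp_all add: spec_add spec_scaleR)

lemma spec_symaug: "0 \<notin># A \<Longrightarrow> spec v (symaug A) = aug v A"
  by (rule aug_hom) (simp_all add: spec_one spec_add spec_mult spec_powersum)

lemma spec_symaug_variables:
  "spec (\<lambda>k. \<Sum>i<N. x i ^ k) (symaug (parts \<mu>)) = aut (parts \<mu>) * monomial_poly \<mu> N x"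
  by (simp add: spec_symaug aug_power_sums monomial_poly_def exponents_expo)

text \<open>The last variable is peeled off as the indeterminate of a polynomial that vanishes
  identically. Only the first \<open>N\<close> exponents enter the products, hence the injectivity
  of \<open>restrict\<close>.\<close>

lemma monomials_independent:
  fixes f :: "(nat \<Rightarrow> nat) \<Rightarrow> real"
  assumes "finite S" "inj_on (\<lambda>a. restrict a {..<N}) S" "\<And>x :: nat \<Rightarrow> real. (\<Sum>a\<in>S. f a * (\<Prod>i<N. x i ^ a i)) = 0" "a \<in> S"
  shows "f a = 0"
  using assms
proof (induction N arbitrary: S a)
  case 0
  then have "S = {a}" by (auto simp: inj_on_def restrict_def fun_eq_iff)
  then show ?case using 0 by simp
next
  case (Suc N)
  define j where "j = a N"
  let ?T = "{b \<in> S. b N = j}"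
  have "(\<Sum>b\<in>?T. f b * (\<Prod>i<N. x i ^ b i)) = 0" for x :: "nat \<Rightarrow> real"
  proof -
    define C where "C k = (\<Sum>b | b \<in> S \<and> b N = k. f b * (\<Prod>i<N. x i ^ b i))" for k
    define M where "M = Max ((\<lambda>b. b N) ` S)"
    have M: "b N \<le> M" if "b \<in> S" for b using that Suc.prems(1) by (simp add: M_def)
    have "(\<Sum>k\<le>M. C k * t ^ k) = 0" for t
    proof -
      have "(\<Prod>i<Suc N. (x(N := t)) i ^ b i) = (\<Prod>i<N. x i ^ b i) * t ^ b N" for b by simp
      then have "0 = (\<Sum>b\<in>S. f b * (\<Prod>i<N. x i ^ b i) * t ^ b N)"
        using Suc.prems(3)[of "x(N := t)"] by (simp only: mult.assoc)
      also have "\<dots> = (\<Sum>k\<le>M. \<Sum>b | b \<in> S \<and> b N = k. f b * (\<Prod>i<N. x i ^ b i) * t ^ b N)"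
        using Suc.prems(1) M by (intro sum.group[symmetric]) auto
      also have "\<dots> = (\<Sum>k\<le>M. C k * t ^ k)"
        unfolding C_def sum_distrib_right by (intro sum.cong) auto
      finally show ?thesis ..
    qed
    then have "\<forall>t. (\<Sum>k\<le>M. C k * t ^ k) = 0" by blast
    then have "\<forall>k\<le>M. C k = 0" by (simp only: polyfun_eq_0)
    then show ?thesis using M[OF Suc.prems(4)] by (simp add: C_def j_def)
  qed
  moreover have "inj_on (\<lambda>b. restrict b {..<N}) ?T"
  proof (rule inj_onI)
    fix b c assume bc: "b \<in> ?T" "c \<in> ?T" "restrict b {..<N} = restrict c {..<N}"
    have "b i = c i" if "i < Suc N" for i
    proof (cases "i < N")
      case True then show ?thesis using fun_cong[OF bc(3), of i] by simp
    next
      case False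
      then have "i = N" using that by simp
      then show ?thesis using bc(1,2) by simp
    qed
    then have "restrict b {..<Suc N} = restrict c {..<Suc N}" by (auto simp: restrict_def)
    then show "b = c" by (rule inj_onD[OF Suc.prems(2)]) (use bc in auto)
  qed
  moreover have "finite ?T" "a \<in> ?T" using Suc.prems(1,4) by (auto simp: j_def)
  ultimately show ?case by (intro Suc.IH[of ?T])
qed

lemma expo_nonempty:
  assumes "0 \<notin># A" "size A \<le> N" shows "expo N A \<noteq> {}"
proof -
  obtain xs where xs: "mset xs = A" using ex_mset by blast
  define a where "a i = (if i < length xs then xs ! i else 0)" for i
  have U: "{..<N} = {..<length xs} \<union> {length xs..<N}" using assms(2) xs by auto
  have "mset_set {..<N} = mset_set {..<length xs} + mset_set {length xs..<N}"
    unfolding U by (rule mset_set_Union) auto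
  moreover have "image_mset a (mset_set {..<length xs}) = A"
  proof -
    have "image_mset a (mset_set {..<length xs}) = image_mset ((!) xs) (mset_set {..<length xs})"
      by (intro image_mset_cong) (auto simp: a_def)
    then show ?thesis using xs by (metis atLeast0LessThan map_nth mset_map mset_upt)
  qed
  moreover have "image_mset a (mset_set {length xs..<N}) = image_mset (\<lambda>_. 0) (mset_set {length xs..<N})"
    by (intro image_mset_cong) (auto simp: a_def)
  moreover have "{#k \<in># image_mset (\<lambda>_. 0 :: nat) X. k \<noteq> 0#} = {#}" for X :: "nat multiset"
    by (induction X) auto
  moreover have "{#k \<in># A. k \<noteq> 0#} = A" using assms(1) by (induction A) auto
  ultimately have "{#k \<in># image_mset a (mset_set {..<N}). k \<noteq> 0#} = A" by (simp only: image_mset_union filter_union_mset empty_neutral)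
  moreover have "a i = 0" if "i \<ge> N" for i using that assms(2) xs by (auto simp: a_def)
  ultimately have "a \<in> expo N A" by (simp add: expo_def)
  then show ?thesis by blast
qed

text \<open>With as many variables as the longest multiset of the expansion has parts, every
  \<open>symaug\<close> contains a monomial, and different multisets share none.\<close>

lemma spec_variables_injective:
  assumes "\<And>(N :: nat) x. spec (\<lambda>k. \<Sum>i<N. x i ^ k) F = 0" shows "F = 0"
proof -
  have "F \<in> span (symaug ` {A. 0 \<notin># A})" by (rule symaug_span)
  then obtain T r where T: "finite T" "T \<subseteq> symaug ` {A. 0 \<notin># A}" "F = (\<Sum>s\<in>T. r s *\<^sub>R s)"
    unfolding span_explicit by blast
  have "\<exists>D. D \<subseteq> {A. 0 \<notin># A} \<and> inj_on symaug D \<and> T = symaug ` D" using T(2) unfolding subset_image_inj by blast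
  then obtain D where D: "D \<subseteq> {A. 0 \<notin># A}" "inj_on symaug D" "T = symaug ` D" by blast
  have finD: "finite D" using T(1) D(2,3) by (simp add: finite_image_iff)
  define c where "c A = r (symaug A)" for A
  have F: "F = (\<Sum>A\<in>D. c A *\<^sub>R symaug A)" using T(3) D by (simp add: sum.reindex c_def)
  define N where "N = Max (insert 0 (size ` D))"
  have N: "size A \<le> N" if "A \<in> D" for A using that finD by (simp add: N_def)
  let ?S = "\<Union>A\<in>D. expo N A"
  \<comment> \<open>\<open>shp\<close> recovers the multiset from an exponent vector, so the double
    sum becomes one sum over distinct monomials.\<close>
  define shp where "shp a = {#k \<in># image_mset a (mset_set {..<N}). k \<noteq> 0#}" for a :: "nat \<Rightarrow> nat"
  have shp: "a \<in> expo N A \<Longrightarrow> shp a = A" for a A by (simp add: expo_def shp_def)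
  have "c A * aut A = 0" if A: "A \<in> D" for A
  proof -
    obtain a where a: "a \<in> expo N A" using expo_nonempty[of A N] N[OF A] A D(1) by auto
    have "(\<Sum>a\<in>?S. (c (shp a) * aut (shp a)) * (\<Prod>i<N. x i ^ a i)) = 0" for x :: "nat \<Rightarrow> real"
    proof -
      have "0 = (\<Sum>A\<in>D. c A * spec (\<lambda>k. \<Sum>i<N. x i ^ k) (symaug A))"
        using assms[of x N] unfolding F by (simp add: linear_sum[OF linear_spec] spec_scaleR)
      also have "\<dots> = (\<Sum>A\<in>D. \<Sum>a\<in>expo N A. (c (shp a) * aut (shp a)) * (\<Prod>i<N. x i ^ a i))"
      proof (intro sum.cong refl)
        fix A assume "A \<in> D"
        then show "c A * spec (\<lambda>k. \<Sum>i<N. x i ^ k) (symaug A) =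
            (\<Sum>a\<in>expo N A. (c (shp a) * aut (shp a)) * (\<Prod>i<N. x i ^ a i))"
          using D(1) by (auto simp: spec_symaug aug_power_sums shp sum_distrib_left mult.assoc intro!: sum.cong)
      qed
      also have "\<dots> = (\<Sum>a\<in>?S. (c (shp a) * aut (shp a)) * (\<Prod>i<N. x i ^ a i))"
        using finD shp by (intro sum.UNION_disjoint[symmetric]) (auto simp: finite_expo)
      finally show ?thesis ..
    qed
    moreover have "inj_on (\<lambda>a. restrict a {..<N}) ?S"
    proof (rule inj_onI)
      fix a b assume ab: "a \<in> ?S" "b \<in> ?S" "restrict a {..<N} = restrict b {..<N}"
      show "a = b"
      proof
        fix i show "a i = b i"
        proof (cases "i < N")
          case True then show ?thesis using fun_cong[OF ab(3), of i] by simp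
        qed (use ab(1,2) in \<open>auto simp: expo_def\<close>)
      qed
    qed
    ultimately have "c (shp a) * aut (shp a) = 0"
      using finD a A by (intro monomials_independent[of ?S N "\<lambda>a. c (shp a) * aut (shp a)"]) (auto simp: finite_expo)
    then show ?thesis using shp[OF a] by simp
  qed
  then have "c A = 0" if "A \<in> D" for A using that aut_pos[of A] by force
  then show ?thesis unfolding F by simp
qed

text \<open>Values determine the symmetric function, so the condition becomes an identity in
  \<open>sym\<close>; \<open>aut\<close> converts between monomials and augmented monomials.\<close>

lemma dominance_triangular_iff:
  "dominance_triangular \<kappa> F \<longleftrightarrow> (\<exists>c. F = (\<Sum>A | dle A (parts \<kappa>). c A *\<^sub>R symaug A))"
proof -
  have inj: "inj parts" by (simp add: inj_on_def parts_inject)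
  have D: "{A. dle A (parts \<kappa>)} = parts ` {\<mu>. dominated \<mu> \<kappa>}"
  proof (intro set_eqI iffI)
    fix A assume A: "A \<in> {A. dle A (parts \<kappa>)}"
    then have "parts (Abs_partition A) = A" by (auto simp: Abs_partition_inverse dle_no_zero)
    then show "A \<in> parts ` {\<mu>. dominated \<mu> \<kappa>}" using A by (metis dominated_iff_dle imageI mem_Collect_eq)
  qed (auto simp: dominated_iff_dle)
  have sum: "(\<Sum>A | dle A (parts \<kappa>). c A *\<^sub>R symaug A) = (\<Sum>\<mu> | dominated \<mu> \<kappa>. c (parts \<mu>) *\<^sub>R symaug (parts \<mu>))" for c
    unfolding D using inj by (subst sum.reindex) (auto simp: inj_on_def)
  have eval: "spec (\<lambda>k. \<Sum>i<N. x i ^ k) (\<Sum>A | dle A (parts \<kappa>). c A *\<^sub>R symaug A) =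
      (\<Sum>\<mu> | dominated \<mu> \<kappa>. (c (parts \<mu>) * aut (parts \<mu>)) * monomial_poly \<mu> N x)" for c N x
    unfolding sum by (simp add: linear_sum[OF linear_spec] spec_scaleR spec_symaug_variables mult.assoc)
  show ?thesis
  proof
    assume "dominance_triangular \<kappa> F"
    then obtain c where c: "\<And>N x. spec (\<lambda>k. \<Sum>i<N. x i ^ k) F = (\<Sum>\<mu> | dominated \<mu> \<kappa>. c \<mu> * monomial_poly \<mu> N x)"
      unfolding dominance_triangular_def by blast
    define d where "d A = c (Abs_partition A) / aut A" for A
    have "d (parts \<mu>) * aut (parts \<mu>) = c \<mu>" for \<mu> using aut_pos[of "parts \<mu>"] by (simp add: d_def parts_inverse)
    then have "spec (\<lambda>k. \<Sum>i<N. x i ^ k) F = spec (\<lambda>k. \<Sum>i<N. x i ^ k) (\<Sum>A | dle A (parts \<kappa>). d A *\<^sub>R symaug A)" for N :: nat and x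
      by (subst eval, subst c) simp
    then have "F - (\<Sum>A | dle A (parts \<kappa>). d A *\<^sub>R symaug A) = 0"
      by (intro spec_variables_injective) (subst linear_diff[OF linear_spec], simp)
    then show "\<exists>c. F = (\<Sum>A | dle A (parts \<kappa>). c A *\<^sub>R symaug A)" by auto
  next
    assume "\<exists>c. F = (\<Sum>A | dle A (parts \<kappa>). c A *\<^sub>R symaug A)"
    then obtain c where F: "F = (\<Sum>A | dle A (parts \<kappa>). c A *\<^sub>R symaug A)" by blast
    show "dominance_triangular \<kappa> F"
      unfolding dominance_triangular_def F eval
      by (rule exI[of _ "\<lambda>\<mu>. c (parts \<mu>) * aut (parts \<mu>)"]) simp
  qed
qed

section \<open>Jack functions\<close>

lemma psize_parts: "sum_mset (parts \<kappa>) = psize \<kappa>"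
  by (simp add: psize_def)

lemma jackJ_coeff_pos:
  assumes "\<alpha> > 0" shows "Poly_Mapping.lookup (jackP \<alpha> (parts \<kappa>)) (ones (psize \<kappa>)) > 0"
  using jackP_ones_pos[OF assms zero_notin_parts, of \<kappa>] by (simp add: psize_parts)

lemma jackP_nonzero: "\<alpha> > 0 \<Longrightarrow> 0 \<notin># B \<Longrightarrow> jackP \<alpha> B \<noteq> 0"
  using jackP_ones_pos[of \<alpha> B] by auto

lemma jackP_norm_pos: "\<alpha> > 0 \<Longrightarrow> 0 \<notin># B \<Longrightarrow> jack_inner \<alpha> (jackP \<alpha> B) (jackP \<alpha> B) \<noteq> 0"
  using form_pos[of "jweight \<alpha>" "jackP \<alpha> B", OF jweight_pos] jackP_nonzero by (auto simp: jack_inner_form)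

lemma is_jack_family_jackJ:
  assumes "\<alpha> > 0" shows "is_jack_family \<alpha> (jackJ \<alpha>)"
  unfolding is_jack_family_def
proof (intro conjI allI impI)
  fix \<kappa> \<mu> :: partition assume "\<kappa> \<noteq> \<mu>"
  then have "parts \<kappa> \<noteq> parts \<mu>" by (simp add: parts_inject)
  then show "jack_inner \<alpha> (jackJ \<alpha> \<kappa>) (jackJ \<alpha> \<mu>) = 0"
    using jackP_orthogonal[OF assms zero_notin_parts zero_notin_parts, of \<kappa> \<mu>]
    by (simp add: jackJ_def jack_inner_form form_linear)
next
  fix \<kappa>
  obtain c where "jackP \<alpha> (parts \<kappa>) = (\<Sum>A | dle A (parts \<kappa>). c A *\<^sub>R symaug A)"
    using jackP_coefficients[OF assms zero_notin_parts, of \<kappa>] by blast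
  then have "jackJ \<alpha> \<kappa> = (\<Sum>A | dle A (parts \<kappa>). (1 / Poly_Mapping.lookup (jackP \<alpha> (parts \<kappa>)) (ones (psize \<kappa>)) * c A) *\<^sub>R symaug A)"
    unfolding jackJ_def by (simp add: scaleR_sum_right)
  then show "dominance_triangular \<kappa> (jackJ \<alpha> \<kappa>)" unfolding dominance_triangular_iff
    by (intro exI[of _ "\<lambda>A. 1 / Poly_Mapping.lookup (jackP \<alpha> (parts \<kappa>)) (ones (psize \<kappa>)) * c A"])
  show "Poly_Mapping.lookup (jackJ \<alpha> \<kappa>) (ones (psize \<kappa>)) = 1"
    using jackJ_coeff_pos[OF assms, of \<kappa>] by (simp add: jackJ_def)
qed

lemma symaug_span_jackP:
  assumes "\<alpha> > 0" "0 \<notin># B"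
  shows "symaug B \<in> span (jackP \<alpha> ` {A. dle A B})"
  using assms(2)
proof (induction "\<Sum>c\<in>#B. c\<^sup>2" arbitrary: B rule: less_induct)
  case less
  let ?V = "span (jackP \<alpha> ` {A. dle A B})"
  have "symaug ` {A. dless A B} \<subseteq> ?V"
  proof clarify
    fix A assume A: "dless A B"
    then have "symaug A \<in> span (jackP \<alpha> ` {C. dle C A})"
      using dle_no_zero(1)[of A B] sum_squares_less[of A B] by (intro less.hyps) (auto simp: dless_def)
    also have "\<dots> \<subseteq> ?V" using A by (intro span_mono) (auto intro: dle_trans dless_imp_dle)
    finally show "symaug A \<in> ?V" .
  qed
  then have "low B \<subseteq> ?V" unfolding low_def by (intro span_minimal) auto
  then have 1: "jackP \<alpha> B - symaug B \<in> ?V" using jackP_low[OF assms(1)] by blast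
  have "jackP \<alpha> B \<in> ?V" using dle_refl[OF less.prems] by (intro span_base) auto
  from span_diff[OF this 1] show ?case by simp
qed

lemma jackP_expansion_inner:
  assumes "\<alpha> > 0" "finite D" "\<And>A. A \<in> D \<Longrightarrow> 0 \<notin># A" "B \<in> D"
  shows "jack_inner \<alpha> (\<Sum>A\<in>D. c A *\<^sub>R jackP \<alpha> A) (jackP \<alpha> B) = c B * jack_inner \<alpha> (jackP \<alpha> B) (jackP \<alpha> B)"
proof -
  have "jack_inner \<alpha> (\<Sum>A\<in>D. c A *\<^sub>R jackP \<alpha> A) (jackP \<alpha> B) = (\<Sum>A\<in>D. c A * jack_inner \<alpha> (jackP \<alpha> A) (jackP \<alpha> B))"
    by (simp add: jack_inner_form linear_sum[OF linear_form_left] form_linear)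
  also have "\<dots> = (\<Sum>A\<in>D. if A = B then c B * jack_inner \<alpha> (jackP \<alpha> B) (jackP \<alpha> B) else 0)"
    using jackP_orthogonal[OF assms(1) assms(3) assms(3)[OF assms(4)]] by (intro sum.cong) auto
  finally show ?thesis using assms(2,4) by simp
qed

text \<open>Induction along dominance: \<open>J \<kappa>\<close> is a combination of
  \<open>jackP\<close> at lower multisets. Orthogonality to the lower members, already identified,
  leaves the top term, and the normalisation fixes the scalar.\<close>

lemma jack_family_unique:
  assumes "\<alpha> > 0" "is_jack_family \<alpha> J" shows "J = jackJ \<alpha>"
proof
  fix \<kappa>
  have orth: "jack_inner \<alpha> (J \<kappa>) (J \<mu>) = 0" if "\<kappa> \<noteq> \<mu>" for \<kappa> \<mu> using assms(2) that by (simp add: is_jack_family_def)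
  have tri: "dominance_triangular \<kappa> (J \<kappa>)" and one: "Poly_Mapping.lookup (J \<kappa>) (ones (psize \<kappa>)) = 1" for \<kappa>
    using assms(2) by (auto simp: is_jack_family_def)
  show "J \<kappa> = jackJ \<alpha> \<kappa>"
  proof (induction "\<Sum>c\<in>#parts \<kappa>. c\<^sup>2" arbitrary: \<kappa> rule: less_induct)
    case less
    let ?B = "parts \<kappa>"
    let ?D = "{A. dle A ?B}"
    have D0: "\<And>A. A \<in> ?D \<Longrightarrow> 0 \<notin># A" using dle_no_zero by blast
    obtain b where b: "J \<kappa> = (\<Sum>A\<in>?D. b A *\<^sub>R symaug A)"
      using tri[of \<kappa>] unfolding dominance_triangular_iff by blast
    have "J \<kappa> \<in> span (jackP \<alpha> ` ?D)"
      unfolding b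
    proof (intro span_sum span_scale)
      fix A assume A: "A \<in> ?D"
      then have "symaug A \<in> span (jackP \<alpha> ` {C. dle C A})" using D0 by (intro symaug_span_jackP assms) auto
      also have "\<dots> \<subseteq> span (jackP \<alpha> ` ?D)" using A by (intro span_mono) (auto intro: dle_trans)
      finally show "symaug A \<in> span (jackP \<alpha> ` ?D)" .
    qed
    then obtain c where c: "J \<kappa> = (\<Sum>A\<in>?D. c A *\<^sub>R jackP \<alpha> A)" using span_image_expansion[OF finite_dle] by blast
    have zero: "c A = 0" if A: "dless A ?B" for A
    proof -
      define \<mu> where "\<mu> = Abs_partition A"
      have \<mu>: "parts \<mu> = A" using dle_no_zero(1)[OF dless_imp_dle[OF A]] by (simp add: \<mu>_def Abs_partition_inverse)
      have "J \<mu> = jackJ \<alpha> \<mu>" using A sum_squares_less by (intro less.hyps) (auto simp: \<mu> dless_def)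
      then have "jack_inner \<alpha> (J \<kappa>) (jackJ \<alpha> \<mu>) = 0" using orth[of \<kappa> \<mu>] A \<mu> by (auto simp: dless_def)
      then have "jack_inner \<alpha> (J \<kappa>) (jackP \<alpha> A) = 0"
        using jackJ_coeff_pos[OF assms(1), of \<mu>] by (simp add: jackJ_def \<mu> jack_inner_form form_linear)
      then have "c A * jack_inner \<alpha> (jackP \<alpha> A) (jackP \<alpha> A) = 0"
        unfolding c by (subst (asm) jackP_expansion_inner[OF assms(1) finite_dle D0]) (use A in \<open>simp_all add: dless_def\<close>)
      then show ?thesis using jackP_norm_pos[OF assms(1), of A] dle_no_zero(1)[OF dless_imp_dle[OF A]] by simp
    qed
    have "J \<kappa> = (\<Sum>A\<in>?D. if A = ?B then c ?B *\<^sub>R jackP \<alpha> ?B else 0)"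
      unfolding c using zero by (intro sum.cong) (auto simp: dless_def)
    then have J: "J \<kappa> = c ?B *\<^sub>R jackP \<alpha> ?B" using dle_refl[of ?B] finite_dle[of ?B] by simp
    have "c ?B * Poly_Mapping.lookup (jackP \<alpha> ?B) (ones (psize \<kappa>)) = 1" using one[of \<kappa>] by (simp add: J)
    then have "c ?B = 1 / Poly_Mapping.lookup (jackP \<alpha> ?B) (ones (psize \<kappa>))"
      using jackJ_coeff_pos[OF assms(1), of \<kappa>] by (simp add: field_simps)
    then show ?case by (simp add: J jackJ_def)
  qed
qed

theorem jack_eq: "\<alpha> > 0 \<Longrightarrow> jack \<alpha> = jackJ \<alpha>"
  unfolding jack_def by (rule the_equality) (auto intro: is_jack_family_jackJ jack_family_unique)

section \<open>Positivity of specializations\<close>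

lemma jack_nonneg_iff:
  assumes "\<alpha> > 0"
  shows "spec v (jack \<alpha> \<kappa>) \<ge> 0 \<longleftrightarrow> spec v (jackP \<alpha> (parts \<kappa>)) \<ge> 0"
  using jackJ_coeff_pos[OF assms, of \<kappa>]
  by (simp add: jack_eq[OF assms] jackJ_def spec_scaleR zero_le_mult_iff zero_le_divide_iff)

lemma jackP_nonneg:
  assumes "\<alpha> > 0" "0 \<notin># B" "\<And>A. 0 \<notin># A \<Longrightarrow> aug v A \<ge> 0"
  shows "spec v (jackP \<alpha> B) \<ge> 0"
proof -
  obtain c where c: "jackP \<alpha> B = (\<Sum>A | dle A B. c A *\<^sub>R symaug A)" "\<And>A. dle A B \<Longrightarrow> c A \<ge> 0"
    using jackP_coefficients[OF assms(1,2)] by blast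
  have "spec v (jackP \<alpha> B) = (\<Sum>A | dle A B. c A * aug v A)"
    unfolding c(1) using dle_no_zero(1)
    by (auto simp: linear_sum[OF linear_spec] spec_scaleR spec_symaug intro!: sum.cong)
  then show ?thesis using c(2) assms(3) dle_no_zero(1) by (auto intro!: sum_nonneg mult_nonneg_nonneg)
qed

text \<open>Downward from \<open>B\<close>: the recursion divides a convergent sum by an energy gap
  of at least \<alpha>, so every coefficient except that of \<open>B\<close> tends to 0.\<close>

lemma spec_jackP_limit:
  assumes "0 \<notin># B"
  shows "((\<lambda>\<alpha>. spec v (jackP \<alpha> B)) \<longlongrightarrow> aug v B) at_top"
proof -
  let ?D = "{A. dle A B}"
  define Q where "Q \<alpha> c \<longleftrightarrow> jackP \<alpha> B = (\<Sum>A | dle A B. c A *\<^sub>R symaug A) \<and> c B = 1 \<and> (\<forall>A. dle A B \<longrightarrow> c A \<ge> 0) \<and>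
    (\<forall>A. dless A B \<longrightarrow> (energy \<alpha> B - energy \<alpha> A) * c A = (\<Sum>\<nu> | dle \<nu> B \<and> dless A \<nu>. c \<nu> * hcoef \<nu> A))" for \<alpha> c
  have "\<forall>\<alpha>. \<exists>c. \<alpha> > 0 \<longrightarrow> Q \<alpha> c" using jackP_coefficients[OF _ assms] unfolding Q_def by blast
  from choice[OF this] obtain C where "\<And>\<alpha>. \<alpha> > 0 \<Longrightarrow> Q \<alpha> (C \<alpha>)" by blast
  then have C: "\<And>\<alpha>. \<alpha> > 0 \<Longrightarrow> jackP \<alpha> B = (\<Sum>A | dle A B. C \<alpha> A *\<^sub>R symaug A)"
    "\<And>\<alpha>. \<alpha> > 0 \<Longrightarrow> C \<alpha> B = 1" "\<And>\<alpha> A. \<alpha> > 0 \<Longrightarrow> dle A B \<Longrightarrow> C \<alpha> A \<ge> 0"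
    "\<And>\<alpha> A. \<alpha> > 0 \<Longrightarrow> dless A B \<Longrightarrow>
      (energy \<alpha> B - energy \<alpha> A) * C \<alpha> A = (\<Sum>\<nu> | dle \<nu> B \<and> dless A \<nu>. C \<alpha> \<nu> * hcoef \<nu> A)"
    unfolding Q_def by blast+
  have pos: "eventually (\<lambda>\<alpha>::real. \<alpha> > 0) at_top" by (rule eventually_gt_at_top)
  have CB: "((\<lambda>\<alpha>. C \<alpha> B) \<longlongrightarrow> 1) at_top"
    by (rule tendsto_eventually, rule eventually_mono[OF pos], rule C(2))
  have lim: "((\<lambda>\<alpha>. C \<alpha> A) \<longlongrightarrow> (if A = B then 1 else 0)) at_top" if "dle A B" for A
    using that
  proof (induction "(\<Sum>c\<in>#B. c\<^sup>2) - (\<Sum>c\<in>#A. c\<^sup>2)" arbitrary: A rule: less_induct)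
    case less
    show ?case
    proof (cases "A = B")
      case True then show ?thesis using CB by simp
    next
      case False
      then have A: "dless A B" using less.prems by (simp add: dless_def)
      let ?N = "{\<nu>. dle \<nu> B \<and> dless A \<nu>}"
      have "((\<lambda>\<alpha>. C \<alpha> \<nu>) \<longlongrightarrow> (if \<nu> = B then 1 else 0)) at_top" if "\<nu> \<in> ?N" for \<nu>
      proof -
        have "(\<Sum>c\<in>#A. c\<^sup>2) < (\<Sum>c\<in>#\<nu>. c\<^sup>2)" "(\<Sum>c\<in>#A. c\<^sup>2) < (\<Sum>c\<in>#B. c\<^sup>2)"
          using that A sum_squares_less by (auto simp: dless_def)
        then show ?thesis using that by (intro less.hyps) auto
      qed
      then have "((\<lambda>\<alpha>. (\<Sum>\<nu>\<in>?N. C \<alpha> \<nu> * hcoef \<nu> A) * inverse \<alpha>) \<longlongrightarrow>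
          (\<Sum>\<nu>\<in>?N. (if \<nu> = B then 1 else 0) * hcoef \<nu> A) * 0) at_top"
        by (intro tendsto_mult tendsto_sum tendsto_const tendsto_inverse_0_at_top filterlim_ident) auto
      then have up: "((\<lambda>\<alpha>. (\<Sum>\<nu>\<in>?N. C \<alpha> \<nu> * hcoef \<nu> A) * inverse \<alpha>) \<longlongrightarrow> 0) at_top" by simp
      have "C \<alpha> A \<le> (\<Sum>\<nu>\<in>?N. C \<alpha> \<nu> * hcoef \<nu> A) * inverse \<alpha>" if "\<alpha> > 0" for \<alpha>
      proof -
        have "\<alpha> * C \<alpha> A \<le> (energy \<alpha> B - energy \<alpha> A) * C \<alpha> A"
          using energy_less[OF A that] C(3)[OF that less.prems] by (intro mult_right_mono)
        then show ?thesis unfolding C(4)[OF that A] using that by (simp add: field_simps)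
      qed
      then have "((\<lambda>\<alpha>. C \<alpha> A) \<longlongrightarrow> 0) at_top"
        using C(3)[OF _ less.prems]
        by (intro tendsto_sandwich[OF _ _ tendsto_const up]) (auto intro!: eventually_mono[OF pos])
      then show ?thesis using False by simp
    qed
  qed
  have "((\<lambda>\<alpha>. \<Sum>A\<in>?D. C \<alpha> A * aug v A) \<longlongrightarrow> (\<Sum>A\<in>?D. (if A = B then 1 else 0) * aug v A)) at_top"
    by (intro tendsto_sum tendsto_mult tendsto_const lim) auto
  moreover have "(\<Sum>A\<in>?D. (if A = B then 1 else 0) * aug v A) = aug v B"
    using dle_refl[OF assms] finite_dle[of B] by (simp add: if_distrib[of "\<lambda>x. x * _"] cong: if_cong)
  moreover have "eventually (\<lambda>\<alpha>. (\<Sum>A\<in>?D. C \<alpha> A * aug v A) = spec v (jackP \<alpha> B)) at_top"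
    using pos
  proof eventually_elim
    case (elim \<alpha>)
    then show ?case unfolding C(1)[OF elim] using dle_no_zero(1)
      by (auto simp: linear_sum[OF linear_spec] spec_scaleR spec_symaug intro!: sum.cong)
  qed
  ultimately show ?thesis by (simp add: tendsto_cong)
qed

lemma totally_jack_positive_aug:
  assumes "totally_jack_positive v" "0 \<notin># B" shows "aug v B \<ge> 0"
proof -
  have "spec v (jackP \<alpha> B) \<ge> 0" if "\<alpha> > 0" for \<alpha>
    using assms jack_nonneg_iff[OF that, of v "Abs_partition B"] that
    by (simp add: totally_jack_positive_def Abs_partition_inverse)
  then have "eventually (\<lambda>\<alpha>. 0 \<le> spec v (jackP \<alpha> B)) at_top"
    by (intro eventually_mono[OF eventually_gt_at_top[of 0]]) auto
  from tendsto_lowerbound[OF spec_jackP_limit[OF assms(2)] this] show ?thesis by simp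
qed

lemma totally_jack_positive_multiple:
  assumes "totally_jack_positive v" "n > 0"
  shows "totally_jack_positive (\<lambda>k. real n * v k)"
proof -
  obtain m where n: "n = Suc m" using assms(2) by (cases n) auto
  have "aug (\<lambda>k. real n * v k) A \<ge> 0" if "0 \<notin># A" for A
    unfolding n by (rule aug_mult_nat_nonneg[OF totally_jack_positive_aug[OF assms(1)] that])
  then show ?thesis
    unfolding totally_jack_positive_def using jack_nonneg_iff jackP_nonneg by simp
qed

text \<open>For k > 1, p_1 p_(k-1) is the sum of p_k and an augmented monomial, both nonnegative at
  \<open>v\<close>; thus \<open>v 1 = 0\<close> would force \<open>v k = 0\<close>.\<close>

lemma totally_jack_positive_first:
  assumes "totally_jack_positive v" "k \<ge> 1" "v k \<noteq> 0" shows "v 1 > 0"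
proof -
  have "v 1 \<ge> 0" using totally_jack_positive_aug[OF assms(1), of "{#1#}"] by simp
  moreover have "v 1 \<noteq> 0"
  proof
    assume v1: "v 1 = 0"
    show False
    proof (cases "k = 1")
      case True then show ?thesis using v1 assms(3) by simp
    next
      case False
      have "v 1 * aug v {#k - 1#} = aug v {#1, k - 1#} + v k"
        using aug_mult[of v 1 "{#k - 1#}"] False assms(2) by (simp del: aug_single) simp
      moreover have "aug v {#1, k - 1#} \<ge> 0" "v k \<ge> 0"
        using totally_jack_positive_aug[OF assms(1), of "{#1, k - 1#}"]
          totally_jack_positive_aug[OF assms(1), of "{#k#}"] False assms(2) by auto
      ultimately show False using v1 assms(3) by simp
    qed
  qed
  ultimately show ?thesis by simp
qed

section \<open>Duality\<close>

definition osign :: "real \<Rightarrow> partition \<Rightarrow> real" where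
  "osign \<alpha> \<kappa> = (\<Prod>k\<in>#parts \<kappa>. (- 1) ^ (k - 1) * \<alpha>)"

definition omega :: "real \<Rightarrow> sym \<Rightarrow> sym" where
  "omega \<alpha> = lin (\<lambda>\<kappa>. Poly_Mapping.single \<kappa> (osign \<alpha> \<kappa>))"

text \<open>\<open>omega\<close> sends p_k to - \<alpha> times the power sum of the negated
  variables; accordingly \<open>w\<close> goes to - w.\<close>

definition womega :: "real \<Rightarrow> wsym \<Rightarrow> wsym" where
  "womega \<alpha> = lin (\<lambda>(a, \<kappa>). Poly_Mapping.single (a, \<kappa>) ((- 1) ^ Suc a * osign \<alpha> \<kappa>))"

lemma linear_omega: "linear (omega \<alpha>)" and linear_womega: "linear (womega \<alpha>)"
  by (simp_all add: omega_def womega_def)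

lemma osign_add: "k > 0 \<Longrightarrow> osign \<alpha> (\<kappa> + single_part k) = (- 1) ^ (k - 1) * \<alpha> * osign \<alpha> \<kappa>"
  by (simp add: osign_def)

lemma osign_remove:
  assumes "k \<in># parts \<kappa>" shows "osign \<alpha> \<kappa> = (- 1) ^ (k - 1) * \<alpha> * osign \<alpha> (\<kappa> - single_part k)"
proof -
  have "\<kappa> = (\<kappa> - single_part k) + single_part k" using partition_diff_eq[OF assms] by blast
  then show ?thesis using osign_add[OF parts_pos[OF assms], of \<alpha> "\<kappa> - single_part k"] by simp
qed

text \<open>Each of the three parts of \<open>lax\<close> acquires the factor - \<alpha>; on the
  diagonal because \<alpha> - 1 = - \<alpha> (1/\<alpha> - 1).\<close>

lemma womega_lax:
  assumes "\<alpha> > 0" shows "womega \<alpha> (lax \<alpha> X) = (- \<alpha>) *\<^sub>R lax (1 / \<alpha>) (womega \<alpha> X)"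
proof (rule linear_ext_single[of "\<lambda>X. womega \<alpha> (lax \<alpha> X)" "\<lambda>X. (- \<alpha>) *\<^sub>R lax (1 / \<alpha>) (womega \<alpha> X)"])
  show "linear (\<lambda>X. womega \<alpha> (lax \<alpha> X))" by (intro linear_compose_fun[OF linear_womega] linear_lax)
  show "linear (\<lambda>X. (- \<alpha>) *\<^sub>R lax (1 / \<alpha>) (womega \<alpha> X))"
    by (intro linear_compose_scale_right linear_compose_fun[OF linear_lax] linear_womega)
  fix x :: "nat \<times> partition"
  obtain a \<kappa> where x: "x = (a, \<kappa>)" by force
  let ?t = "(- 1) ^ Suc a * osign \<alpha> \<kappa>"
  have 1: "(\<Sum>k\<in>#parts \<kappa>. womega \<alpha> (Poly_Mapping.single (a + k, \<kappa> - single_part k) (\<alpha> * real k))) =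
      (\<Sum>k\<in>#parts \<kappa>. (- \<alpha> * ?t) *\<^sub>R Poly_Mapping.single (a + k, \<kappa> - single_part k) (1 / \<alpha> * real k))"
  proof (intro arg_cong[where f = sum_mset] image_mset_cong)
    fix k assume k: "k \<in># parts \<kappa>"
    obtain m where m: "k = Suc m" using parts_pos[OF k] by (cases k) auto
    show "womega \<alpha> (Poly_Mapping.single (a + k, \<kappa> - single_part k) (\<alpha> * real k)) =
        (- \<alpha> * ?t) *\<^sub>R Poly_Mapping.single (a + k, \<kappa> - single_part k) (1 / \<alpha> * real k)"
      using assms by (simp add: womega_def scaleR_single osign_remove[OF k] m power_add)
        (simp add: field_simps power_add)
  qed
  have 2: "(\<Sum>b\<in>{1..a}. womega \<alpha> (Poly_Mapping.single (a - b, \<kappa> + single_part b) 1)) =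
      (\<Sum>b\<in>{1..a}. (- \<alpha> * ?t) *\<^sub>R Poly_Mapping.single (a - b, \<kappa> + single_part b) 1)"
  proof (intro sum.cong refl)
    fix b assume b: "b \<in> {1..a}"
    then have "(- 1) ^ Suc (a - b) * (- 1) ^ (b - 1) = ((- 1) ^ a :: real)"
      by (simp add: power_add[symmetric] del: power_Suc)
    then have "(- 1) ^ Suc (a - b) * ((- 1) ^ (b - 1) * \<alpha> * osign \<alpha> \<kappa>) = (- 1) ^ a * \<alpha> * osign \<alpha> \<kappa>"
      by (metis mult.assoc)
    then show "womega \<alpha> (Poly_Mapping.single (a - b, \<kappa> + single_part b) 1) =
        (- \<alpha> * ?t) *\<^sub>R Poly_Mapping.single (a - b, \<kappa> + single_part b) 1"
      using b by (simp add: womega_def scaleR_single osign_add mult_ac)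
  qed
  have 3: "womega \<alpha> (Poly_Mapping.single (a, \<kappa>) ((\<alpha> - 1) * real (a + 1))) =
      (- \<alpha> * ?t) *\<^sub>R Poly_Mapping.single (a, \<kappa>) ((1 / \<alpha> - 1) * real (a + 1))"
  proof -
    have "- \<alpha> * (1 / \<alpha> - 1) = \<alpha> - 1" using assms by (simp add: right_diff_distrib)
    then have "(\<alpha> - 1) * real (a + 1) * ?t = - \<alpha> * (1 / \<alpha> - 1) * real (a + 1) * ?t" by (simp only:)
    also have "\<dots> = - \<alpha> * ?t * ((1 / \<alpha> - 1) * real (a + 1))" by (simp only: mult_ac)
    finally show ?thesis by (simp only: womega_def lin_single prod.case scaleR_single)
  qed
  have "womega \<alpha> (lax \<alpha> (Poly_Mapping.single x 1)) = (- \<alpha> * ?t) *\<^sub>R lax_basis (1 / \<alpha>) x"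
    unfolding x lax_def lin_single scaleR_one lax_basis_def prod.case linear_add[OF linear_womega]
      linear_sum_mset[OF linear_womega] linear_sum[OF linear_womega] 1 2 3
    by (simp only: scaleR_add_right scaleR_sum_mset[symmetric] scaleR_sum_right[symmetric])
  also have "\<dots> = (- \<alpha>) *\<^sub>R lax (1 / \<alpha>) (womega \<alpha> (Poly_Mapping.single x 1))"
    by (simp add: x lax_def womega_def)
  finally show "womega \<alpha> (lax \<alpha> (Poly_Mapping.single x 1)) = (- \<alpha>) *\<^sub>R lax (1 / \<alpha>) (womega \<alpha> (Poly_Mapping.single x 1))" .
qed

lemma womega_wopen:
  assumes "\<alpha> > 0" shows "womega \<alpha> (wopen \<alpha> F) = (- \<alpha>) *\<^sub>R wopen (1 / \<alpha>) (omega \<alpha> F)"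
proof (rule linear_ext_single[of "\<lambda>F. womega \<alpha> (wopen \<alpha> F)" "\<lambda>F. (- \<alpha>) *\<^sub>R wopen (1 / \<alpha>) (omega \<alpha> F)"])
  show "linear (\<lambda>F. womega \<alpha> (wopen \<alpha> F))" by (intro linear_compose_fun[OF linear_womega] linear_wopen)
  show "linear (\<lambda>F. (- \<alpha>) *\<^sub>R wopen (1 / \<alpha>) (omega \<alpha> F))"
    by (intro linear_compose_scale_right linear_compose_fun[OF linear_wopen] linear_omega)
  fix \<kappa> :: partition
  have "(\<Sum>k\<in>#parts \<kappa>. womega \<alpha> (Poly_Mapping.single (k - 1, \<kappa> - single_part k) (\<alpha> * real k))) =
      (\<Sum>k\<in>#parts \<kappa>. (- \<alpha> * osign \<alpha> \<kappa>) *\<^sub>R Poly_Mapping.single (k - 1, \<kappa> - single_part k) (1 / \<alpha> * real k))"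
  proof (intro arg_cong[where f = sum_mset] image_mset_cong)
    fix k assume k: "k \<in># parts \<kappa>"
    obtain m where m: "k = Suc m" using parts_pos[OF k] by (cases k) auto
    show "womega \<alpha> (Poly_Mapping.single (k - 1, \<kappa> - single_part k) (\<alpha> * real k)) =
        (- \<alpha> * osign \<alpha> \<kappa>) *\<^sub>R Poly_Mapping.single (k - 1, \<kappa> - single_part k) (1 / \<alpha> * real k)"
      using assms by (simp add: womega_def scaleR_single osign_remove[OF k] m) (simp add: mult_ac)
  qed
  then have "womega \<alpha> (wopen_basis \<alpha> \<kappa>) = (- \<alpha> * osign \<alpha> \<kappa>) *\<^sub>R wopen_basis (1 / \<alpha>) \<kappa>"
    unfolding wopen_basis_def linear_sum_mset[OF linear_womega] by (simp only: scaleR_sum_mset)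
  then show "womega \<alpha> (wopen \<alpha> (Poly_Mapping.single \<kappa> 1)) = (- \<alpha>) *\<^sub>R wopen (1 / \<alpha>) (omega \<alpha> (Poly_Mapping.single \<kappa> 1))"
    by (simp add: wopen_def omega_def)
qed

lemma omega_wclose: "omega \<alpha> (wclose X) = (- \<alpha>) *\<^sub>R wclose (womega \<alpha> X)"
proof (rule linear_ext_single[of "\<lambda>X. omega \<alpha> (wclose X)" "\<lambda>X. (- \<alpha>) *\<^sub>R wclose (womega \<alpha> X)"])
  show "linear (\<lambda>X. omega \<alpha> (wclose X))" by (intro linear_compose_fun[OF linear_omega] linear_wclose)
  show "linear (\<lambda>X. (- \<alpha>) *\<^sub>R wclose (womega \<alpha> X))"
    by (intro linear_compose_scale_right linear_compose_fun[OF linear_wclose] linear_womega)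
  fix x :: "nat \<times> partition"
  obtain a \<kappa> where x: "x = (a, \<kappa>)" by force
  show "omega \<alpha> (wclose (Poly_Mapping.single x 1)) = (- \<alpha>) *\<^sub>R wclose (womega \<alpha> (Poly_Mapping.single x 1))"
    using osign_add[of "Suc a" \<alpha> \<kappa>] by (simp add: x omega_def wclose_def womega_def scaleR_single mult_ac)
qed

text \<open>One factor - \<alpha> for each of \<open>wopen\<close>, \<open>wclose\<close> and the
  \<open>l\<close> copies of \<open>lax\<close>.\<close>

lemma omega_ham:
  assumes "\<alpha> > 0" shows "omega \<alpha> (ham \<alpha> l F) = (- \<alpha>) ^ (l + 2) *\<^sub>R ham (1 / \<alpha>) l (omega \<alpha> F)"
proof -
  have "womega \<alpha> ((lax \<alpha> ^^ l) X) = (- \<alpha>) ^ l *\<^sub>R (lax (1 / \<alpha>) ^^ l) (womega \<alpha> X)" for X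
    by (induction l) (simp_all add: womega_lax[OF assms] linear_scale[OF linear_lax])
  then show ?thesis
    by (simp add: ham_def omega_wclose womega_wopen[OF assms] linear_scale[OF linear_wclose]
        linear_scale[OF linear_funpow[OF linear_lax]] linear_neg[OF linear_wclose]
        linear_neg[OF linear_funpow[OF linear_lax]])
qed

lemma lookup_omega: "Poly_Mapping.lookup (omega \<alpha> F) \<kappa> = osign \<alpha> \<kappa> * Poly_Mapping.lookup F \<kappa>"
proof (rule linear_ext_single[of "\<lambda>F. Poly_Mapping.lookup (omega \<alpha> F) \<kappa>" "\<lambda>F. osign \<alpha> \<kappa> * Poly_Mapping.lookup F \<kappa>"])
  show "linear (\<lambda>F. Poly_Mapping.lookup (omega \<alpha> F) \<kappa>)"
    by (rule linearI) (simp_all add: linear_add[OF linear_omega] linear_scale[OF linear_omega] lookup_add)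
  show "linear (\<lambda>F :: sym. osign \<alpha> \<kappa> * Poly_Mapping.lookup F \<kappa>)"
    by (rule linearI) (simp_all add: lookup_add distrib_left)
qed (auto simp: omega_def lookup_single when_def)

lemma spec_omega: "spec v (omega \<alpha> F) = spec (\<lambda>k. (- 1) ^ (k - 1) * \<alpha> * v k) F"
proof (rule linear_ext_single[of "\<lambda>F. spec v (omega \<alpha> F)"])
  show "linear (\<lambda>F. spec v (omega \<alpha> F))" by (intro linear_compose_fun[OF linear_spec] linear_omega)
qed (auto simp: linear_spec omega_def spec_single osign_def prod_mset.distrib)

text \<open>By \<open>omega_ham\<close> the image is a joint eigenvector for 1/\<alpha>, and as
  eigenvalues separate multisets only one \<open>jackP\<close> occurs in it. The coefficients at
  \<open>ones\<close>, positive on both sides, fix the sign of \<open>c\<close>.\<close>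

theorem omega_jackP:
  assumes "\<alpha> > 0" "0 \<notin># B"
  shows "\<exists>A c. 0 \<notin># A \<and> c > 0 \<and> omega \<alpha> (jackP \<alpha> B) = c *\<^sub>R jackP (1 / \<alpha>) A"
proof -
  define \<beta> where "\<beta> = 1 / \<alpha>"
  have \<beta>: "\<beta> > 0" using assms(1) by (simp add: \<beta>_def)
  let ?X = "omega \<alpha> (jackP \<alpha> B)"
  define e where "e l = eig \<alpha> l B / (- \<alpha>) ^ (l + 2)" for l
  have hX: "ham \<beta> l ?X = e l *\<^sub>R ?X" for l
  proof -
    have "(- \<alpha>) ^ (l + 2) *\<^sub>R ham \<beta> l ?X = eig \<alpha> l B *\<^sub>R ?X"
      unfolding \<beta>_def omega_ham[OF assms(1), symmetric] ham_jackP[OF assms] linear_scale[OF linear_omega] ..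
    then have "(1 / (- \<alpha>) ^ (l + 2)) *\<^sub>R (- \<alpha>) ^ (l + 2) *\<^sub>R ham \<beta> l ?X = (1 / (- \<alpha>) ^ (l + 2)) *\<^sub>R eig \<alpha> l B *\<^sub>R ?X"
      by simp
    then show ?thesis using assms(1) by (simp add: e_def)
  qed
  let ?n = "sum_mset B"
  have "osign \<alpha> (ones ?n) > 0" using assms(1) by (simp add: osign_def parts_ones)
  then have look: "Poly_Mapping.lookup ?X (ones ?n) > 0" using jackP_ones_pos[OF assms] by (simp add: lookup_omega)
  have "symaug ` {A. 0 \<notin># A} \<subseteq> span (jackP \<beta> ` {A. 0 \<notin># A})"
  proof clarify
    fix A :: "nat multiset" assume "0 \<notin># A"
    then have "symaug A \<in> span (jackP \<beta> ` {C. dle C A})" by (rule symaug_span_jackP[OF \<beta>])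
    also have "\<dots> \<subseteq> span (jackP \<beta> ` {A. 0 \<notin># A})" by (intro span_mono) (auto dest: dle_no_zero)
    finally show "symaug A \<in> span (jackP \<beta> ` {A. 0 \<notin># A})" .
  qed
  then have "?X \<in> span (jackP \<beta> ` {A. 0 \<notin># A})"
    using span_minimal[OF _ subspace_span] symaug_span by blast
  then obtain T r where T: "finite T" "T \<subseteq> jackP \<beta> ` {A. 0 \<notin># A}" "?X = (\<Sum>s\<in>T. r s *\<^sub>R s)"
    unfolding span_explicit by blast
  obtain D where D: "D \<subseteq> {A. 0 \<notin># A}" "inj_on (jackP \<beta>) D" "T = jackP \<beta> ` D"
    using T(2) unfolding subset_image_inj by blast
  have finD: "finite D" using T(1) D(2,3) by (simp add: finite_image_iff)
  have D0: "\<And>A. A \<in> D \<Longrightarrow> 0 \<notin># A" using D(1) by blast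
  define c where "c A = r (jackP \<beta> A)" for A
  have X: "?X = (\<Sum>A\<in>D. c A *\<^sub>R jackP \<beta> A)" using T(3) D by (simp add: sum.reindex c_def)
  have eigA: "eig \<beta> l A = e l" if A: "A \<in> D" "c A \<noteq> 0" for A l
  proof -
    have "(\<Sum>A\<in>D. (c A * eig \<beta> l A) *\<^sub>R jackP \<beta> A) = ham \<beta> l ?X"
      unfolding X using D0 by (auto simp: linear_sum[OF linear_ham] linear_scale[OF linear_ham] ham_jackP[OF \<beta>] intro!: sum.cong)
    also have "\<dots> = e l *\<^sub>R ?X" by (rule hX)
    also have "\<dots> = (\<Sum>A\<in>D. (c A * e l) *\<^sub>R jackP \<beta> A)"
      unfolding X by (simp add: scaleR_sum_right mult.commute)
    finally have "jack_inner \<beta> (\<Sum>A\<in>D. (c A * eig \<beta> l A) *\<^sub>R jackP \<beta> A) (jackP \<beta> A) =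
        jack_inner \<beta> (\<Sum>A\<in>D. (c A * e l) *\<^sub>R jackP \<beta> A) (jackP \<beta> A)" by simp
    moreover have "jack_inner \<beta> (\<Sum>A\<in>D. (c A * eig \<beta> l A) *\<^sub>R jackP \<beta> A) (jackP \<beta> A) =
        c A * eig \<beta> l A * jack_inner \<beta> (jackP \<beta> A) (jackP \<beta> A)"
      by (rule jackP_expansion_inner[OF \<beta> finD D0 A(1)])
    moreover have "jack_inner \<beta> (\<Sum>A\<in>D. (c A * e l) *\<^sub>R jackP \<beta> A) (jackP \<beta> A) =
        c A * e l * jack_inner \<beta> (jackP \<beta> A) (jackP \<beta> A)"
      by (rule jackP_expansion_inner[OF \<beta> finD D0 A(1)])
    ultimately show ?thesis using jackP_norm_pos[OF \<beta> D0[OF A(1)]] A(2) by simp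
  qed
  have "\<exists>A\<in>D. c A \<noteq> 0"
  proof (rule ccontr)
    assume "\<not> ?thesis"
    then have "?X = 0" unfolding X by simp
    then show False using look by simp
  qed
  then obtain A where A: "A \<in> D" "c A \<noteq> 0" by blast
  have "c A' = 0" if "A' \<in> D" "A' \<noteq> A" for A'
    using eig_separates[OF \<beta> D0[OF that(1)] D0[OF A(1)]] eigA[OF that(1)] eigA[OF A] that(2) by metis
  then have "?X = (\<Sum>A'\<in>D. if A' = A then c A *\<^sub>R jackP \<beta> A else 0)"
    unfolding X by (intro sum.cong) auto
  then have XA: "?X = c A *\<^sub>R jackP \<beta> A" using finD A(1) by simp
  have eig0: "eig x 0 Y = x * real (sum_mset Y)" for x Y
    by (simp add: eig_def)
  \<comment> \<open>For \<open>l = 0\<close> the eigenvalue is the parameter times the size, so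
    \<open>A\<close> and \<open>B\<close> have equal size and the coefficients of the same power of
    p_1 can be compared.\<close>
  have "\<beta> * real (sum_mset A) = \<beta> * real ?n"
    using eigA[OF A, of 0] assms(1) by (simp add: e_def eig0 \<beta>_def power2_eq_square field_simps)
  then have "sum_mset A = ?n" using \<beta> by (simp only: mult_cancel_left of_nat_eq_iff less_irrefl) auto
  then have "c A * Poly_Mapping.lookup (jackP \<beta> A) (ones (sum_mset A)) > 0" using look by (simp add: XA)
  then have "c A > 0" using jackP_ones_pos[OF \<beta> D0[OF A(1)]] by (simp add: zero_less_mult_iff)
  then show ?thesis using XA D0[OF A(1)] by (auto simp: \<beta>_def)
qed

lemma totally_jack_positive_dual:
  assumes "totally_jack_positive v" "\<alpha> > 0"
  shows "spec (\<lambda>k. (- 1) ^ (k - 1) * \<alpha> * v k) (jack \<alpha> \<kappa>) \<ge> 0"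
proof -
  obtain A c where A: "0 \<notin># A" "c > 0" "omega \<alpha> (jackP \<alpha> (parts \<kappa>)) = c *\<^sub>R jackP (1 / \<alpha>) A"
    using omega_jackP[OF assms(2) zero_notin_parts] by blast
  have "spec v (jackP (1 / \<alpha>) A) \<ge> 0"
    using assms by (intro jackP_nonneg A totally_jack_positive_aug) auto
  then show ?thesis
    using A(2) by (subst jack_nonneg_iff[OF assms(2)], subst spec_omega[symmetric], subst A(3)) (simp add: spec_scaleR)
qed

section \<open>The refined assumption\<close>

text \<open>Arm and leg of a box are nonnegative; for the leg, the first \<open>i\<close> rows all
  reach column \<open>j\<close>.\<close>

lemma jack_norm_pos:
  assumes "\<alpha> > 0" shows "jack_norm \<alpha> \<kappa> > 0"
  unfolding jack_norm_def
proof (rule prod_pos)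
  fix x assume "x \<in> boxes \<kappa>"
  then obtain i j where x: "x = (i, j)" and b: "1 \<le> i" "i \<le> plen \<kappa>" "1 \<le> j" "j \<le> row \<kappa> i"
    by (auto simp: boxes_def)
  have j: "j \<le> rows \<kappa> ! (i - 1)" using b by (simp add: row_def rows_def)
  have "{#p \<in># mset (take i (rows \<kappa>)). j \<le> p#} = mset (take i (rows \<kappa>))"
  proof -
    have "j \<le> p" if "p \<in> set (take i (rows \<kappa>))" for p
    proof -
      obtain m where m: "m < i" "p = rows \<kappa> ! m" using \<open>p \<in> set _\<close> by (auto simp: in_set_conv_nth)
      have "rows \<kappa> ! (i - 1) \<le> rows \<kappa> ! m"
        using sorted_rows[of \<kappa>] m b by (cases "m = i - 1") (auto simp: sorted_wrt_iff_nth_less length_rows)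
      then show ?thesis using j m by simp
    qed
    then have "filter (\<lambda>p. j \<le> p) (take i (rows \<kappa>)) = take i (rows \<kappa>)" unfolding filter_id_conv by blast
    then show ?thesis by (simp only: mset_filter[symmetric])
  qed
  moreover have "parts \<kappa> = mset (take i (rows \<kappa>)) + mset (drop i (rows \<kappa>))"
    by (metis append_take_drop_id mset_append mset_rows)
  ultimately have "size (mset (take i (rows \<kappa>))) \<le> col \<kappa> j"
    unfolding col_def by simp
  then have "real i \<le> real (col \<kappa> j)" using b by (simp add: length_rows)
  moreover have "\<alpha> * (real (row \<kappa> i) - real j) \<ge> 0" using b assms by simp
  ultimately show "0 < (case x of (i, j) \<Rightarrow>
      (\<alpha> * (real (row \<kappa> i) - real j) + (real (col \<kappa> j) - real i) + 1) *
      (\<alpha> * (real (row \<kappa> i) - real j) + (real (col \<kappa> j) - real i) + \<alpha>))"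
    unfolding x prod.case using assms by (intro mult_pos_pos) linarith+
qed

lemma jack_measure_nonneg:
  assumes "\<alpha> > 0" "u > 0" "spec (\<lambda>k. u * v k) (jack \<alpha> \<kappa>) \<ge> 0"
  shows "jack_measure \<alpha> u v \<kappa> \<ge> 0"
  unfolding jack_measure_def using assms jack_norm_pos[OF assms(1), of \<kappa>] by simp

text \<open>Rounding up changes \<open>g * real d\<close> by at most 1. The resulting errors are
  smaller than required by a factor of order 1/d in the first relation and 1/sqrt d in the
  second.\<close>

lemma ceiling_asymptotics:
  fixes g :: real assumes "g > 0"
  defines "u \<equiv> \<lambda>d :: nat. real_of_int \<lceil>g * real d\<rceil>"
  shows "(\<lambda>d. g\<^sup>2 * real d / (u d)\<^sup>2 - 1 / real d) \<in> o(\<lambda>d. 1 / real d)"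
    and "(\<lambda>d. (g\<^sup>2 * real d - 1) / u d - g) \<in> o(\<lambda>d. 1 / sqrt (real d))"
proof -
  have u: "g * real d \<le> u d" "u d \<le> g * real d + 1" for d
    unfolding u_def by linarith+
  have pos: "eventually (\<lambda>d::nat. d > 0) sequentially" by (rule eventually_gt_at_top)
  have ud: "(\<lambda>d. u d / real d) \<longlonglongrightarrow> g"
  proof (rule tendsto_sandwich[of "\<lambda>_. g"])
    show "eventually (\<lambda>d. g \<le> u d / real d) sequentially"
      using pos by eventually_elim (use u in \<open>simp add: field_simps\<close>)
    show "eventually (\<lambda>d. u d / real d \<le> g + 1 / real d) sequentially"
      using pos by eventually_elim (use u in \<open>simp add: field_simps\<close>)
    show "(\<lambda>d. g + 1 / real d) \<longlonglongrightarrow> g" by real_asymp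
  qed simp
  show "(\<lambda>d. g\<^sup>2 * real d / (u d)\<^sup>2 - 1 / real d) \<in> o(\<lambda>d. 1 / real d)"
  proof (rule smalloI_tendsto)
    have "(\<lambda>d. g\<^sup>2 / (u d / real d)\<^sup>2 - 1) \<longlonglongrightarrow> g\<^sup>2 / g\<^sup>2 - 1"
      using assms(1) by (intro tendsto_intros ud) auto
    moreover have "eventually (\<lambda>d. (g\<^sup>2 * real d / (u d)\<^sup>2 - 1 / real d) / (1 / real d) = g\<^sup>2 / (u d / real d)\<^sup>2 - 1) sequentially"
      using pos by eventually_elim (simp add: field_simps power2_eq_square)
    ultimately show "(\<lambda>d. (g\<^sup>2 * real d / (u d)\<^sup>2 - 1 / real d) / (1 / real d)) \<longlonglongrightarrow> 0"
      using assms(1) by (simp add: tendsto_cong)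
    show "eventually (\<lambda>d. 1 / real d \<noteq> 0) sequentially" using pos by eventually_elim simp
  qed
  show "(\<lambda>d. (g\<^sup>2 * real d - 1) / u d - g) \<in> o(\<lambda>d. 1 / sqrt (real d))"
  proof (rule smalloI_tendsto)
    show "(\<lambda>d. ((g\<^sup>2 * real d - 1) / u d - g) / (1 / sqrt (real d))) \<longlonglongrightarrow> 0"
    proof (rule Lim_null_comparison)
      \<comment> \<open>The numerator 1 + g collects the constant 1 and \<open>g\<close> times the
        rounding error; the denominator is the lower bound of \<open>u d\<close>.\<close>
      show "(\<lambda>d. (1 + g) / (g * real d) * sqrt (real d)) \<longlonglongrightarrow> 0" using assms(1) by real_asymp
      show "eventually (\<lambda>d. norm (((g\<^sup>2 * real d - 1) / u d - g) / (1 / sqrt (real d))) \<le>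
          (1 + g) / (g * real d) * sqrt (real d)) sequentially"
        using pos
      proof eventually_elim
        case (elim d)
        have gd: "g * real d > 0" using elim assms(1) by simp
        have up: "u d > 0" using gd u(1)[of d] by linarith
        have "g * (g * real d) \<le> g * u d" "g * u d \<le> g * (g * real d + 1)"
          using u[of d] assms(1) by (intro mult_left_mono; simp)+
        then have "\<bar>g * (g * real d) - 1 - g * u d\<bar> \<le> 1 + g"
          using assms(1) unfolding distrib_left by linarith
        then have "\<bar>g\<^sup>2 * real d - 1 - g * u d\<bar> \<le> 1 + g"
          by (simp only: power2_eq_square mult.assoc)
        then have "\<bar>g\<^sup>2 * real d - 1 - g * u d\<bar> / u d \<le> (1 + g) / (g * real d)"
          using gd u(1)[of d] assms(1) by (intro frac_le) auto
        moreover have "\<bar>(g\<^sup>2 * real d - 1) / u d - g\<bar> = \<bar>g\<^sup>2 * real d - 1 - g * u d\<bar> / u d"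
        proof -
          have "(g\<^sup>2 * real d - 1) / u d - g = (g\<^sup>2 * real d - 1 - g * u d) / u d"
            using up by (simp add: diff_divide_distrib)
          then show ?thesis using up by (simp add: abs_divide)
        qed
        ultimately have "\<bar>(g\<^sup>2 * real d - 1) / u d - g\<bar> * sqrt (real d) \<le> (1 + g) / (g * real d) * sqrt (real d)"
          by (intro mult_right_mono) simp_all
        then show ?case by (simp add: abs_mult)
      qed
    qed
    show "eventually (\<lambda>d. 1 / sqrt (real d) \<noteq> 0) sequentially" using pos by eventually_elim simp
  qed
qed

text \<open>\<open>u\<close> is a positive integer, so \<open>totally_jack_positive_multiple\<close>
  covers exactly the scaled sequence in the measure.\<close>

theorem refined_assumption_pos:
  assumes "g > 0" "totally_jack_positive v" "k \<ge> 1" "v k \<noteq> 0"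
  shows "refined_assumption g 0 v (\<lambda>d. g\<^sup>2 * real d) (\<lambda>d. real_of_int \<lceil>g * real d\<rceil>)"
  unfolding refined_assumption_def
proof (intro conjI allI impI)
  fix d :: nat assume d: "d \<ge> 1"
  have gd: "g * real d > 0" using d assms(1) by simp
  show \<alpha>: "0 < g\<^sup>2 * real d" and u: "0 < real_of_int \<lceil>g * real d\<rceil>" using d assms(1) gd by auto
  fix \<kappa>
  obtain n where n: "real_of_int \<lceil>g * real d\<rceil> = real n" "n > 0"
    using u by (metis of_int_0_less_iff of_int_of_nat_eq of_nat_0_less_iff zero_less_imp_eq_int)
  show "0 \<le> jack_measure (g\<^sup>2 * real d) (real_of_int \<lceil>g * real d\<rceil>) v \<kappa>"
    using totally_jack_positive_multiple[OF assms(2) n(2)] \<alpha> u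
    by (intro jack_measure_nonneg) (auto simp: totally_jack_positive_def n(1))
next
  show "0 < v 1" using totally_jack_positive_first[OF assms(2-4)] .
qed (use ceiling_asymptotics[OF assms(1)] in simp_all)

text \<open>\<open>u\<close> is \<alpha> times an integer n. The duality applied to n times
  \<open>twist v\<close> gives n \<alpha> \<open>v\<close>, because the two sign changes cancel, and
  this is \<open>u\<close> times \<open>v\<close>.\<close>

theorem refined_assumption_neg:
  assumes "g < 0" "totally_jack_positive (twist v)" "k \<ge> 1" "v k \<noteq> 0"
  shows "refined_assumption g 0 v (\<lambda>d. 1 / (g\<^sup>2 * real d)) (\<lambda>d. real_of_int \<lceil>- g * real d\<rceil> / (g\<^sup>2 * real d))"
  unfolding refined_assumption_def
proof (intro conjI allI impI)
  fix d :: nat assume d: "d \<ge> 1"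
  have gd: "- g * real d > 0" "g\<^sup>2 * real d > 0" using d assms(1) by (auto simp: mult_neg_pos)
  then have N: "0 < real_of_int \<lceil>- g * real d\<rceil>" by (simp only: of_int_0_less_iff zero_less_ceiling)
  show \<alpha>: "0 < 1 / (g\<^sup>2 * real d)" using gd by simp
  show u: "0 < real_of_int \<lceil>- g * real d\<rceil> / (g\<^sup>2 * real d)" using gd N by (intro divide_pos_pos)
  fix \<kappa>
  obtain n where n: "real_of_int \<lceil>- g * real d\<rceil> = real n" "n > 0"
    using N by (metis of_int_0_less_iff of_int_of_nat_eq of_nat_0_less_iff zero_less_imp_eq_int)
  have "(- 1) ^ (k - 1) * (1 / (g\<^sup>2 * real d)) * (real n * twist v k) = real_of_int \<lceil>- g * real d\<rceil> / (g\<^sup>2 * real d) * v k" for k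
    unfolding n(1) by (simp add: twist_def power_mult_distrib[symmetric])
  then show "0 \<le> jack_measure (1 / (g\<^sup>2 * real d)) (real_of_int \<lceil>- g * real d\<rceil> / (g\<^sup>2 * real d)) v \<kappa>"
    using totally_jack_positive_dual[OF totally_jack_positive_multiple[OF assms(2) n(2)] \<alpha>, of \<kappa>] \<alpha> u
    by (intro jack_measure_nonneg) (simp_all only:)
next
  have "twist v k \<noteq> 0" using assms(4) by (simp add: twist_def)
  from totally_jack_positive_first[OF assms(2,3) this] show "0 < v 1" by (simp add: twist_def)
next
  let ?N = "\<lambda>d. real_of_int \<lceil>- g * real d\<rceil>"
  have g: "- g > 0" using assms(1) by simp
  \<comment> \<open>Both quantities reduce to those of the positive case for - g: with u = \<alpha>
    N, \<alpha> / u^2 is (1/\<alpha>) / N^2 and (\<alpha> - 1) / u is - (1/\<alpha> - 1) /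
    N.\<close>
  have "1 / (g\<^sup>2 * real d) / (?N d / (g\<^sup>2 * real d))\<^sup>2 = (- g)\<^sup>2 * real d / (?N d)\<^sup>2" for d
    using assms(1) by (cases "d = 0") (simp_all add: field_simps power2_eq_square)
  then show "(\<lambda>d. 1 / (g\<^sup>2 * real d) / (?N d / (g\<^sup>2 * real d))\<^sup>2 - 1 / real d) \<in> o(\<lambda>d. 1 / real d)"
    using ceiling_asymptotics(1)[OF g] by (simp only:)
  \<comment> \<open>\<open>h\<close> stands for 1/\<alpha>.\<close>
  have frac: "(1 / h - 1) / (N / h) = - ((h - 1) / N)" if "h \<noteq> 0" for h N :: real
  proof -
    have "(1 / h - 1) / (N / h) = ((1 / h - 1) * h) / N" by simp
    also have "(1 / h - 1) * h = - (h - 1)" using that by (simp add: left_diff_distrib)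
    also have "- (h - 1) / N = - ((h - 1) / N)" by (rule minus_divide_left[symmetric])
    finally show ?thesis .
  qed
  have "(1 / (g\<^sup>2 * real d) - 1) / (?N d / (g\<^sup>2 * real d)) - (g + 0 / sqrt (real d)) = - (((- g)\<^sup>2 * real d - 1) / ?N d - (- g))" for d
  proof (cases "d = 0")
    case False
    then show ?thesis using assms(1) by (subst frac) auto
  qed simp
  then show "(\<lambda>d. (1 / (g\<^sup>2 * real d) - 1) / (?N d / (g\<^sup>2 * real d)) - (g + 0 / sqrt (real d))) \<in> o(\<lambda>d. 1 / sqrt (real d))"
    using ceiling_asymptotics(2)[OF g] by (simp only: landau_o.small.uminus_in_iff)
qed

text \<open>The zero sequence determines a totally Jack-positive specialization, yet
  \<open>v 1 > 0\<close> fails for it; \<open>nonzero\<close> excludes this case.\<close>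

theorem proposition4p6:
  fixes g :: real and v :: "nat \<Rightarrow> real"
  assumes "admissible g v"
    and nonzero: "\<exists>k\<ge>1. v k \<noteq> 0"
  shows "(\<exists>\<alpha> u :: nat \<Rightarrow> real. refined_assumption g 0 v \<alpha> u) \<and>
    (g > 0 \<longrightarrow> refined_assumption g 0 v
       (\<lambda>d. g\<^sup>2 * real d)
       (\<lambda>d. real_of_int \<lceil>g * real d\<rceil>)) \<and>
    (g < 0 \<longrightarrow> refined_assumption g 0 v
       (\<lambda>d. 1 / (g\<^sup>2 * real d))
       (\<lambda>d. real_of_int \<lceil>- g * real d\<rceil> / (g\<^sup>2 * real d)))"
proof -
  obtain k where k: "k \<ge> 1" "v k \<noteq> 0" using nonzero by blast
  from assms(1) consider "g > 0" "totally_jack_positive v" | "g < 0" "totally_jack_positive (twist v)"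
    unfolding admissible_def by blast
  then show ?thesis
  proof cases
    case 1
    then show ?thesis using refined_assumption_pos[OF 1 k] by auto
  next
    case 2
    then show ?thesis using refined_assumption_neg[OF 2 k] by auto
  qed
qed

end
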